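(* Consider the $d$-dimensional renewal model with $r$ heterogeneous claim types described in the context. Assume that for some $\alpha>0$, $\overline{F_k^j}\in\mathcal{RV}_{-\alpha}$ for all $1\le k\le d$, $1\le j\le r$, and that $\overline{F_{k_1}^{j_1}}(x)\asymp\overline{F_{k_2}^{j_2}}(x)$ for all $1\le k_1,k_2\le d$, $1\le j_1,j_2\le r$. Suppose there is some $\alpha^*>\alpha$ such that $\phi(\alpha^* )<0$. Then, as $x\to\infty$: (i) uniformly for all $t\in\Lambda$, $$\mathbb{P}(S_t>x)\sim\sum_{k=1}^d\sum_{j=1}^r\overline{F_k^j}(x)\int_{0-}^t e^{s\phi(\alpha)}\,\mathrm{d}\lambda_{k,s}^j;$$ (ii) for any fixed $T\in\Lambda$, uniformly for all $t\in\Lambda^T=\Lambda\cap[T,\infty]$, $$\mathbb{P}(D_t>x)\sim\sum_{k=1}^d\sum_{j=1}^r\overline{F_k^j}(x)\int_{0-}^t e^{s\phi(\alpha)}\,\mathrm{d}\lambda_{k,s}^j.$$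
   Context: Model. Let $d,r\ge1$ be integers. For $1\le k\le d$ (business line), $1\le j\le r$ (claim type), the nonnegative random variables $\{X_{ki}^j;i\ge1\}$ (claim sizes) have common distribution function $F_k^j$. All the variables $\{X_{ki}^j;\,i\ge1,1\le k\le d,1\le j\le r\}$ are pairwise asymptotically independent (PAI): any two distinct ones are asymptotically independent. Here two nonnegative unbounded random variables $Y_1,Y_2$ with distributions $G_1,G_2$ are asymptotically independent if $\lim_{x\to\infty}\mathbb{P}(Y_1>U_1(x),Y_2>U_2(x))/\mathbb{P}(Y_1>U_1(x))=0$, where $U_i=(1/\overline{G_i})^{\gets}$ and $g^{\gets}(x)=\inf\{y:g(y)\ge x\}$. For each $k$, $\{(\theta_{ki}^1,\dots,\theta_{ki}^r);i\ge1\}$ is an i.i.d. sequence of nonnegative random vectors, with arbitrary dependence among the components of each vector; each $\theta_{ki}^j$ is not almost surely $0$. Put $\tau_{ki}^j=\sum_{h=1}^i\theta_{kh}^j$, $\tau_{k0}^j=0$, $N_{k,t}^j=\sup\{m\ge0:\tau_{km}^j\le t\}$ and $\lambda_{k,t}^j=\mathbb{E}[N_{k,t}^j]=\sum_{i\ge1}\mathbb{P}(\tau_{ki}^j\le t)$. $\{R_t\}_{t\ge0}$ is a real-valued càdlàg Lévy process with $\mathbb{E}[R_1]>0$ and Laplace exponent $\phi(a)=\log\mathbb{E}[e^{-aR_1}]$. The family of all claim sizes, the inter-arrival vector sequences of the different business lines, and the process $\{R_t\}$ are mutually independent. With constants $c_k>0$, for $0\le t\le\infty$, $$Z_{k,t}=\sum_{j=1}^r\sum_{i=1}^\infty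 X_{ki}^je^{-R_{\tau_{ki}^j}}\mathbf{1}_{\{\tau_{ki}^j\le t\}}-c_k\int_0^te^{-R_s}\mathrm{d}s,\qquad D_t=\sum_{k=1}^dZ_{k,t},$$ $$S_t=\sum_{k=1}^d\sum_{j=1}^r\sum_{i=1}^\infty X_{ki}^je^{-R_{\tau_{ki}^j}}\mathbf{1}_{\{\tau_{ki}^j\le t\}}.$$ Let $\Lambda=\{t\in[0,\infty]:0<\lambda_{k,t}^j\le\infty\text{ for all }1\le k\le d,1\le j\le r\}$ (so $\infty\in\Lambda$). The integral $\int_{0-}^t$ includes a possible atom at $0$: $\int_{0-}^te^{s\phi(\alpha)}\mathrm{d}\lambda_{k,s}^j=\sum_{i\ge1}\mathbb{E}[e^{\phi(\alpha)\tau_{ki}^j}\mathbf{1}_{\{\tau_{ki}^j\le t\}}]$. Notation. $\overline F=1-F$; $\overline F\in\mathcal{RV}_{-\alpha}$ means $\lim_{x\to\infty}\overline F(yx)/\overline F(x)=y^{-\alpha}$ for all $y>0$; $f\asymp g$ means $f=O(g)$ and $g=O(f)$ as $x\to\infty$. $f(x,t)\sim g(x,t)$ uniformly for $t\in\Delta$ means $\lim_{x\to\infty}\sup_{t\in\Delta}|f(x,t)/g(x,t)-1|=0$. *)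

theory Defs
  imports "HOL-Probability.Probability"
begin

section \<open>Tails\<close>

definition regularly_varying :: "real \<Rightarrow> (real \<Rightarrow> real) \<Rightarrow> bool" where
  "regularly_varying \<rho> f \<longleftrightarrow> (\<forall>y>0. ((\<lambda>x. f (y * x) / f x) \<longlongrightarrow> y powr \<rho>) at_top)"

definition tail :: "(real \<Rightarrow> real) \<Rightarrow> real \<Rightarrow> real" where
  "tail F x = 1 - F x"

definition left_inverse :: "(real \<Rightarrow> real) \<Rightarrow> real \<Rightarrow> real" where
  "left_inverse g x = Inf {y. g y \<ge> x}"

text \<open>For an unbounded variable the tail is strictly positive everywhere, so no division by zero
  occurs below.\<close>

definition (in prob_space) tail_quantile :: "('a \<Rightarrow> real) \<Rightarrow> real \<Rightarrow> real" where
  "tail_quantile Y = left_inverse (\<lambda>y. 1 / tail (cdf (distr M borel Y)) y)"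

definition (in prob_space) asymptotically_independent ::
  "('a \<Rightarrow> real) \<Rightarrow> ('a \<Rightarrow> real) \<Rightarrow> bool" where
  "asymptotically_independent Y Z \<longleftrightarrow>
     ((\<lambda>x. \<P>(\<omega> in M. Y \<omega> > tail_quantile Y x \<and> Z \<omega> > tail_quantile Z x)
          / \<P>(\<omega> in M. Y \<omega> > tail_quantile Y x)) \<longlongrightarrow> 0) at_top"

text \<open>\<open>uniform_limit\<close> says that the supremum over \<open>t \<in> \<Delta>\<close> of the distance between
  \<open>f x t / g x t\<close> and \<open>1\<close> tends to \<open>0\<close> as \<open>x\<close> tends to infinity.\<close>

definition uniformly_asymp_equiv ::
  "'t set \<Rightarrow> (real \<Rightarrow> 't \<Rightarrow> real) \<Rightarrow> (real \<Rightarrow> 't \<Rightarrow> real) \<Rightarrow> bool" where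
  "uniformly_asymp_equiv \<Delta> f g \<longleftrightarrow>
     uniform_limit \<Delta> (\<lambda>x t. f x t / g x t) (\<lambda>_. 1) at_top"


section \<open>Levy processes\<close>

definition cadlag :: "(real \<Rightarrow> real) \<Rightarrow> bool" where
  "cadlag f \<longleftrightarrow> (\<forall>t\<ge>0. continuous (at_right t) f) \<and> (\<forall>t>0. \<exists>l. (f \<longlongrightarrow> l) (at_left t))"

text \<open>The process is indexed by \<open>t \<ge> 0\<close>; values at negative times are irrelevant. All paths (not
  just almost all) are cadlag, which makes the discounted sums and integrals below measurable
  although \<open>M\<close> need not be complete.\<close>

definition (in prob_space) cadlag_levy_process :: "(real \<Rightarrow> 'a \<Rightarrow> real) \<Rightarrow> bool" where
  "cadlag_levy_process R \<longleftrightarrow>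
     (\<forall>t\<ge>0. random_variable borel (R t)) \<and>
     (AE \<omega> in M. R 0 \<omega> = 0) \<and>
     (\<forall>(n::nat) t. 0 \<le> t 0 \<longrightarrow> (\<forall>i<n. t i \<le> t (Suc i)) \<longrightarrow>
        indep_vars (\<lambda>_. borel) (\<lambda>i \<omega>. R (t (Suc i)) \<omega> - R (t i) \<omega>) {..<n}) \<and>
     (\<forall>s\<ge>0. \<forall>h\<ge>0. distr M borel (\<lambda>\<omega>. R (s + h) \<omega> - R s \<omega>) = distr M borel (R h)) \<and>
     (\<forall>\<omega>\<in>space M. cadlag (\<lambda>t. R t \<omega>))"

definition laplace_exponent :: "'a measure \<Rightarrow> (real \<Rightarrow> 'a \<Rightarrow> real) \<Rightarrow> real \<Rightarrow> ereal" where
  "laplace_exponent M R a =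
     (if integrable M (\<lambda>\<omega>. exp (- a * R 1 \<omega>))
      then ereal (ln (integral\<^sup>L M (\<lambda>\<omega>. exp (- a * R 1 \<omega>)))) else \<infinity>)"


section \<open>The renewal model\<close>

text \<open>Doubly and triply indexed objects take the business line \<open>k \<in> {1..d}\<close> first, then the claim
  type \<open>j \<in> {1..r}\<close>, then the number \<open>i \<ge> 1\<close> of the claim.\<close>

definition generated_sigma :: "'a measure \<Rightarrow> 'i set \<Rightarrow> ('i \<Rightarrow> 'a \<Rightarrow> real) \<Rightarrow> 'a set set" where
  "generated_sigma M I Y =
     sigma_sets (space M) {Y i -` A \<inter> space M | i A. i \<in> I \<and> A \<in> sets borel}"

datatype model_component = Claim_Sizes | Inter_Arrivals nat | Returns

definition component_sigma ::
  "'a measure \<Rightarrow> nat \<Rightarrow> nat \<Rightarrow> (nat \<Rightarrow> nat \<Rightarrow> nat \<Rightarrow> 'a \<Rightarrow> real) \<Rightarrow>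
   (nat \<Rightarrow> nat \<Rightarrow> nat \<Rightarrow> 'a \<Rightarrow> real) \<Rightarrow> (real \<Rightarrow> 'a \<Rightarrow> real) \<Rightarrow> model_component \<Rightarrow> 'a set set" where
  "component_sigma M d r X \<theta> R q = (case q of
     Claim_Sizes \<Rightarrow> generated_sigma M ({1..d} \<times> {1..r} \<times> {1..}) (\<lambda>(k, j, i). X k j i)
   | Inter_Arrivals k \<Rightarrow> generated_sigma M ({1..r} \<times> {1..}) (\<lambda>(j, i). \<theta> k j i)
   | Returns \<Rightarrow> generated_sigma M {0..} R)"

definition inter_arrival_vector ::
  "nat \<Rightarrow> (nat \<Rightarrow> nat \<Rightarrow> nat \<Rightarrow> 'a \<Rightarrow> real) \<Rightarrow> nat \<Rightarrow> nat \<Rightarrow> 'a \<Rightarrow> nat \<Rightarrow> real" where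
  "inter_arrival_vector r \<theta> k i \<omega> = (\<lambda>j\<in>{1..r}. \<theta> k j i \<omega>)"

locale renewal_model = prob_space M
  for M :: "'a measure" +
  fixes d r :: nat
    and X :: "nat \<Rightarrow> nat \<Rightarrow> nat \<Rightarrow> 'a \<Rightarrow> real"
    and F :: "nat \<Rightarrow> nat \<Rightarrow> real \<Rightarrow> real"
    and \<theta> :: "nat \<Rightarrow> nat \<Rightarrow> nat \<Rightarrow> 'a \<Rightarrow> real"
    and R :: "real \<Rightarrow> 'a \<Rightarrow> real"
    and c :: "nat \<Rightarrow> real"
  assumes d_ge_1: "d \<ge> 1" and r_ge_1: "r \<ge> 1"
    and claim_rv: "\<lbrakk>k \<in> {1..d}; j \<in> {1..r}; i \<ge> 1\<rbrakk> \<Longrightarrow> random_variable borel (X k j i)"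
    and claim_nonneg:
      "\<lbrakk>k \<in> {1..d}; j \<in> {1..r}; i \<ge> 1; \<omega> \<in> space M\<rbrakk> \<Longrightarrow> X k j i \<omega> \<ge> 0"
    and claim_cdf:
      "\<lbrakk>k \<in> {1..d}; j \<in> {1..r}; i \<ge> 1\<rbrakk> \<Longrightarrow> cdf (distr M borel (X k j i)) = F k j"
    and claims_PAI:
      "\<lbrakk>k \<in> {1..d}; j \<in> {1..r}; i \<ge> 1; k' \<in> {1..d}; j' \<in> {1..r}; i' \<ge> 1;
        (k, j, i) \<noteq> (k', j', i')\<rbrakk> \<Longrightarrow> asymptotically_independent (X k j i) (X k' j' i')"
    and inter_arrival_rv:
      "\<lbrakk>k \<in> {1..d}; j \<in> {1..r}; i \<ge> 1\<rbrakk> \<Longrightarrow> random_variable borel (\<theta> k j i)"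
    and inter_arrival_nonneg:
      "\<lbrakk>k \<in> {1..d}; j \<in> {1..r}; i \<ge> 1; \<omega> \<in> space M\<rbrakk> \<Longrightarrow> \<theta> k j i \<omega> \<ge> 0"
    and inter_arrival_not_AE_0:
      "\<lbrakk>k \<in> {1..d}; j \<in> {1..r}; i \<ge> 1\<rbrakk> \<Longrightarrow> \<not> (AE \<omega> in M. \<theta> k j i \<omega> = 0)"
    and inter_arrival_indep:
      "k \<in> {1..d} \<Longrightarrow>
        indep_vars (\<lambda>_. \<Pi>\<^sub>M j\<in>{1..r}. borel) (inter_arrival_vector r \<theta> k) {1..}"
    and inter_arrival_ident:
      "\<lbrakk>k \<in> {1..d}; i \<ge> 1; i' \<ge> 1\<rbrakk> \<Longrightarrow>
        distr M (\<Pi>\<^sub>M j\<in>{1..r}. borel) (inter_arrival_vector r \<theta> k i) =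
        distr M (\<Pi>\<^sub>M j\<in>{1..r}. borel) (inter_arrival_vector r \<theta> k i')"
    and levy: "cadlag_levy_process R"
    \<comment> \<open>\<open>E[R\<^sub>1] > 0\<close>, comparing negative and positive parts: the expectation exists and may be
      infinite.\<close>
    and mean_return_pos:
      "(\<integral>\<^sup>+\<omega>. ennreal (- R 1 \<omega>) \<partial>M) < (\<integral>\<^sup>+\<omega>. ennreal (R 1 \<omega>) \<partial>M)"
    and components_indep:
      "indep_sets (component_sigma M d r X \<theta> R) ({Claim_Sizes, Returns} \<union> Inter_Arrivals ` {1..d})"
    and premium_pos: "k \<in> {1..d} \<Longrightarrow> c k > 0"


section \<open>Arrivals and renewal functions\<close>

definition arrival_time ::
  "(nat \<Rightarrow> nat \<Rightarrow> nat \<Rightarrow> 'a \<Rightarrow> real) \<Rightarrow> nat \<Rightarrow> nat \<Rightarrow> nat \<Rightarrow> 'a \<Rightarrow> real" where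
  "arrival_time \<theta> k j i \<omega> = (\<Sum>h=1..i. \<theta> k j h \<omega>)"

text \<open>Times range over \<open>ereal\<close>. For \<open>t < 0\<close> the supremum is over the empty set, that is \<open>0\<close>.\<close>

definition claim_count ::
  "(nat \<Rightarrow> nat \<Rightarrow> nat \<Rightarrow> 'a \<Rightarrow> real) \<Rightarrow> nat \<Rightarrow> nat \<Rightarrow> ereal \<Rightarrow> 'a \<Rightarrow> ennreal" where
  "claim_count \<theta> k j t \<omega> = (SUP m\<in>{m. ereal (arrival_time \<theta> k j m \<omega>) \<le> t}. of_nat m)"

definition renewal_function ::
  "'a measure \<Rightarrow> (nat \<Rightarrow> nat \<Rightarrow> nat \<Rightarrow> 'a \<Rightarrow> real) \<Rightarrow> nat \<Rightarrow> nat \<Rightarrow> ereal \<Rightarrow> ennreal" where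
  "renewal_function M \<theta> k j t = (\<integral>\<^sup>+\<omega>. claim_count \<theta> k j t \<omega> \<partial>M)"

text \<open>Lebesgue-Stieltjes integral with respect to the renewal function, which is finite,
  nondecreasing and right-continuous on the reals. Since it vanishes on the negative half-line,
  \<open>interval_measure\<close> gives the point \<open>0\<close> the mass \<open>renewal_function M \<theta> k j 0\<close>, so the integral
  over the closed interval is the one from \<open>0-\<close> to \<open>t\<close>.\<close>

definition renewal_integral ::
  "'a measure \<Rightarrow> (nat \<Rightarrow> nat \<Rightarrow> nat \<Rightarrow> 'a \<Rightarrow> real) \<Rightarrow> nat \<Rightarrow> nat \<Rightarrow> (real \<Rightarrow> real) \<Rightarrow> ereal \<Rightarrow> real"
  where
  "renewal_integral M \<theta> k j f t =
     (LINT s:{s. 0 \<le> s \<and> ereal s \<le> t}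
        | interval_measure (\<lambda>s. enn2real (renewal_function M \<theta> k j (ereal s))). f s)"

definition renewal_times ::
  "'a measure \<Rightarrow> nat \<Rightarrow> nat \<Rightarrow> (nat \<Rightarrow> nat \<Rightarrow> nat \<Rightarrow> 'a \<Rightarrow> real) \<Rightarrow> ereal set" where
  "renewal_times M d r \<theta> =
     {t. 0 \<le> t \<and> (\<forall>k\<in>{1..d}. \<forall>j\<in>{1..r}. 0 < renewal_function M \<theta> k j t)}"


section \<open>Discounted claims and net losses\<close>

text \<open>These take values in \<open>ennreal\<close> and \<open>ereal\<close>, so that the series and, at \<open>t = \<infinity>\<close>, the premium
  integral are meaningful without presupposing convergence.\<close>

definition discounted_claims ::
  "(nat \<Rightarrow> nat \<Rightarrow> nat \<Rightarrow> 'a \<Rightarrow> real) \<Rightarrow> (nat \<Rightarrow> nat \<Rightarrow> nat \<Rightarrow> 'a \<Rightarrow> real) \<Rightarrow> (real \<Rightarrow> 'a \<Rightarrow> real) \<Rightarrow>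
   nat \<Rightarrow> nat \<Rightarrow> ereal \<Rightarrow> 'a \<Rightarrow> ennreal" where
  "discounted_claims X \<theta> R k j t \<omega> =
     (\<Sum>n. let i = Suc n; \<tau> = arrival_time \<theta> k j i \<omega>
           in ennreal (X k j i \<omega> * exp (- R \<tau> \<omega>) * of_bool (ereal \<tau> \<le> t)))"

definition total_discounted_claims ::
  "nat \<Rightarrow> nat \<Rightarrow> (nat \<Rightarrow> nat \<Rightarrow> nat \<Rightarrow> 'a \<Rightarrow> real) \<Rightarrow> (nat \<Rightarrow> nat \<Rightarrow> nat \<Rightarrow> 'a \<Rightarrow> real) \<Rightarrow>
   (real \<Rightarrow> 'a \<Rightarrow> real) \<Rightarrow> ereal \<Rightarrow> 'a \<Rightarrow> ennreal" where
  "total_discounted_claims d r X \<theta> R t \<omega> =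
     (\<Sum>k=1..d. \<Sum>j=1..r. discounted_claims X \<theta> R k j t \<omega>)"

definition discount_integral :: "(real \<Rightarrow> 'a \<Rightarrow> real) \<Rightarrow> ereal \<Rightarrow> 'a \<Rightarrow> ennreal" where
  "discount_integral R t \<omega> =
     (\<integral>\<^sup>+s\<in>{s. 0 \<le> s \<and> ereal s \<le> t}. ennreal (exp (- R s \<omega>)) \<partial>lborel)"

definition line_net_loss ::
  "nat \<Rightarrow> (nat \<Rightarrow> nat \<Rightarrow> nat \<Rightarrow> 'a \<Rightarrow> real) \<Rightarrow> (nat \<Rightarrow> nat \<Rightarrow> nat \<Rightarrow> 'a \<Rightarrow> real) \<Rightarrow>
   (real \<Rightarrow> 'a \<Rightarrow> real) \<Rightarrow> (nat \<Rightarrow> real) \<Rightarrow> nat \<Rightarrow> ereal \<Rightarrow> 'a \<Rightarrow> ereal" where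
  "line_net_loss r X \<theta> R c k t \<omega> =
     enn2ereal (\<Sum>j=1..r. discounted_claims X \<theta> R k j t \<omega>)
     - ereal (c k) * enn2ereal (discount_integral R t \<omega>)"

definition net_loss ::
  "nat \<Rightarrow> nat \<Rightarrow> (nat \<Rightarrow> nat \<Rightarrow> nat \<Rightarrow> 'a \<Rightarrow> real) \<Rightarrow> (nat \<Rightarrow> nat \<Rightarrow> nat \<Rightarrow> 'a \<Rightarrow> real) \<Rightarrow>
   (real \<Rightarrow> 'a \<Rightarrow> real) \<Rightarrow> (nat \<Rightarrow> real) \<Rightarrow> ereal \<Rightarrow> 'a \<Rightarrow> ereal" where
  "net_loss d r X \<theta> R c t \<omega> = (\<Sum>k=1..d. line_net_loss r X \<theta> R c k t \<omega>)"

end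

theory Submission
  imports Defs "HOL-Real_Asymp.Real_Asymp"
begin

text \<open>
  By the principle of a single big jump, a weighted sum of asymptotically independent claims
  exceeds \<open>x\<close> essentially only if a single weighted claim does. Given the weight
  \<open>W = exp (- R \<tau>) 1 (\<tau> \<le> t)\<close> of a claim, which is independent of the claim sizes, regular variation
  gives \<open>P (X W > x) \<sim> tail F x E (W powr \<alpha>)\<close>, with an error controlled by
  \<open>E (W powr \<alpha>\<^sub>1 + W powr \<alpha>')\<close> for some \<open>\<alpha>\<^sub>1 < \<alpha>\<close>. By conditioning on \<open>\<tau>\<close> these moments decay
  geometrically in the number \<open>i\<close> of the claim, and they are at most a constant times
  \<open>q ^ i P (\<tau>\<^sub>1 \<le> t)\<close>. Since the asymptotic expression is at least a constant times
  \<open>tail F x P (\<tau>\<^sub>1 \<le> t)\<close>, all errors are relative, uniformly in \<open>t\<close>, including small \<open>t\<close>.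

  For the net loss, the total discounted premium is almost surely finite: the martingale
  \<open>exp (- \<alpha>' R s - s \<phi> \<alpha>')\<close> is almost surely bounded by a maximal inequality, so that
  \<open>exp (- R s)\<close> decays exponentially. Being independent of the claims, the premium is negligible
  on a fixed level \<open>\<delta> x\<close>, provided that \<open>P (\<tau>\<^sub>1 \<le> t)\<close> stays away from \<open>0\<close>.
\<close>

section \<open>Regular variation\<close>

text \<open>The obstacle is dependence. Weights are dependent among themselves and on the premium,
  and the claims are only pairwise asymptotically independent. What remains is that the claims are
  independent of the sigma-algebra of all arrivals and returns. Hence any scaling, truncation or
  event expressed through arrivals and returns is absorbed into the weight of a claim, and the
  one-claim estimates are proved for arbitrary weights. Two moments appear because Potter's bounds
  lose a little power on either side of \<alpha>, downwards for small weights and upwards for large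
  ones. One hypothesis covers both: by convexity of the exponential, E exp (- p R 1) < 1 at p =
  \<alpha>' implies the same for every 0 < p \<le> \<alpha>'. With such a value b < 1 in hand, the
  first waiting time is reserved for the event \<tau>1 \<le> t, and each later one contributes a
  factor E (b powr \<theta>) < 1, since \<theta> is not almost surely 0. Asymptotic independence is
  given along the individual quantiles of the claims. Comparability of the tails converts it into a
  statement about a common level.\<close>

lemma regularly_varying_tendsto:
  assumes "regularly_varying \<rho> G" "y > 0"
  shows "((\<lambda>x. G (y * x) / G x) \<longlongrightarrow> y powr \<rho>) at_top"
  using assms by (auto simp: regularly_varying_def)

text \<open>Division by zero gives \<open>0\<close>, so the limit \<open>1\<close> of
  \<open>G x / G x\<close> already forces \<open>G x\<close> to be nonzero for large
  \<open>x\<close>. Monotonicity carries positivity back to every point.\<close>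

lemma antimono_regularly_varying_pos:
  assumes rv: "regularly_varying \<rho> G" and mono: "antimono G" and nonneg: "\<And>x. 0 \<le> G x"
  shows "0 < G (x::real)"
proof -
  have "((\<lambda>x. G (1 * x) / G x) \<longlongrightarrow> 1 powr \<rho>) at_top"
    by (rule regularly_varying_tendsto[OF rv]) simp
  then have "eventually (\<lambda>x. G (1 * x) / G x > 0) at_top"
    by (rule order_tendstoD) simp
  then have "eventually (\<lambda>z. G z > 0 \<and> z \<ge> x) at_top"
    using eventually_ge_at_top[of x]
  proof eventually_elim
    case (elim z)
    then have "G z \<noteq> 0" by auto
    then show ?case using elim nonneg[of z] by auto
  qed
  then obtain z where "G z > 0" "z \<ge> x"
    unfolding eventually_at_top_linorder by blast
  then show ?thesis
    using antimonoD[OF mono, of x z] by linarith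
qed

text \<open>A strict inequality for the limit at the single factor 2 gives one-step bounds beyond a
  threshold, and iteration gives power bounds along dyadic multiples. Rounding \<open>y\<close> to
  the neighbouring powers of two costs the factors \<open>2 powr \<beta>\<^sub>1\<close> and
  \<open>2 powr \<beta>\<^sub>2\<close>.\<close>

lemma doubling_bounds:
  fixes G :: "real \<Rightarrow> real"
  assumes rv: "regularly_varying (- \<alpha>) G" and mono: "antimono G" and pos: "\<And>x. 0 < G x"
    and b: "\<beta>\<^sub>1 < \<alpha>" "\<alpha> < \<beta>\<^sub>2" "0 < \<beta>\<^sub>1"
  obtains x0 where "x0 > 0"
    "\<And>x y. x \<ge> x0 \<Longrightarrow> y \<ge> 1 \<Longrightarrow> G (y * x) \<le> 2 powr \<beta>\<^sub>1 * y powr (- \<beta>\<^sub>1) * G x"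
    "\<And>x y. x \<ge> x0 \<Longrightarrow> y \<ge> 1 \<Longrightarrow> G x \<le> 2 powr \<beta>\<^sub>2 * y powr \<beta>\<^sub>2 * G (y * x)"
proof -
  have lim: "((\<lambda>x. G (2 * x) / G x) \<longlongrightarrow> 2 powr (- \<alpha>)) at_top"
    by (rule regularly_varying_tendsto[OF rv]) simp
  have "eventually (\<lambda>x. G (2 * x) / G x < 2 powr (- \<beta>\<^sub>1)) at_top"
    by (rule order_tendstoD[OF lim]) (use b in auto)
  moreover have "eventually (\<lambda>x. G (2 * x) / G x > 2 powr (- \<beta>\<^sub>2)) at_top"
    by (rule order_tendstoD[OF lim]) (use b in auto)
  ultimately have "eventually (\<lambda>x. G (2 * x) \<le> 2 powr (- \<beta>\<^sub>1) * G x \<and>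
      2 powr (- \<beta>\<^sub>2) * G x \<le> G (2 * x)) at_top"
    by eventually_elim (use pos in \<open>simp add: field_simps less_imp_le\<close>)
  then obtain x1 where x1: "\<And>x. x \<ge> x1 \<Longrightarrow> G (2 * x) \<le> 2 powr (- \<beta>\<^sub>1) * G x \<and>
      2 powr (- \<beta>\<^sub>2) * G x \<le> G (2 * x)"
    by (auto simp: eventually_at_top_linorder)
  \<comment> \<open>Positivity of \<open>x\<close> gives \<open>x \<le> 2 ^ n * x\<close>, so the
    iteration never falls below the one-step threshold \<open>x1\<close>.\<close>
  define x0 where "x0 = max 1 x1"
  have iter: "G (2 ^ n * x) \<le> 2 powr (- \<beta>\<^sub>1 * n) * G x \<and> 2 powr (- \<beta>\<^sub>2 * n) * G x \<le> G (2 ^ n * x)"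
    if "x \<ge> x0" for x and n :: nat
  proof (induction n)
    case (Suc n)
    have "2 ^ n * x \<ge> x1"
    proof -
      have "1 * x \<le> 2 ^ n * x"
        using that by (intro mult_right_mono) (auto simp: x0_def)
      moreover have "x1 \<le> x" using that by (simp add: x0_def)
      ultimately show ?thesis by linarith
    qed
    note st = x1[OF this]
    have "G (2 ^ Suc n * x) \<le> 2 powr (- \<beta>\<^sub>1) * G (2 ^ n * x)"
      using st by (simp add: mult.assoc)
    also have "\<dots> \<le> 2 powr (- \<beta>\<^sub>1) * (2 powr (- \<beta>\<^sub>1 * n) * G x)"
      using Suc by (intro mult_left_mono) auto
    also have "\<dots> = 2 powr (- \<beta>\<^sub>1 * Suc n) * G x"
      by (simp add: powr_add[symmetric] mult.assoc[symmetric] algebra_simps)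
    finally have 1: "G (2 ^ Suc n * x) \<le> 2 powr (- \<beta>\<^sub>1 * Suc n) * G x" .
    have "2 powr (- \<beta>\<^sub>2 * Suc n) * G x = 2 powr (- \<beta>\<^sub>2) * (2 powr (- \<beta>\<^sub>2 * n) * G x)"
      by (simp add: powr_add[symmetric] mult.assoc[symmetric] algebra_simps)
    also have "\<dots> \<le> 2 powr (- \<beta>\<^sub>2) * G (2 ^ n * x)"
      using Suc by (intro mult_left_mono) auto
    also have "\<dots> \<le> G (2 ^ Suc n * x)"
      using st by (simp add: mult.assoc)
    finally show ?case using 1 by blast
  qed simp
  have dyadic: "\<exists>n::nat. 2 ^ n \<le> y \<and> y \<le> 2 ^ Suc n" if "y \<ge> 1" for y :: real
  proof -
    define n where "n = nat \<lfloor>log 2 y\<rfloor>"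
    have l0: "log 2 y \<ge> 0" using that by simp
    have "real n \<le> log 2 y" "log 2 y \<le> real n + 1"
      using l0 unfolding n_def by linarith+
    then have "2 powr real n \<le> 2 powr log 2 y" "2 powr log 2 y \<le> 2 powr (real (Suc n))"
      by (intro powr_mono; simp)+
    moreover have "2 powr log 2 y = y" using that by simp
    ultimately have "2 ^ n \<le> y \<and> y \<le> 2 ^ Suc n"
      by (simp only: powr_realpow zero_less_numeral)
    then show ?thesis by blast
  qed
  show thesis
  proof (rule that[of x0])
    show "x0 > 0" by (simp add: x0_def)
  next
    fix x y :: real assume x: "x \<ge> x0" and y: "y \<ge> 1"
    have x_pos: "x > 0" using x by (simp add: x0_def)
    obtain n :: nat where n: "2 ^ n \<le> y" "y \<le> 2 ^ Suc n" using dyadic[OF y] by blast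
    have n': "2 powr real n = 2 ^ n" "2 powr real (Suc n) = 2 ^ Suc n"
      by (simp_all only: powr_realpow zero_less_numeral)
    have "G (y * x) \<le> G (2 ^ n * x)"
      using n x_pos by (intro antimonoD[OF mono] mult_right_mono) auto
    also have "\<dots> \<le> 2 powr (- \<beta>\<^sub>1 * n) * G x" using iter[OF x] by blast
    also have "2 powr (- \<beta>\<^sub>1 * n) = 2 powr \<beta>\<^sub>1 * (2 powr real (Suc n)) powr (- \<beta>\<^sub>1)"
      by (simp add: powr_powr powr_add[symmetric] algebra_simps del: of_nat_Suc)
        (simp add: algebra_simps)
    also have "\<dots> = 2 powr \<beta>\<^sub>1 * (2 ^ Suc n) powr (- \<beta>\<^sub>1)"
      by (simp only: n')
    also have "(2 ^ Suc n) powr (- \<beta>\<^sub>1) \<le> y powr (- \<beta>\<^sub>1)"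
      using n y b by (intro powr_mono2') auto
    finally show "G (y * x) \<le> 2 powr \<beta>\<^sub>1 * y powr (- \<beta>\<^sub>1) * G x"
      using pos[of x] by (simp add: mult_right_mono less_imp_le)
    have "2 powr (- \<beta>\<^sub>2 * Suc n) * G x \<le> G (2 ^ Suc n * x)" using iter[OF x] by blast
    also have "\<dots> \<le> G (y * x)"
      using n x_pos by (intro antimonoD[OF mono] mult_right_mono) auto
    finally have "2 powr (\<beta>\<^sub>2 * Suc n) * (2 powr (- \<beta>\<^sub>2 * Suc n) * G x)
        \<le> 2 powr (\<beta>\<^sub>2 * Suc n) * G (y * x)"
      by (intro mult_left_mono) auto
    then have "G x \<le> 2 powr (\<beta>\<^sub>2 * Suc n) * G (y * x)"
      by (simp add: mult.assoc[symmetric] powr_add[symmetric])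
    also have "2 powr (\<beta>\<^sub>2 * Suc n) = 2 powr \<beta>\<^sub>2 * (2 powr real n) powr \<beta>\<^sub>2"
      by (simp add: powr_powr powr_add[symmetric] algebra_simps)
    also have "\<dots> = 2 powr \<beta>\<^sub>2 * (2 ^ n) powr \<beta>\<^sub>2"
      by (simp only: n')
    also have "(2 ^ n) powr \<beta>\<^sub>2 \<le> y powr \<beta>\<^sub>2"
      using n y b by (intro powr_mono2) auto
    finally show "G x \<le> 2 powr \<beta>\<^sub>2 * y powr \<beta>\<^sub>2 * G (y * x)"
      using pos[of "y * x"] by (simp add: mult_right_mono less_imp_le)
  qed
qed

text \<open>Potter's bounds, written for \<open>x / w\<close>, the level that a claim with weight
  \<open>w\<close> has to exceed. For large \<open>w\<close> this level can fall below the threshold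
  of regular variation, where only \<open>G \<le> 1\<close> is available; the constant therefore
  contains \<open>1 / G x0\<close>.\<close>

lemma potter_bound:
  fixes G :: "real \<Rightarrow> real"
  assumes rv: "regularly_varying (- \<alpha>) G" and mono: "antimono G" and pos: "\<And>x. 0 < G x"
    and le1: "\<And>x. G x \<le> 1"
    and b: "\<beta>\<^sub>1 < \<alpha>" "\<alpha> < \<beta>\<^sub>2" "0 < \<beta>\<^sub>1"
  obtains C x0 where "C > 0" "x0 > 0"
    "\<And>x w. x \<ge> x0 \<Longrightarrow> 0 < w \<Longrightarrow> w \<le> 1 \<Longrightarrow> G (x / w) \<le> C * w powr \<beta>\<^sub>1 * G x"
    "\<And>x w. x \<ge> x0 \<Longrightarrow> 1 \<le> w \<Longrightarrow> G (x / w) \<le> C * w powr \<beta>\<^sub>2 * G x"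
proof -
  obtain x0 where x0: "x0 > 0"
    and up: "\<And>x y. x \<ge> x0 \<Longrightarrow> y \<ge> 1 \<Longrightarrow> G (y * x) \<le> 2 powr \<beta>\<^sub>1 * y powr (- \<beta>\<^sub>1) * G x"
    and lo: "\<And>x y. x \<ge> x0 \<Longrightarrow> y \<ge> 1 \<Longrightarrow> G x \<le> 2 powr \<beta>\<^sub>2 * y powr \<beta>\<^sub>2 * G (y * x)"
    using doubling_bounds[OF rv mono pos b] by blast
  define C where "C = max (2 powr \<beta>\<^sub>1) (2 powr \<beta>\<^sub>2 / G x0)"
  have C: "2 powr \<beta>\<^sub>1 \<le> C" "2 powr \<beta>\<^sub>2 / G x0 \<le> C" "2 powr \<beta>\<^sub>2 \<le> C"
  proof -
    have "2 powr \<beta>\<^sub>2 * 1 \<le> 2 powr \<beta>\<^sub>2 * (1 / G x0)"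
      using le1[of x0] pos[of x0] by (intro mult_left_mono) auto
    then show "2 powr \<beta>\<^sub>2 \<le> C" by (simp add: C_def)
  qed (simp_all add: C_def)
  show thesis
  proof (rule that[of C x0])
    show "C > 0" using C(1) by (rule less_le_trans[rotated]) simp
    show "x0 > 0" by fact
  next
    fix x w :: real assume x: "x \<ge> x0" and w: "0 < w" "w \<le> 1"
    have "G (x / w) \<le> 2 powr \<beta>\<^sub>1 * (1 / w) powr (- \<beta>\<^sub>1) * G x"
      using up[OF x, of "1 / w"] w by simp
    also have "(1 / w) powr (- \<beta>\<^sub>1) = w powr \<beta>\<^sub>1"
      using w by (simp add: powr_divide powr_minus)
    also have "2 powr \<beta>\<^sub>1 * w powr \<beta>\<^sub>1 * G x \<le> C * w powr \<beta>\<^sub>1 * G x"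
      using pos[of x] C by (intro mult_right_mono) auto
    finally show "G (x / w) \<le> C * w powr \<beta>\<^sub>1 * G x" .
  next
    fix x w :: real assume x: "x \<ge> x0" and w: "1 \<le> w"
    show "G (x / w) \<le> C * w powr \<beta>\<^sub>2 * G x"
    proof (cases "x / w \<ge> x0")
      case True
      have "G (x / w) \<le> 2 powr \<beta>\<^sub>2 * w powr \<beta>\<^sub>2 * G x"
        using lo[OF True w] w by simp
      also have "\<dots> \<le> C * w powr \<beta>\<^sub>2 * G x"
        using pos[of x] C by (intro mult_right_mono) auto
      finally show ?thesis .
    next
      \<comment> \<open>Now \<open>w > x / x0\<close>, and comparing \<open>G x0\<close> with
        \<open>G x\<close> shows that the right-hand side is already at least
        \<open>1\<close>.\<close>
      case False
      have "G x0 \<le> 2 powr \<beta>\<^sub>2 * (x / x0) powr \<beta>\<^sub>2 * G x"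
        using lo[of x0 "x / x0"] x x0 by simp
      also have "(x / x0) powr \<beta>\<^sub>2 \<le> w powr \<beta>\<^sub>2"
        using False x x0 w b by (intro powr_mono2) (auto simp: field_simps)
      finally have "G x0 \<le> 2 powr \<beta>\<^sub>2 * w powr \<beta>\<^sub>2 * G x"
        using pos[of x] by (simp add: mult_right_mono mult_left_mono less_imp_le)
      then have "1 \<le> 2 powr \<beta>\<^sub>2 / G x0 * w powr \<beta>\<^sub>2 * G x"
        using pos[of x0] by (simp add: field_simps)
      also have "\<dots> \<le> C * w powr \<beta>\<^sub>2 * G x"
        using pos[of x] C by (intro mult_right_mono) auto
      finally show ?thesis using le1[of "x / w"] by linarith
    qed
  qed
qed

text \<open>Monotonicity of \<open>w \<mapsto> G (x / w)\<close> upgrades pointwise to locally uniform convergence.\<close>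

lemma regularly_varying_uniform_compact:
  fixes G :: "real \<Rightarrow> real"
  assumes rv: "regularly_varying (- \<alpha>) G" and mono: "antimono G" and pos: "\<And>x. 0 < G x"
    and a: "0 < a" and e: "0 < \<epsilon>"
  shows "\<forall>\<^sub>F x in at_top. \<forall>w\<in>{a..b}. \<bar>G (x / w) / G x - w powr \<alpha>\<bar> \<le> \<epsilon>"
proof -
  have lim: "((\<lambda>x. G (x / w) / G x) \<longlongrightarrow> w powr \<alpha>) at_top" if "w > 0" for w
    using regularly_varying_tendsto[OF rv, of "1 / w"] that
    by (simp add: powr_divide powr_minus)
  have loc: "\<exists>U. open U \<and> w \<in> U \<and>
      (\<forall>\<^sub>F x in at_top. \<forall>v\<in>U. \<bar>G (x / v) / G x - v powr \<alpha>\<bar> \<le> \<epsilon>)" if w: "w > 0" for w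
  proof -
    have "isCont (\<lambda>v. v powr \<alpha>) w" using w by (intro continuous_intros) auto
    then have "((\<lambda>v. v powr \<alpha>) \<longlongrightarrow> w powr \<alpha>) (nhds w)"
      using tendsto_at_iff_tendsto_nhds[of "\<lambda>v. v powr \<alpha>" w] by (simp add: isCont_def)
    then have 1: "\<forall>\<^sub>F v in nhds w. \<bar>v powr \<alpha> - w powr \<alpha>\<bar> < \<epsilon> / 4"
      using e by (auto dest!: tendstoD[where e = "\<epsilon> / 4"] simp: dist_real_def)
    have 2: "\<forall>\<^sub>F v in nhds w. v > 0"
      using w eventually_nhds_in_open[of "{0<..}" w] by simp
    have "\<forall>\<^sub>F v in nhds w. v > 0 \<and> \<bar>v powr \<alpha> - w powr \<alpha>\<bar> < \<epsilon> / 4"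
      using 1 2 by eventually_elim simp
    then obtain h where h: "h > 0" "\<And>v. dist v w < h \<Longrightarrow> v > 0 \<and> \<bar>v powr \<alpha> - w powr \<alpha>\<bar> < \<epsilon> / 4"
      by (auto simp: eventually_nhds_metric)
    \<comment> \<open>Half the radius keeps both end points inside the ball where powers are within
      \<open>\<epsilon> / 4\<close> of \<open>w powr \<alpha>\<close>. Monotonicity traps every
      \<open>v\<close> between the two pointwise limits, at the cost of three such quarters.\<close>
    define lo hi where "lo = w - h / 2" and "hi = w + h / 2"
    have lh: "lo > 0" "\<bar>lo powr \<alpha> - w powr \<alpha>\<bar> < \<epsilon> / 4" "hi > 0" "\<bar>hi powr \<alpha> - w powr \<alpha>\<bar> < \<epsilon> / 4"
      using h(2)[of lo] h(2)[of hi] h(1) by (auto simp: lo_def hi_def dist_real_def)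
    have "\<forall>\<^sub>F x in at_top. \<bar>G (x / lo) / G x - lo powr \<alpha>\<bar> < \<epsilon> / 4"
      using lim[OF lh(1)] e by (auto dest!: tendstoD[where e = "\<epsilon> / 4"] simp: dist_real_def)
    moreover have "\<forall>\<^sub>F x in at_top. \<bar>G (x / hi) / G x - hi powr \<alpha>\<bar> < \<epsilon> / 4"
      using lim[OF lh(3)] e by (auto dest!: tendstoD[where e = "\<epsilon> / 4"] simp: dist_real_def)
    ultimately have "\<forall>\<^sub>F x in at_top. \<forall>v\<in>{lo<..<hi}. \<bar>G (x / v) / G x - v powr \<alpha>\<bar> \<le> \<epsilon>"
      using eventually_gt_at_top[of 0]
    proof eventually_elim
      case (elim x)
      show ?case
      proof
        fix v assume v: "v \<in> {lo<..<hi}"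
        have "dist v w < h" using v h(1) by (auto simp: lo_def hi_def dist_real_def)
        then have vw: "\<bar>v powr \<alpha> - w powr \<alpha>\<bar> < \<epsilon> / 4" using h(2) by blast
        have "G (x / lo) \<le> G (x / v)" "G (x / v) \<le> G (x / hi)"
          using v lh elim(3) by (intro antimonoD[OF mono] divide_left_mono; simp)+
        then have "G (x / lo) / G x \<le> G (x / v) / G x" "G (x / v) / G x \<le> G (x / hi) / G x"
          using pos[of x] by (intro divide_right_mono; simp)+
        then show "\<bar>G (x / v) / G x - v powr \<alpha>\<bar> \<le> \<epsilon>"
          using elim(1,2) vw lh(2,4) by linarith
      qed
    qed
    moreover have "w \<in> {lo<..<hi}" using h(1) by (auto simp: lo_def hi_def)
    ultimately show ?thesis by (intro exI[of _ "{lo<..<hi}"]) auto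
  qed
  then have "\<forall>w\<in>{0<..}. \<exists>U. open U \<and> w \<in> U \<and>
      (\<forall>\<^sub>F x in at_top. \<forall>v\<in>U. \<bar>G (x / v) / G x - v powr \<alpha>\<bar> \<le> \<epsilon>)" by simp
  from bchoice[OF this] obtain U where U': "\<forall>w\<in>{0<..}. open (U w) \<and> w \<in> U w \<and>
      (\<forall>\<^sub>F x in at_top. \<forall>v\<in>U w. \<bar>G (x / v) / G x - v powr \<alpha>\<bar> \<le> \<epsilon>)" ..
  have U: "open (U w)" "w \<in> U w"
    "\<forall>\<^sub>F x in at_top. \<forall>v\<in>U w. \<bar>G (x / v) / G x - v powr \<alpha>\<bar> \<le> \<epsilon>" if "w > 0" for w
    using bspec[OF U', of w] that by simp_all
  have cover: "{a..b} \<subseteq> (\<Union>c\<in>{a..b}. U c)"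
  proof
    fix w assume w: "w \<in> {a..b}"
    then have "w \<in> U w" using a by (intro U(2)) simp
    with w show "w \<in> (\<Union>c\<in>{a..b}. U c)" by (rule UN_I)
  qed
  have op: "open (U w)" if "w \<in> {a..b}" for w
    using that a by (intro U(1)) simp
  obtain C where C: "C \<subseteq> {a..b}" "finite C" "{a..b} \<subseteq> (\<Union>c\<in>C. U c)"
    by (rule compactE_image[OF compact_Icc op cover])
  have "\<forall>\<^sub>F x in at_top. \<forall>c\<in>C. \<forall>v\<in>U c. \<bar>G (x / v) / G x - v powr \<alpha>\<bar> \<le> \<epsilon>"
  proof (rule eventually_ball_finite[OF C(2)], rule ballI)
    fix c assume "c \<in> C"
    then show "\<forall>\<^sub>F x in at_top. \<forall>v\<in>U c. \<bar>G (x / v) / G x - v powr \<alpha>\<bar> \<le> \<epsilon>"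
      using C(1) a by (intro U(3)) auto
  qed
  then show ?thesis
  proof eventually_elim
    case (elim x)
    show ?case
    proof
      fix w assume "w \<in> {a..b}"
      then obtain c where "c \<in> C" "w \<in> U c" using C(3) by blast
      then show "\<bar>G (x / w) / G x - w powr \<alpha>\<bar> \<le> \<epsilon>" using elim by blast
    qed
  qed
qed

lemma regularly_varying_uniform:
  fixes G :: "real \<Rightarrow> real"
  assumes rv: "regularly_varying (- \<alpha>) G" and mono: "antimono G" and pos: "\<And>x. 0 < G x"
    and le1: "\<And>x. G x \<le> 1"
    and b: "0 < \<alpha>\<^sub>1" "\<alpha>\<^sub>1 < \<alpha>" "\<alpha> < \<alpha>'" and e: "0 < \<epsilon>"
  shows "\<forall>\<^sub>F x in at_top. \<forall>w>0. \<bar>G (x / w) - w powr \<alpha> * G x\<bar>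
           \<le> \<epsilon> * (w powr \<alpha>\<^sub>1 + w powr \<alpha>') * G x"
proof -
  \<comment> \<open>The midpoints leave room on both sides: Potter's bounds hold with them, and the
    spare powers \<open>w powr (\<beta>\<^sub>1 - \<alpha>\<^sub>1)\<close> at \<open>0\<close> and
    \<open>w powr (\<beta>\<^sub>2 - \<alpha>')\<close> at infinity tend to
    \<open>0\<close>.\<close>
  define \<beta>\<^sub>1 where "\<beta>\<^sub>1 = (\<alpha>\<^sub>1 + \<alpha>) / 2"
  define \<beta>\<^sub>2 where "\<beta>\<^sub>2 = (\<alpha>' + \<alpha>) / 2"
  have be: "\<beta>\<^sub>1 < \<alpha>" "\<alpha> < \<beta>\<^sub>2" "0 < \<beta>\<^sub>1" "\<alpha>\<^sub>1 < \<beta>\<^sub>1" "\<beta>\<^sub>2 < \<alpha>'"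
    using b by (auto simp: \<beta>\<^sub>1_def \<beta>\<^sub>2_def)
  obtain C x0 where C: "C > 0" "x0 > 0"
    and sm: "\<And>x w. x \<ge> x0 \<Longrightarrow> 0 < w \<Longrightarrow> w \<le> 1 \<Longrightarrow> G (x / w) \<le> C * w powr \<beta>\<^sub>1 * G x"
    and la: "\<And>x w. x \<ge> x0 \<Longrightarrow> 1 \<le> w \<Longrightarrow> G (x / w) \<le> C * w powr \<beta>\<^sub>2 * G x"
    using potter_bound[OF rv mono pos le1 be(1-3)] by blast
  have "((\<lambda>w::real. (C + 1) * w powr (\<beta>\<^sub>1 - \<alpha>\<^sub>1)) \<longlongrightarrow> 0) (at_right 0)"
    using be by real_asymp
  then have "\<forall>\<^sub>F w in at_right 0. (C + 1) * w powr (\<beta>\<^sub>1 - \<alpha>\<^sub>1) < \<epsilon>"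
    using e by (rule order_tendstoD)
  then obtain a0 where a0: "a0 > 0" "\<And>w. 0 < w \<Longrightarrow> w < a0 \<Longrightarrow> (C + 1) * w powr (\<beta>\<^sub>1 - \<alpha>\<^sub>1) < \<epsilon>"
    by (auto simp: eventually_at_right_field)
  define a where "a = min (a0 / 2) 1"
  have a: "0 < a" "a \<le> 1" "\<And>w. 0 < w \<Longrightarrow> w \<le> a \<Longrightarrow> (C + 1) * w powr (\<beta>\<^sub>1 - \<alpha>\<^sub>1) < \<epsilon>"
    using a0 by (auto simp: a_def)
  have "((\<lambda>w::real. (C + 1) * w powr (\<beta>\<^sub>2 - \<alpha>')) \<longlongrightarrow> 0) at_top"
    using be by real_asymp
  then have "\<forall>\<^sub>F w in at_top. (C + 1) * w powr (\<beta>\<^sub>2 - \<alpha>') < \<epsilon> \<and> w \<ge> 1"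
    using e by (intro eventually_conj order_tendstoD eventually_ge_at_top)
  then obtain B where B: "\<And>w. w \<ge> B \<Longrightarrow> (C + 1) * w powr (\<beta>\<^sub>2 - \<alpha>') < \<epsilon> \<and> w \<ge> 1"
    by (auto simp: eventually_at_top_linorder)
  \<comment> \<open>The tolerance is scaled by \<open>a powr \<alpha>\<^sub>1\<close>, which bounds
    the majorant from below on the middle range.\<close>
  have "\<forall>\<^sub>F x in at_top. \<forall>w\<in>{a..B}. \<bar>G (x / w) / G x - w powr \<alpha>\<bar> \<le> \<epsilon> * a powr \<alpha>\<^sub>1"
    using a e by (intro regularly_varying_uniform_compact[OF rv mono pos]) auto
  then show ?thesis
    using eventually_ge_at_top[of x0]
  proof eventually_elim
    case (elim x)
    have Gx: "G x > 0" by (rule pos)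
    show ?case
    proof (intro allI impI)
      fix w :: real assume w: "w > 0"
      have mid: "w powr \<alpha> \<le> w powr \<beta>\<^sub>1" if "w \<le> 1"
        using that w be by (intro powr_mono') auto
      have mid': "w powr \<alpha> \<le> w powr \<beta>\<^sub>2" if "w \<ge> 1"
        using that w be by (intro powr_mono) auto
      have Gnn: "0 \<le> G (x / w)" "0 \<le> w powr \<alpha> * G x"
        using pos[of "x / w"] Gx by auto
      consider "w \<le> a" | "a \<le> w" "w \<le> B" | "B \<le> w" by linarith
      then show "\<bar>G (x / w) - w powr \<alpha> * G x\<bar> \<le> \<epsilon> * (w powr \<alpha>\<^sub>1 + w powr \<alpha>') * G x"
      proof cases
        case 1
        have "\<bar>G (x / w) - w powr \<alpha> * G x\<bar> \<le> G (x / w) + w powr \<alpha> * G x"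
          using Gnn by linarith
        also have "\<dots> \<le> C * w powr \<beta>\<^sub>1 * G x + w powr \<beta>\<^sub>1 * G x"
          using sm[OF elim(2) w] mid a(2) 1 Gx by (intro add_mono mult_right_mono) auto
        also have "\<dots> = (C + 1) * w powr (\<beta>\<^sub>1 - \<alpha>\<^sub>1) * w powr \<alpha>\<^sub>1 * G x"
          using w by (simp add: algebra_simps powr_add[symmetric])
        also have "\<dots> \<le> \<epsilon> * w powr \<alpha>\<^sub>1 * G x"
          using a(3)[OF w 1] Gx by (intro mult_right_mono) auto
        also have "\<dots> \<le> \<epsilon> * (w powr \<alpha>\<^sub>1 + w powr \<alpha>') * G x"
          using e Gx by (intro mult_right_mono mult_left_mono) auto
        finally show ?thesis .
      next
        case 2
        have "\<bar>G (x / w) / G x - w powr \<alpha>\<bar> \<le> \<epsilon> * a powr \<alpha>\<^sub>1"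
          using elim(1) 2 by simp
        also have "\<dots> \<le> \<epsilon> * (w powr \<alpha>\<^sub>1 + w powr \<alpha>')"
        proof -
          have "a powr \<alpha>\<^sub>1 \<le> w powr \<alpha>\<^sub>1" using 2 a b by (intro powr_mono2) auto
          then show ?thesis using e by (intro mult_left_mono) (auto intro: add_increasing2)
        qed
        finally have "\<bar>G (x / w) / G x - w powr \<alpha>\<bar> * G x \<le> \<epsilon> * (w powr \<alpha>\<^sub>1 + w powr \<alpha>') * G x"
          using Gx by (intro mult_right_mono) auto
        moreover have "\<bar>G (x / w) / G x - w powr \<alpha>\<bar> * G x = \<bar>G (x / w) - w powr \<alpha> * G x\<bar>"
        proof -
          have "\<bar>G (x / w) / G x - w powr \<alpha>\<bar> * G x = \<bar>(G (x / w) / G x - w powr \<alpha>) * G x\<bar>"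
            using Gx by (simp add: abs_mult)
          also have "(G (x / w) / G x - w powr \<alpha>) * G x = G (x / w) - w powr \<alpha> * G x"
            using Gx by (simp add: field_simps)
          finally show ?thesis .
        qed
        ultimately show ?thesis by simp
      next
        case 3
        have w1: "w \<ge> 1" using B[OF 3] by blast
        have "\<bar>G (x / w) - w powr \<alpha> * G x\<bar> \<le> G (x / w) + w powr \<alpha> * G x"
          using Gnn by linarith
        also have "\<dots> \<le> C * w powr \<beta>\<^sub>2 * G x + w powr \<beta>\<^sub>2 * G x"
          using la[OF elim(2) w1] mid' w1 Gx by (intro add_mono mult_right_mono) auto
        also have "\<dots> = (C + 1) * w powr (\<beta>\<^sub>2 - \<alpha>') * w powr \<alpha>' * G x"
          using w by (simp add: algebra_simps powr_add[symmetric])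
        also have "\<dots> \<le> \<epsilon> * w powr \<alpha>' * G x"
          using B[OF 3] Gx by (intro mult_right_mono) auto
        also have "\<dots> \<le> \<epsilon> * (w powr \<alpha>\<^sub>1 + w powr \<alpha>') * G x"
          using e Gx by (intro mult_right_mono mult_left_mono) auto
        finally show ?thesis .
      qed
    qed
  qed
qed

section \<open>Products with independent weights\<close>

text \<open>Fubini for the product law, with the weight held fixed. Where \<open>U\<close> vanishes
  the product is \<open>0 < x\<close>, so the integrand is set to \<open>0\<close> there and the
  meaningless \<open>x / 0\<close> never enters. The second conclusion serves the integrability
  argument in \<open>breiman_bound\<close>.\<close>

lemma (in prob_space) prob_mult_gt_indep:
  fixes Y U :: "'a \<Rightarrow> real"
  assumes indep: "indep_var borel Y borel U"
    and tail: "\<And>u. \<P>(\<omega> in M. Y \<omega> > u) = G u"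
    and nonneg: "\<And>\<omega>. \<omega> \<in> space M \<Longrightarrow> 0 \<le> U \<omega>" and x: "0 < x"
  shows "\<P>(\<omega> in M. Y \<omega> * U \<omega> > x) = expectation (\<lambda>\<omega>. if U \<omega> > 0 then G (x / U \<omega>) else 0)"
    and "(\<lambda>\<omega>. if U \<omega> > 0 then G (x / U \<omega>) else 0) \<in> borel_measurable M"
proof -
  have [measurable]: "Y \<in> borel_measurable M" "U \<in> borel_measurable M"
    using indep by (auto dest: indep_var_rv1 indep_var_rv2)
  have G_le: "0 \<le> G u" "G u \<le> 1" for u
    by (simp_all add: tail[symmetric])
  have "antimono G"
    unfolding tail[symmetric] by (intro antimonoI finite_measure_mono) auto
  then have "mono (\<lambda>u. - G u)" by (simp add: mono_def antimono_def)
  then have "(\<lambda>u. - (- G u)) \<in> borel_measurable borel"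
    by (intro borel_measurable_uminus borel_measurable_mono)
  then have [measurable]: "G \<in> borel_measurable borel" by simp
  show meas: "(\<lambda>\<omega>. if U \<omega> > 0 then G (x / U \<omega>) else 0) \<in> borel_measurable M"
    by measurable
  interpret DY: prob_space "distr M borel Y" by (rule prob_space_distr) simp
  interpret DU: prob_space "distr M borel U" by (rule prob_space_distr) simp
  interpret P: pair_prob_space "distr M borel Y" "distr M borel U" ..
  define S where "S = {p :: real \<times> real. fst p * snd p > x}"
  have S[measurable]: "S \<in> sets (borel \<Otimes>\<^sub>M borel)"
  proof -
    have m: "(\<lambda>p. fst p * snd p :: real) \<in> borel_measurable (borel \<Otimes>\<^sub>M borel)" by measurable
    have e: "S = (\<lambda>p. fst p * snd p) -` {x<..} \<inter> space (borel \<Otimes>\<^sub>M borel)"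
      by (auto simp: S_def space_pair_measure)
    show ?thesis unfolding e by (rule measurable_sets[OF m]) simp
  qed
  have pair[measurable]: "(\<lambda>\<omega>. (Y \<omega>, U \<omega>)) \<in> measurable M (borel \<Otimes>\<^sub>M borel)" by measurable
  have "{\<omega> \<in> space M. Y \<omega> * U \<omega> > x} = (\<lambda>\<omega>. (Y \<omega>, U \<omega>)) -` S \<inter> space M"
    by (auto simp: S_def)
  then have "emeasure M {\<omega> \<in> space M. Y \<omega> * U \<omega> > x}
      = emeasure (distr M (borel \<Otimes>\<^sub>M borel) (\<lambda>\<omega>. (Y \<omega>, U \<omega>))) S"
    by (simp only: emeasure_distr[OF pair S])
  also have "\<dots> = emeasure (distr M borel Y \<Otimes>\<^sub>M distr M borel U) S"
    using indep by (simp add: indep_var_distribution_eq)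
  also have "\<dots> = (\<integral>\<^sup>+u. emeasure (distr M borel Y) ((\<lambda>y. (y, u)) -` S) \<partial>distr M borel U)"
    by (rule P.emeasure_pair_measure_alt2) (simp add: sets_pair_measure_cong[OF sets_distr sets_distr])
  also have "\<dots> = (\<integral>\<^sup>+\<omega>. emeasure (distr M borel Y) ((\<lambda>y. (y, U \<omega>)) -` S) \<partial>M)"
  proof (subst nn_integral_distr)
    have "S \<in> sets (distr M borel Y \<Otimes>\<^sub>M distr M borel U)"
      by (simp add: sets_pair_measure_cong[OF sets_distr sets_distr])
    from P.measurable_emeasure_Pair2[OF this]
    show "(\<lambda>u. emeasure (distr M borel Y) ((\<lambda>y. (y, u)) -` S)) \<in> borel_measurable (distr M borel U)"
      by simp
  qed simp_all
  also have "\<dots> = (\<integral>\<^sup>+\<omega>. ennreal (if U \<omega> > 0 then G (x / U \<omega>) else 0) \<partial>M)"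
  proof (rule nn_integral_cong)
    fix \<omega> assume w: "\<omega> \<in> space M"
    show "emeasure (distr M borel Y) ((\<lambda>y. (y, U \<omega>)) -` S) = ennreal (if U \<omega> > 0 then G (x / U \<omega>) else 0)"
    proof (cases "U \<omega> > 0")
      case True
      have "(\<lambda>y. (y, U \<omega>)) -` S = {x / U \<omega><..}"
        using True by (auto simp: S_def field_simps)
      then have "emeasure (distr M borel Y) ((\<lambda>y. (y, U \<omega>)) -` S) = emeasure M {\<omega>' \<in> space M. Y \<omega>' > x / U \<omega>}"
        by (simp add: emeasure_distr vimage_def Int_def conj_commute)
      also have "\<dots> = ennreal (G (x / U \<omega>))"
        by (simp add: emeasure_eq_measure tail)
      finally show ?thesis using True by simp
    next
      case False
      then have "U \<omega> = 0" using nonneg[OF w] by simp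
      then have "(\<lambda>y. (y, U \<omega>)) -` S = {}" using x by (auto simp: S_def)
      then show ?thesis using False by simp
    qed
  qed
  finally have eq: "emeasure M {\<omega> \<in> space M. Y \<omega> * U \<omega> > x}
      = (\<integral>\<^sup>+\<omega>. ennreal (if U \<omega> > 0 then G (x / U \<omega>) else 0) \<partial>M)" .
  show "\<P>(\<omega> in M. Y \<omega> * U \<omega> > x) = expectation (\<lambda>\<omega>. if U \<omega> > 0 then G (x / U \<omega>) else 0)"
    unfolding measure_def eq
    by (rule integral_eq_nn_integral[symmetric]) (use G_le in \<open>auto\<close>)
qed

lemma powr_le_sum_powr:
  fixes w :: real
  assumes "0 \<le> w" "a \<le> b" "b \<le> c"
  shows "w powr b \<le> w powr a + w powr c"
proof (cases "w \<le> 1")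
  case True
  then have "w powr b \<le> w powr a" using assms by (cases "w = 0") (auto intro: powr_mono')
  then show ?thesis by (simp add: add_increasing2)
next
  case False
  then have "w powr b \<le> w powr c" using assms by (intro powr_mono) auto
  then show ?thesis by (simp add: add_increasing)
qed

lemma integrable_powr_between:
  fixes U :: "'a \<Rightarrow> real"
  assumes [measurable]: "U \<in> borel_measurable M" and nonneg: "\<And>\<omega>. \<omega> \<in> space M \<Longrightarrow> 0 \<le> U \<omega>"
    and "integrable M (\<lambda>\<omega>. U \<omega> powr a)" "integrable M (\<lambda>\<omega>. U \<omega> powr c)" "a \<le> b" "b \<le> c"
  shows "integrable M (\<lambda>\<omega>. U \<omega> powr b)"
proof (rule Bochner_Integration.integrable_bound[of _ "\<lambda>\<omega>. U \<omega> powr a + U \<omega> powr c"])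
  show "AE \<omega> in M. norm (U \<omega> powr b) \<le> norm (U \<omega> powr a + U \<omega> powr c)"
    using nonneg assms(5,6) by (intro AE_I2) (auto intro!: powr_le_sum_powr)
qed (use assms in auto)

text \<open>A quantitative Breiman lemma at a fixed level: the pointwise estimate is integrated over
  the law of the weight. At \<open>U = 0\<close> every term vanishes because
  \<open>0 powr p = 0\<close>.\<close>

lemma (in prob_space) breiman_bound:
  fixes Y U :: "'a \<Rightarrow> real"
  assumes indep: "indep_var borel Y borel U"
    and tail: "\<And>u. \<P>(\<omega> in M. Y \<omega> > u) = G u"
    and nonneg: "\<And>\<omega>. \<omega> \<in> space M \<Longrightarrow> 0 \<le> U \<omega>" and x: "0 < x"
    and int: "integrable M (\<lambda>\<omega>. U \<omega> powr \<alpha>\<^sub>1)" "integrable M (\<lambda>\<omega>. U \<omega> powr \<alpha>')"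
    and exps: "\<alpha>\<^sub>1 \<le> \<alpha>" "\<alpha> \<le> \<alpha>'"
    and unif: "\<And>w. w > 0 \<Longrightarrow>
      \<bar>G (x / w) - w powr \<alpha> * G x\<bar> \<le> \<epsilon> * (w powr \<alpha>\<^sub>1 + w powr \<alpha>') * G x"
  shows "\<bar>\<P>(\<omega> in M. Y \<omega> * U \<omega> > x) - G x * expectation (\<lambda>\<omega>. U \<omega> powr \<alpha>)\<bar>
    \<le> \<epsilon> * G x * expectation (\<lambda>\<omega>. U \<omega> powr \<alpha>\<^sub>1 + U \<omega> powr \<alpha>')"
proof -
  have [measurable]: "Y \<in> borel_measurable M" "U \<in> borel_measurable M"
    using indep by (auto dest: indep_var_rv1 indep_var_rv2)
  note pr = prob_mult_gt_indep[OF indep tail nonneg x]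
  define H where "H = (\<lambda>\<omega>. if U \<omega> > 0 then G (x / U \<omega>) else 0)"
  have G_le: "0 \<le> G u" "G u \<le> 1" for u
    by (simp_all add: tail[symmetric])
  have H: "integrable M H"
    by (rule integrable_const_bound[of _ 1]) (use pr(2) G_le in \<open>auto simp: H_def\<close>)
  have ia: "integrable M (\<lambda>\<omega>. U \<omega> powr \<alpha>)"
    by (rule integrable_powr_between[OF _ nonneg int]) (use exps in auto)
  have "\<bar>expectation (\<lambda>\<omega>. H \<omega> - U \<omega> powr \<alpha> * G x)\<bar>
      \<le> expectation (\<lambda>\<omega>. \<epsilon> * (U \<omega> powr \<alpha>\<^sub>1 + U \<omega> powr \<alpha>') * G x)"
  proof (intro order.trans[OF integral_abs_bound] integral_mono)
    fix \<omega> assume w: "\<omega> \<in> space M"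
    show "\<bar>H \<omega> - U \<omega> powr \<alpha> * G x\<bar> \<le> \<epsilon> * (U \<omega> powr \<alpha>\<^sub>1 + U \<omega> powr \<alpha>') * G x"
      using nonneg[OF w] unif[of "U \<omega>"] by (cases "U \<omega> = 0") (auto simp: H_def)
  qed (use H ia int in auto)
  moreover have "expectation (\<lambda>\<omega>. H \<omega> - U \<omega> powr \<alpha> * G x)
      = \<P>(\<omega> in M. Y \<omega> * U \<omega> > x) - G x * expectation (\<lambda>\<omega>. U \<omega> powr \<alpha>)"
    using H ia pr(1)[folded H_def] by (simp add: mult.commute[of "G x"])
  moreover have "expectation (\<lambda>\<omega>. \<epsilon> * (U \<omega> powr \<alpha>\<^sub>1 + U \<omega> powr \<alpha>') * G x)
      = \<epsilon> * expectation (\<lambda>\<omega>. U \<omega> powr \<alpha>\<^sub>1 + U \<omega> powr \<alpha>') * G x"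
    by simp
  ultimately show ?thesis by (simp add: ac_simps)
qed

text \<open>Every unordered pair is subtracted twice, once in either order. This weaker correction
  suffices where pairs are negligible, and in the induction only the row of the new index has to be
  estimated; the other rows merely grow.\<close>

lemma (in prob_space) bonferroni_lower:
  assumes "finite I" and B: "\<And>n. n \<in> I \<Longrightarrow> B n \<in> events"
  shows "(\<Sum>n\<in>I. prob (B n)) - (\<Sum>n\<in>I. \<Sum>m\<in>I - {n}. prob (B n \<inter> B m)) \<le> prob (\<Union>n\<in>I. B n)"
  using assms
proof (induction I)
  case (insert n I)
  define U where "U = (\<Union>m\<in>I. B m)"
  have ev: "B n \<in> events" "U \<in> events" using insert by (auto simp: U_def)
  have fin: "finite I" "n \<notin> I" using insert by auto
  have "prob (B n \<inter> U) \<le> (\<Sum>m\<in>I. prob (B n \<inter> B m))"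
    unfolding U_def Int_UN_distrib using insert.prems insert.hyps
    by (intro finite_measure_subadditive_finite) auto
  moreover have "prob (B n \<union> U) = prob (B n) + prob U - prob (B n \<inter> U)"
    using ev measure_Un3[of "B n" M U] by (simp add: fmeasurable_eq_sets)
  moreover have "(\<Sum>m\<in>I. \<Sum>l\<in>I - {m}. prob (B m \<inter> B l)) \<le> (\<Sum>m\<in>I. \<Sum>l\<in>insert n I - {m}. prob (B m \<inter> B l))"
    using fin by (intro sum_mono sum_mono2) auto
  moreover have "(\<Sum>m\<in>I. prob (B m)) - (\<Sum>m\<in>I. \<Sum>l\<in>I - {m}. prob (B m \<inter> B l)) \<le> prob U"
    using insert unfolding U_def by auto
  moreover have "insert n I - {n} = I" using fin by auto
  ultimately show ?case
    using fin by (simp add: U_def)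
qed simp

section \<open>Weighted sums of asymptotically independent claims\<close>

text \<open>The deterministic core of the single big jump: if at most one summand exceeds
  \<open>\<delta> / m * x\<close>, the others together contribute at most
  \<open>\<delta> * x\<close>, so that one has to carry the rest.\<close>

lemma sum_gt_cases:
  fixes y :: "'i \<Rightarrow> real"
  assumes I: "finite I" and nonneg: "\<And>n. n \<in> I \<Longrightarrow> 0 \<le> y n"
    and gt: "(\<Sum>n\<in>I. y n) > (1 - \<delta>) * x" and \<delta>: "0 < \<delta>" "\<delta> \<le> 1 / 4" and x: "0 < x"
    and m: "real (card I) \<le> m" "0 < m"
  shows "(\<exists>n\<in>I. y n > (1 - 2 * \<delta>) * x) \<or>
    (\<exists>n\<in>I. \<exists>n'\<in>I - {n}. y n > \<delta> / m * x \<and> y n' > \<delta> / m * x)"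
proof (rule ccontr)
  assume neg: "\<not> ((\<exists>n\<in>I. y n > (1 - 2 * \<delta>) * x) \<or>
    (\<exists>n\<in>I. \<exists>n'\<in>I - {n}. y n > \<delta> / m * x \<and> y n' > \<delta> / m * x))"
  then have single: "y n \<le> (1 - 2 * \<delta>) * x" if "n \<in> I" for n
    using that by (meson not_less)
  have pair: "y n' \<le> \<delta> / m * x" if "n \<in> I" "n' \<in> I - {n}" "y n > \<delta> / m * x" for n n'
    using neg that by (meson not_less)
  have \<eta>: "0 \<le> \<delta> / m * x" using \<delta> x m by simp
  have cm: "card I * (\<delta> / m * x) \<le> \<delta> * x"
  proof -
    have "card I * (\<delta> / m * x) \<le> m * (\<delta> / m * x)"
      using m \<eta> by (intro mult_right_mono) auto
    then show ?thesis using m by simp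
  qed
  show False
  proof (cases "\<exists>n\<in>I. y n > \<delta> / m * x")
    case True
    then obtain n where n: "n \<in> I" "y n > \<delta> / m * x" by blast
    have "(\<Sum>k\<in>I - {n}. y k) \<le> (\<Sum>k\<in>I - {n}. \<delta> / m * x)"
      using n by (intro sum_mono pair[of n])
    also have "\<dots> \<le> (\<Sum>k\<in>I. \<delta> / m * x)"
      using I \<eta> by (intro sum_mono2) auto
    also have "\<dots> \<le> \<delta> * x" using cm by simp
    finally have "(\<Sum>k\<in>I - {n}. y k) \<le> \<delta> * x" .
    moreover have "y n \<le> (1 - 2 * \<delta>) * x" using n by (intro single)
    moreover have "(\<Sum>k\<in>I. y k) = y n + (\<Sum>k\<in>I - {n}. y k)"
      using I n by (simp add: sum.remove)
    ultimately show False using gt by (simp add: algebra_simps)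
  next
    case False
    then have "(\<Sum>k\<in>I. y k) \<le> (\<Sum>k\<in>I. \<delta> / m * x)"
      by (intro sum_mono) (meson not_less)
    also have "\<dots> \<le> \<delta> * x" using cm by simp
    also have "\<dots> \<le> (1 - \<delta>) * x" using \<delta> x by (intro mult_right_mono) auto
    finally show False using gt by simp
  qed
qed

text \<open>In the application \<open>\<G>\<close> is the sigma-algebra generated by arrivals and returns, and \<open>\<L> a t\<close> is
  the probability that the first claim of type \<open>a\<close> arrives by time \<open>t\<close>.\<close>

locale weighted_claims = prob_space M for M :: "'a measure" +
  fixes A :: "'b set" and X :: "'b \<Rightarrow> nat \<Rightarrow> 'a \<Rightarrow> real" and G :: "'b \<Rightarrow> real \<Rightarrow> real"
    and \<G> :: "'a measure" and V :: "'b \<Rightarrow> nat \<Rightarrow> 't \<Rightarrow> 'a \<Rightarrow> real"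
    and \<L> :: "'b \<Rightarrow> 't \<Rightarrow> real" and \<Lambda> :: "'t set" and \<alpha>\<^sub>1 \<alpha> \<alpha>' q K :: real
  assumes finite_A: "finite A" and A_nonempty: "A \<noteq> {}"
    and exps: "0 < \<alpha>\<^sub>1" "\<alpha>\<^sub>1 < \<alpha>" "\<alpha> < \<alpha>'"
    and q: "0 \<le> q" "q < 1" and K: "0 \<le> K"
    and sub: "subalgebra M \<G>"
    and X_nonneg: "\<And>a i \<omega>. a \<in> A \<Longrightarrow> \<omega> \<in> space M \<Longrightarrow> 0 \<le> X a i \<omega>"
    and X_tail: "\<And>a i u. a \<in> A \<Longrightarrow> \<P>(\<omega> in M. X a i \<omega> > u) = G a u"
    and G_rv: "\<And>a. a \<in> A \<Longrightarrow> regularly_varying (- \<alpha>) (G a)"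
    and X_indep: "\<And>a i U. a \<in> A \<Longrightarrow> U \<in> borel_measurable \<G> \<Longrightarrow> indep_var borel (X a i) borel U"
    and XX_indep: "\<And>a i b j u B. a \<in> A \<Longrightarrow> b \<in> A \<Longrightarrow> B \<in> sets \<G> \<Longrightarrow>
      \<P>(\<omega> in M. X a i \<omega> > u \<and> X b j \<omega> > u \<and> \<omega> \<in> B) = \<P>(\<omega> in M. X a i \<omega> > u \<and> X b j \<omega> > u) * prob B"
    and joint: "\<And>a i b j. a \<in> A \<Longrightarrow> b \<in> A \<Longrightarrow> (a, i) \<noteq> (b, j) \<Longrightarrow>
      ((\<lambda>y. \<P>(\<omega> in M. X a i \<omega> > y \<and> X b j \<omega> > y) / G a y) \<longlongrightarrow> 0) at_top"
    and V_meas: "\<And>a i t. a \<in> A \<Longrightarrow> t \<in> \<Lambda> \<Longrightarrow> V a i t \<in> borel_measurable \<G>"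
    and V_nonneg: "\<And>a i t \<omega>. a \<in> A \<Longrightarrow> t \<in> \<Lambda> \<Longrightarrow> \<omega> \<in> space M \<Longrightarrow> 0 \<le> V a i t \<omega>"
    and V_int: "\<And>a i t. a \<in> A \<Longrightarrow> t \<in> \<Lambda> \<Longrightarrow> integrable M (\<lambda>\<omega>. V a i t \<omega> powr \<alpha>\<^sub>1)"
      "\<And>a i t. a \<in> A \<Longrightarrow> t \<in> \<Lambda> \<Longrightarrow> integrable M (\<lambda>\<omega>. V a i t \<omega> powr \<alpha>')"
    and V_bound: "\<And>a i t. a \<in> A \<Longrightarrow> t \<in> \<Lambda> \<Longrightarrow>
      expectation (\<lambda>\<omega>. V a i t \<omega> powr \<alpha>\<^sub>1 + V a i t \<omega> powr \<alpha>') \<le> K * q ^ i * \<L> a t"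
    and V_pos: "\<And>a i t. a \<in> A \<Longrightarrow> t \<in> \<Lambda> \<Longrightarrow> \<P>(\<omega> in M. V a i t \<omega> > 0) \<le> \<L> a t"
begin

section \<open>Scale, main term and moment series of the weighted claims\<close>

abbreviation exceed :: "'b \<Rightarrow> nat \<Rightarrow> 't \<Rightarrow> real \<Rightarrow> 'a set" where
  "exceed a i t y \<equiv> {\<omega> \<in> space M. X a i \<omega> * V a i t \<omega> > y}"

abbreviation moment :: "'b \<Rightarrow> nat \<Rightarrow> 't \<Rightarrow> real" where
  "moment a i t \<equiv> expectation (\<lambda>\<omega>. V a i t \<omega> powr \<alpha>)"

abbreviation two_moments :: "real \<Rightarrow> ('a \<Rightarrow> real) \<Rightarrow> real" where
  "two_moments \<beta> U \<equiv> expectation (\<lambda>\<omega>. U \<omega> powr \<alpha>\<^sub>1 + U \<omega> powr \<beta>)"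

text \<open>The yardstick for all errors. By geometric decay \<open>main_term\<close> is at most a
  constant times it, and a lower bound on the moment series gives the reverse, so errors relative to
  \<open>scale\<close> become errors relative to \<open>main_term\<close>.\<close>

definition scale :: "real \<Rightarrow> 't \<Rightarrow> real" where
  "scale x t = (\<Sum>a\<in>A. G a x * \<L> a t)"

definition main_term :: "real \<Rightarrow> 't \<Rightarrow> real" where
  "main_term x t = (\<Sum>a\<in>A. G a x * (\<Sum>i. moment a i t))"

lemma measurable_sub: "U \<in> borel_measurable \<G> \<Longrightarrow> U \<in> borel_measurable M"
  for U :: "'a \<Rightarrow> 'c :: topological_space"
  by (rule measurable_from_subalg[OF sub])

lemma X_meas[measurable]: "a \<in> A \<Longrightarrow> X a i \<in> borel_measurable M"
  using X_indep[of a "\<lambda>_. 0" i] by (auto dest: indep_var_rv1)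

lemma V_meas_M[measurable]: "a \<in> A \<Longrightarrow> t \<in> \<Lambda> \<Longrightarrow> V a i t \<in> borel_measurable M"
  by (intro measurable_sub V_meas)

lemma G_nonneg: "a \<in> A \<Longrightarrow> 0 \<le> G a x" and G_le1: "a \<in> A \<Longrightarrow> G a x \<le> 1"
  by (simp_all add: X_tail[where i = 0, symmetric])

lemma G_antimono: "a \<in> A \<Longrightarrow> antimono (G a)"
  unfolding X_tail[where i = 0, symmetric, THEN ext[of "G a" "\<lambda>u. \<P>(\<omega> in M. X a 0 \<omega> > u)"]]
  by (intro antimonoI finite_measure_mono) auto

lemma G_pos: "a \<in> A \<Longrightarrow> 0 < G a x"
  by (rule antimono_regularly_varying_pos[OF G_rv G_antimono G_nonneg])

lemma \<L>_nonneg: "a \<in> A \<Longrightarrow> t \<in> \<Lambda> \<Longrightarrow> 0 \<le> \<L> a t"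
  using V_pos[of a t 0] measure_nonneg by (rule order_trans[rotated])

lemma term_le_scale: "a \<in> A \<Longrightarrow> t \<in> \<Lambda> \<Longrightarrow> G a x * \<L> a t \<le> scale x t"
  unfolding scale_def using finite_A G_nonneg \<L>_nonneg by (intro member_le_sum) auto

lemma scale_nonneg: "t \<in> \<Lambda> \<Longrightarrow> 0 \<le> scale x t"
  unfolding scale_def using G_nonneg \<L>_nonneg by (intro sum_nonneg mult_nonneg_nonneg) auto

lemma V_int_alpha: "a \<in> A \<Longrightarrow> t \<in> \<Lambda> \<Longrightarrow> integrable M (\<lambda>\<omega>. V a i t \<omega> powr \<alpha>)"
  by (rule integrable_powr_between[OF _ V_nonneg V_int]) (use exps in auto)

lemma V_alpha_bound:
  assumes "a \<in> A" "t \<in> \<Lambda>"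
  shows "moment a i t \<le> K * q ^ i * \<L> a t"
proof -
  have "moment a i t \<le> two_moments \<alpha>' (V a i t)"
    using assms V_int V_int_alpha V_nonneg exps
    by (intro integral_mono powr_le_sum_powr Bochner_Integration.integrable_add) auto
  then show ?thesis using V_bound[OF assms, of i] by linarith
qed

lemma summable_V_alpha:
  assumes "a \<in> A" "t \<in> \<Lambda>"
  shows "summable (\<lambda>i. moment a i t)"
proof (rule summable_comparison_test')
  show "summable (\<lambda>i. K * q ^ i * \<L> a t)"
    using q by (intro summable_mult summable_mult2 summable_geometric) auto
  show "norm (moment a i t) \<le> K * q ^ i * \<L> a t" if "i \<ge> 0" for i
    using V_alpha_bound[OF assms, of i] by simp
qed

lemma V_alpha_tail_bound:
  assumes "a \<in> A" "t \<in> \<Lambda>"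
  shows "(\<Sum>i. moment a (i + N) t) \<le> K * q ^ N / (1 - q) * \<L> a t"
proof -
  have "(\<Sum>i. moment a (i + N) t) \<le> (\<Sum>i. K * q ^ N * \<L> a t * q ^ i)"
  proof (rule suminf_le)
    show "moment a (i + N) t \<le> K * q ^ N * \<L> a t * q ^ i" for i
      using V_alpha_bound[OF assms, of "i + N"] by (simp add: power_add ac_simps)
    show "summable (\<lambda>i. moment a (i + N) t)"
      using summable_V_alpha[OF assms] by (subst summable_iff_shift)
    show "summable (\<lambda>i. K * q ^ N * \<L> a t * q ^ i)"
      using q by (intro summable_mult summable_geometric) auto
  qed
  also have "\<dots> = K * q ^ N * \<L> a t * (1 / (1 - q))"
    using q by (subst suminf_mult) (auto simp: suminf_geometric intro: summable_geometric)
  finally show ?thesis by simp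
qed

lemma main_term_le: "t \<in> \<Lambda> \<Longrightarrow> main_term x t \<le> K / (1 - q) * scale x t"
proof -
  assume t: "t \<in> \<Lambda>"
  have "main_term x t \<le> (\<Sum>a\<in>A. G a x * (K / (1 - q) * \<L> a t))"
    unfolding main_term_def using V_alpha_tail_bound[OF _ t, of _ 0] G_nonneg
    by (intro sum_mono mult_left_mono) auto
  also have "\<dots> = K / (1 - q) * scale x t"
    unfolding scale_def sum_distrib_left by (simp add: ac_simps)
  finally show ?thesis .
qed

lemma eventually_product_asymp:
  assumes \<beta>: "\<alpha> < \<beta>" and \<epsilon>: "0 < \<epsilon>"
  shows "\<forall>\<^sub>F x in at_top. \<forall>a\<in>A. \<forall>i U. U \<in> borel_measurable \<G> \<longrightarrow> (\<forall>\<omega>\<in>space M. 0 \<le> U \<omega>) \<longrightarrow>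
    integrable M (\<lambda>\<omega>. U \<omega> powr \<alpha>\<^sub>1) \<longrightarrow> integrable M (\<lambda>\<omega>. U \<omega> powr \<beta>) \<longrightarrow>
    \<bar>\<P>(\<omega> in M. X a i \<omega> * U \<omega> > x) - G a x * expectation (\<lambda>\<omega>. U \<omega> powr \<alpha>)\<bar>
      \<le> \<epsilon> * G a x * two_moments \<beta> U"
proof -
  have "\<forall>\<^sub>F x in at_top. \<forall>a\<in>A. \<forall>w>0. \<bar>G a (x / w) - w powr \<alpha> * G a x\<bar>
      \<le> \<epsilon> * (w powr \<alpha>\<^sub>1 + w powr \<beta>) * G a x"
  proof (rule eventually_ball_finite[OF finite_A], rule ballI)
    fix a assume "a \<in> A"
    then show "\<forall>\<^sub>F x in at_top. \<forall>w>0. \<bar>G a (x / w) - w powr \<alpha> * G a x\<bar>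
      \<le> \<epsilon> * (w powr \<alpha>\<^sub>1 + w powr \<beta>) * G a x"
      using exps \<beta> \<epsilon> by (intro regularly_varying_uniform G_rv G_antimono G_pos G_le1)
  qed
  then show ?thesis
    using eventually_gt_at_top[of 0]
  proof eventually_elim
    case (elim x)
    show ?case
    proof (intro ballI allI impI)
      fix a i and U :: "'a \<Rightarrow> real"
      assume a: "a \<in> A" and U: "U \<in> borel_measurable \<G>" "\<forall>\<omega>\<in>space M. 0 \<le> U \<omega>"
        "integrable M (\<lambda>\<omega>. U \<omega> powr \<alpha>\<^sub>1)" "integrable M (\<lambda>\<omega>. U \<omega> powr \<beta>)"
      show "\<bar>\<P>(\<omega> in M. X a i \<omega> * U \<omega> > x) - G a x * expectation (\<lambda>\<omega>. U \<omega> powr \<alpha>)\<bar>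
        \<le> \<epsilon> * G a x * two_moments \<beta> U"
      proof (rule breiman_bound[OF X_indep[OF a U(1)] X_tail[OF a] _ elim(2) U(3,4)])
        show "0 \<le> U \<omega>" if "\<omega> \<in> space M" for \<omega> using U(2) that by blast
        show "\<alpha>\<^sub>1 \<le> \<alpha>" "\<alpha> \<le> \<beta>" using exps \<beta> by simp_all
        show "\<bar>G a (x / w) - w powr \<alpha> * G a x\<bar> \<le> \<epsilon> * (w powr \<alpha>\<^sub>1 + w powr \<beta>) * G a x"
          if "w > 0" for w using elim(1) a that by blast
      qed
    qed
  qed
qed

text \<open>Tolerance \<open>1\<close> in the asymptotics, with the \<open>\<alpha>\<close>-moment
  bounded by the two outer moments; hence the factor \<open>2\<close>.\<close>

lemma eventually_product_le:
  assumes \<beta>: "\<alpha> < \<beta>"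
  shows "\<forall>\<^sub>F x in at_top. \<forall>a\<in>A. \<forall>i U. U \<in> borel_measurable \<G> \<longrightarrow> (\<forall>\<omega>\<in>space M. 0 \<le> U \<omega>) \<longrightarrow>
    integrable M (\<lambda>\<omega>. U \<omega> powr \<alpha>\<^sub>1) \<longrightarrow> integrable M (\<lambda>\<omega>. U \<omega> powr \<beta>) \<longrightarrow>
    \<P>(\<omega> in M. X a i \<omega> * U \<omega> > x) \<le> 2 * G a x * two_moments \<beta> U"
  using eventually_product_asymp[OF \<beta> zero_less_one]
proof eventually_elim
  case (elim x)
  show ?case
  proof (intro ballI allI impI)
    fix a i and U :: "'a \<Rightarrow> real"
    assume a: "a \<in> A" and U: "U \<in> borel_measurable \<G>" "\<forall>\<omega>\<in>space M. 0 \<le> U \<omega>"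
      "integrable M (\<lambda>\<omega>. U \<omega> powr \<alpha>\<^sub>1)" "integrable M (\<lambda>\<omega>. U \<omega> powr \<beta>)"
    have "expectation (\<lambda>\<omega>. U \<omega> powr \<alpha>) \<le> two_moments \<beta> U"
    proof (rule integral_mono)
      show "integrable M (\<lambda>\<omega>. U \<omega> powr \<alpha>)"
        by (rule integrable_powr_between[OF measurable_sub[OF U(1)] bspec[OF U(2)] U(3,4)])
          (use exps \<beta> in simp_all)
      show "integrable M (\<lambda>\<omega>. U \<omega> powr \<alpha>\<^sub>1 + U \<omega> powr \<beta>)"
        using U(3,4) by (rule Bochner_Integration.integrable_add)
      show "U \<omega> powr \<alpha> \<le> U \<omega> powr \<alpha>\<^sub>1 + U \<omega> powr \<beta>" if "\<omega> \<in> space M" for \<omega>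
        using bspec[OF U(2) that] exps \<beta> by (intro powr_le_sum_powr) simp_all
    qed
    then have "G a x * expectation (\<lambda>\<omega>. U \<omega> powr \<alpha>) \<le> G a x * two_moments \<beta> U"
      using G_nonneg[OF a] by (intro mult_left_mono)
    moreover have "\<bar>\<P>(\<omega> in M. X a i \<omega> * U \<omega> > x) - G a x * expectation (\<lambda>\<omega>. U \<omega> powr \<alpha>)\<bar>
        \<le> 1 * G a x * two_moments \<beta> U"
      using elim a U by blast
    ultimately show "\<P>(\<omega> in M. X a i \<omega> * U \<omega> > x)
        \<le> 2 * G a x * two_moments \<beta> U"
      by linarith
  qed
qed

text \<open>The factor \<open>c\<close> moves into the weight, since \<open>X * V > c * x\<close>
  means \<open>X * (V / c) > x\<close>. The error retains \<open>q ^ i\<close> and so stays summable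
  over the claims.\<close>

lemma single_claim:
  assumes c: "0 < c" and \<epsilon>: "0 < \<epsilon>"
  shows "\<forall>\<^sub>F x in at_top. \<forall>a\<in>A. \<forall>i. \<forall>t\<in>\<Lambda>.
    \<bar>prob (exceed a i t (c * x)) - c powr (- \<alpha>) * (G a x * moment a i t)\<bar>
      \<le> \<epsilon> * q ^ i * (G a x * \<L> a t)"
proof -
  define C where "C = c powr (- \<alpha>\<^sub>1) + c powr (- \<alpha>')"
  have C: "0 < C" using c by (auto simp: C_def intro: add_pos_pos)
  \<comment> \<open>The \<open>+ 1\<close> keeps the denominator positive, as \<open>K\<close> may
    be \<open>0\<close>.\<close>
  define \<epsilon>' where "\<epsilon>' = \<epsilon> / (C * K + 1)"
  have CK: "0 \<le> C * K" using C K by simp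
  have \<epsilon>': "0 < \<epsilon>'" "\<epsilon>' * (C * K) \<le> \<epsilon>"
    using \<epsilon> CK by (auto simp: \<epsilon>'_def field_simps)
  show ?thesis
    using eventually_product_asymp[OF exps(3) \<epsilon>'(1)]
  proof eventually_elim
    case (elim x)
    show ?case
    proof (intro ballI allI)
      fix a i t assume a: "a \<in> A" and t: "t \<in> \<Lambda>"
      define U where "U \<omega> = V a i t \<omega> / c" for \<omega>
      have Up: "U \<omega> powr p = c powr (- p) * V a i t \<omega> powr p" if "\<omega> \<in> space M" for \<omega> p
        using c V_nonneg[OF a t that] by (simp add: U_def powr_divide powr_minus_divide)
      have int: "integrable M (\<lambda>\<omega>. U \<omega> powr p)" if "integrable M (\<lambda>\<omega>. V a i t \<omega> powr p)" for p
        using that by (subst Bochner_Integration.integrable_cong[OF refl Up]) auto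
      have ex: "expectation (\<lambda>\<omega>. U \<omega> powr p) = c powr (- p) * expectation (\<lambda>\<omega>. V a i t \<omega> powr p)" for p
        by (subst Bochner_Integration.integral_cong[OF refl Up]) auto
      have U: "U \<in> borel_measurable \<G>"
        unfolding U_def using V_meas[OF a t] by measurable
      have "\<bar>\<P>(\<omega> in M. X a i \<omega> * U \<omega> > x) - G a x * expectation (\<lambda>\<omega>. U \<omega> powr \<alpha>)\<bar>
          \<le> \<epsilon>' * G a x * two_moments \<alpha>' U"
      proof -
        have "\<forall>\<omega>\<in>space M. 0 \<le> U \<omega>" using V_nonneg[OF a t] c by (auto simp: U_def)
        then show ?thesis
          using elim a U int[OF V_int(1)[OF a t]] int[OF V_int(2)[OF a t]] by blast
      qed
      also have "two_moments \<alpha>' U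
          \<le> C * two_moments \<alpha>' (V a i t)"
      proof -
        have nn: "0 \<le> expectation (\<lambda>\<omega>. V a i t \<omega> powr p)" for p by simp
        have "two_moments \<alpha>' U =
          c powr (- \<alpha>\<^sub>1) * expectation (\<lambda>\<omega>. V a i t \<omega> powr \<alpha>\<^sub>1) + c powr (- \<alpha>') * expectation (\<lambda>\<omega>. V a i t \<omega> powr \<alpha>')"
          using int V_int a t by (simp add: ex)
        also have "\<dots> \<le> C * expectation (\<lambda>\<omega>. V a i t \<omega> powr \<alpha>\<^sub>1) + C * expectation (\<lambda>\<omega>. V a i t \<omega> powr \<alpha>')"
          using nn by (intro add_mono mult_right_mono) (auto simp: C_def)
        finally show ?thesis using V_int[OF a t] by (simp add: distrib_left)
      qed
      also have "C * two_moments \<alpha>' (V a i t) \<le> C * (K * q ^ i * \<L> a t)"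
        using C V_bound[OF a t, of i] by (intro mult_left_mono) auto
      finally have "\<bar>\<P>(\<omega> in M. X a i \<omega> * U \<omega> > x) - G a x * expectation (\<lambda>\<omega>. U \<omega> powr \<alpha>)\<bar>
          \<le> \<epsilon>' * G a x * (C * (K * q ^ i * \<L> a t))"
        using \<epsilon>' G_nonneg[OF a] by (simp add: mult_left_mono)
      also have "\<dots> = (\<epsilon>' * (C * K)) * (q ^ i * (G a x * \<L> a t))" by (simp add: ac_simps)
      also have "\<dots> \<le> \<epsilon> * (q ^ i * (G a x * \<L> a t))"
        using \<epsilon>' q G_nonneg[OF a] \<L>_nonneg[OF a t] by (intro mult_right_mono) auto
      finally have "\<bar>\<P>(\<omega> in M. X a i \<omega> * U \<omega> > x) - G a x * expectation (\<lambda>\<omega>. U \<omega> powr \<alpha>)\<bar>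
          \<le> \<epsilon> * q ^ i * (G a x * \<L> a t)" by (simp add: ac_simps)
      moreover have "(X a i \<omega> * U \<omega> > x) = (X a i \<omega> * V a i t \<omega> > c * x)" for \<omega>
        using c by (simp add: U_def field_simps)
      ultimately show "\<bar>prob (exceed a i t (c * x)) - c powr (- \<alpha>) * (G a x * moment a i t)\<bar>
          \<le> \<epsilon> * q ^ i * (G a x * \<L> a t)"
        by (simp add: ex ac_simps)
    qed
  qed
qed

text \<open>On \<open>V > \<kappa>\<close> a power of order \<open>\<beta> < \<alpha>'\<close> is at
  most \<open>\<kappa> powr (\<beta> - \<alpha>')\<close> times the power of order
  \<open>\<alpha>'\<close>, a factor that vanishes as \<kappa> grows. Removing large weights reduces
  joint exceedances of products to joint exceedances of bare claims.\<close>

lemma large_weight: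
  assumes \<eta>: "0 < \<eta>" "\<eta> \<le> 1" and \<epsilon>: "0 < \<epsilon>"
  obtains \<kappa> where "1 \<le> \<kappa>" "\<forall>\<^sub>F x in at_top. \<forall>a\<in>A. \<forall>i. \<forall>t\<in>\<Lambda>.
    \<P>(\<omega> in M. X a i \<omega> * V a i t \<omega> > \<eta> * x \<and> V a i t \<omega> > \<kappa>) \<le> \<epsilon> * (G a x * \<L> a t)"
proof -
  define \<beta> where "\<beta> = (\<alpha> + \<alpha>') / 2"
  have \<beta>: "\<alpha> < \<beta>" "\<beta> < \<alpha>'" using exps by (auto simp: \<beta>_def)
  define c where "c = 2 * \<eta> powr (- \<beta>)"
  have "((\<lambda>\<kappa>::real. 2 * c * K * \<kappa> powr (\<beta> - \<alpha>')) \<longlongrightarrow> 0) at_top"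
    using \<beta> by real_asymp
  then have "\<forall>\<^sub>F \<kappa> in at_top. 2 * c * K * \<kappa> powr (\<beta> - \<alpha>') < \<epsilon> \<and> \<kappa> \<ge> 1"
    using \<epsilon> by (intro eventually_conj order_tendstoD eventually_ge_at_top)
  then obtain \<kappa> where \<kappa>: "2 * c * K * \<kappa> powr (\<beta> - \<alpha>') < \<epsilon>" "\<kappa> \<ge> 1"
    unfolding eventually_at_top_linorder by blast
  define c' where "c' = c * \<kappa> powr (\<beta> - \<alpha>')"
  have c': "0 \<le> c'" by (simp add: c'_def c_def)
  have "\<forall>\<^sub>F x in at_top. \<forall>a\<in>A. \<forall>i. \<forall>t\<in>\<Lambda>.
    \<P>(\<omega> in M. X a i \<omega> * V a i t \<omega> > \<eta> * x \<and> V a i t \<omega> > \<kappa>) \<le> \<epsilon> * (G a x * \<L> a t)"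
    using eventually_product_le[OF \<beta>(1)] eventually_gt_at_top[of 0]
  proof eventually_elim
    case (elim x)
    show ?case
    proof (intro ballI allI)
      fix a i t assume a: "a \<in> A" and t: "t \<in> \<Lambda>"
      \<comment> \<open>Truncation and level are moved into one weight. Where \<open>U\<close> is
        nonzero it is at least \<open>1\<close>, so its power of order
        \<open>\<alpha>\<^sub>1\<close> is dominated by the one of order
        \<open>\<beta>\<close>.\<close>
      define U where "U \<omega> = (if V a i t \<omega> > \<kappa> then V a i t \<omega> / \<eta> else 0)" for \<omega>
      have U: "U \<in> borel_measurable \<G>"
        unfolding U_def using V_meas[OF a t] by measurable
      note [measurable] = measurable_sub[OF U]
      have Ub: "U \<omega> powr \<alpha>\<^sub>1 \<le> c' / 2 * V a i t \<omega> powr \<alpha>' \<and> U \<omega> powr \<beta> \<le> c' / 2 * V a i t \<omega> powr \<alpha>'" for \<omega>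
      proof (cases "V a i t \<omega> > \<kappa>")
        case True
        let ?v = "V a i t \<omega>"
        have v: "?v > 1" "?v / \<eta> \<ge> 1" using True \<kappa> \<eta> by (auto simp: field_simps)
        have "(?v / \<eta>) powr \<alpha>\<^sub>1 \<le> (?v / \<eta>) powr \<beta>"
          using v exps \<beta> by (intro powr_mono) auto
        moreover have "(?v / \<eta>) powr \<beta> = \<eta> powr (- \<beta>) * (?v powr (\<beta> - \<alpha>') * ?v powr \<alpha>')"
          using v \<eta> by (simp add: powr_divide powr_minus_divide powr_add[symmetric])
        moreover have "\<dots> \<le> \<eta> powr (- \<beta>) * (\<kappa> powr (\<beta> - \<alpha>') * ?v powr \<alpha>')"
          using True \<kappa> \<beta> by (intro mult_left_mono mult_right_mono powr_mono2') auto
        ultimately show ?thesis using True by (simp add: U_def c'_def c_def)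
      qed (use c' in \<open>simp add: U_def\<close>)
      have i1: "integrable M (\<lambda>\<omega>. U \<omega> powr \<alpha>\<^sub>1)" "integrable M (\<lambda>\<omega>. U \<omega> powr \<beta>)"
        by (rule Bochner_Integration.integrable_bound[OF integrable_mult_right[OF V_int(2)[OF a t, of i], of "c' / 2"]];
            use Ub c' in \<open>simp add: AE_I2\<close>)+
      have "two_moments \<beta> U
          \<le> expectation (\<lambda>\<omega>. c' * (V a i t \<omega> powr \<alpha>\<^sub>1 + V a i t \<omega> powr \<alpha>'))"
      proof (rule integral_mono)
        fix \<omega>
        have "U \<omega> powr \<alpha>\<^sub>1 + U \<omega> powr \<beta> \<le> c' * V a i t \<omega> powr \<alpha>'"
          using Ub[of \<omega>] by linarith
        also have "\<dots> \<le> c' * (V a i t \<omega> powr \<alpha>\<^sub>1 + V a i t \<omega> powr \<alpha>')"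
          using c' by (intro mult_left_mono) auto
        finally show "U \<omega> powr \<alpha>\<^sub>1 + U \<omega> powr \<beta> \<le> c' * (V a i t \<omega> powr \<alpha>\<^sub>1 + V a i t \<omega> powr \<alpha>')" .
      qed (use i1 V_int[OF a t] in auto)
      also have "\<dots> = c' * two_moments \<alpha>' (V a i t)" by simp
      also have "\<dots> \<le> c' * (K * q ^ i * \<L> a t)"
        using c' V_bound[OF a t] by (intro mult_left_mono)
      also have "\<dots> \<le> c' * (K * 1 * \<L> a t)"
        using c' K q \<L>_nonneg[OF a t] by (intro mult_left_mono mult_right_mono) (auto simp: power_le_one)
      finally have ex: "two_moments \<beta> U \<le> c' * K * \<L> a t" by simp
      have "(X a i \<omega> * V a i t \<omega> > \<eta> * x \<and> V a i t \<omega> > \<kappa>) = (X a i \<omega> * U \<omega> > x)" for \<omega>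
        using elim(2) \<eta> by (auto simp: U_def field_simps)
      then have "\<P>(\<omega> in M. X a i \<omega> * V a i t \<omega> > \<eta> * x \<and> V a i t \<omega> > \<kappa>) = \<P>(\<omega> in M. X a i \<omega> * U \<omega> > x)"
        by simp
      also have "\<dots> \<le> 2 * G a x * two_moments \<beta> U"
      proof -
        have "\<forall>\<omega>\<in>space M. 0 \<le> U \<omega>" using V_nonneg[OF a t] \<eta> by (auto simp: U_def)
        then show ?thesis using elim(1) a U i1 by blast
      qed
      also have "\<dots> \<le> 2 * G a x * (c' * K * \<L> a t)"
        using ex G_nonneg[OF a] by (intro mult_left_mono) auto
      also have "\<dots> = (2 * c * K * \<kappa> powr (\<beta> - \<alpha>')) * (G a x * \<L> a t)"
        by (simp add: c'_def ac_simps)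
      also have "\<dots> \<le> \<epsilon> * (G a x * \<L> a t)"
        using \<kappa> G_nonneg[OF a] \<L>_nonneg[OF a t] by (intro mult_right_mono) auto
      finally show "\<P>(\<omega> in M. X a i \<omega> * V a i t \<omega> > \<eta> * x \<and> V a i t \<omega> > \<kappa>) \<le> \<epsilon> * (G a x * \<L> a t)" .
    qed
  qed
  then show thesis using that \<kappa> by blast
qed

text \<open>If neither weight exceeds \<kappa>, both claims exceed \<open>s * x\<close>, an event
  independent of the weights. The probability that \<open>V a i t\<close> is positive is kept as a
  factor: it supplies \<open>\<L> a t\<close>, which makes the bound relative to
  \<open>scale\<close> even for small \<open>t\<close>.\<close>

lemma joint_claims:
  assumes a: "a \<in> A" and b: "b \<in> A" and ne: "(a, i) \<noteq> (b, j)"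
    and \<eta>: "0 < \<eta>" "\<eta> \<le> 1" and \<epsilon>: "0 < \<epsilon>"
  shows "\<forall>\<^sub>F x in at_top. \<forall>t\<in>\<Lambda>.
    \<P>(\<omega> in M. X a i \<omega> * V a i t \<omega> > \<eta> * x \<and> X b j \<omega> * V b j t \<omega> > \<eta> * x) \<le> \<epsilon> * scale x t"
proof -
  obtain \<kappa> where \<kappa>: "1 \<le> \<kappa>" and large: "\<forall>\<^sub>F x in at_top. \<forall>a\<in>A. \<forall>i. \<forall>t\<in>\<Lambda>.
    \<P>(\<omega> in M. X a i \<omega> * V a i t \<omega> > \<eta> * x \<and> V a i t \<omega> > \<kappa>) \<le> \<epsilon> / 4 * (G a x * \<L> a t)"
    using large_weight[OF \<eta>, of "\<epsilon> / 4"] \<epsilon> by auto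
  define s where "s = \<eta> / \<kappa>"
  have s: "0 < s" using \<eta> \<kappa> by (simp add: s_def)
  define p where "p y = \<P>(\<omega> in M. X a i \<omega> > y \<and> X b j \<omega> > y)" for y
  have "((\<lambda>y. p y / G a y) \<longlongrightarrow> 0) at_top"
    unfolding p_def by (rule joint[OF a b ne])
  then have "((\<lambda>x. p (s * x) / G a (s * x)) \<longlongrightarrow> 0) at_top"
    by (rule filterlim_compose) (use s in real_asymp)
  \<comment> \<open>Regular variation replaces the tail at level \<open>s * x\<close> by the tail at
    level \<open>x\<close> in the denominator.\<close>
  moreover have "((\<lambda>x. G a (s * x) / G a x) \<longlongrightarrow> s powr (- \<alpha>)) at_top"
    using G_rv[OF a] s by (rule regularly_varying_tendsto)
  ultimately have "((\<lambda>x. (p (s * x) / G a (s * x)) * (G a (s * x) / G a x)) \<longlongrightarrow> 0 * s powr (- \<alpha>)) at_top"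
    by (rule tendsto_mult)
  moreover have "(p (s * x) / G a (s * x)) * (G a (s * x) / G a x) = p (s * x) / G a x" for x
    using G_pos[OF a, of "s * x"] by simp
  ultimately have "((\<lambda>x. p (s * x) / G a x) \<longlongrightarrow> 0) at_top" by (simp only: mult_zero_left)
  then have "\<forall>\<^sub>F x in at_top. p (s * x) / G a x < \<epsilon> / 4"
    using \<epsilon> by (intro order_tendstoD) auto
  then show ?thesis
    using large eventually_gt_at_top[of 0]
  proof eventually_elim
    case (elim x)
    show ?case
    proof
      fix t assume t: "t \<in> \<Lambda>"
      note [measurable] = X_meas[OF a] X_meas[OF b] V_meas_M[OF a t] V_meas_M[OF b t]
      define B1 where "B1 = {\<omega> \<in> space M. X a i \<omega> * V a i t \<omega> > \<eta> * x \<and> V a i t \<omega> > \<kappa>}"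
      define B2 where "B2 = {\<omega> \<in> space M. X b j \<omega> * V b j t \<omega> > \<eta> * x \<and> V b j t \<omega> > \<kappa>}"
      define B where "B = {\<omega> \<in> space \<G>. V a i t \<omega> > 0}"
      have B: "B \<in> sets \<G>" unfolding B_def using V_meas[OF a t] by measurable
      then have [measurable]: "B \<in> events" using sub by (auto simp: subalgebra_def)
      define B3 where "B3 = {\<omega> \<in> space M. X a i \<omega> > s * x \<and> X b j \<omega> > s * x \<and> \<omega> \<in> B}"
      have ev: "B1 \<in> events" "B2 \<in> events" "B3 \<in> events"
        unfolding B1_def B2_def B3_def by measurable
      have key: "Y > s * x" if "Y * v > \<eta> * x" "v \<le> \<kappa>" "0 \<le> v" "0 \<le> Y" for Y v :: real
      proof -
        have "Y * v \<le> Y * \<kappa>" using that by (intro mult_left_mono) auto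
        then have "\<eta> * x < Y * \<kappa>" using that by linarith
        then show ?thesis using \<kappa> by (simp add: s_def field_simps)
      qed
      have "{\<omega> \<in> space M. X a i \<omega> * V a i t \<omega> > \<eta> * x \<and> X b j \<omega> * V b j t \<omega> > \<eta> * x} \<subseteq> B1 \<union> B2 \<union> B3"
      proof
        fix \<omega> assume w: "\<omega> \<in> {\<omega> \<in> space M. X a i \<omega> * V a i t \<omega> > \<eta> * x \<and> X b j \<omega> * V b j t \<omega> > \<eta> * x}"
        have "0 < \<eta> * x" using \<eta> elim(3) by simp
        then have "V a i t \<omega> \<noteq> 0" using w by auto
        then have "\<omega> \<in> B" using w V_nonneg[OF a t, of \<omega> i] sub
          by (auto simp: B_def subalgebra_def less_le)
        then show "\<omega> \<in> B1 \<union> B2 \<union> B3"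
          using w key[of "X a i \<omega>" "V a i t \<omega>"] key[of "X b j \<omega>" "V b j t \<omega>"]
            V_nonneg[OF a t, of \<omega> i] V_nonneg[OF b t, of \<omega> j] X_nonneg[OF a, of \<omega> i] X_nonneg[OF b, of \<omega> j]
          by (auto simp: B1_def B2_def B3_def not_less)
      qed
      then have "\<P>(\<omega> in M. X a i \<omega> * V a i t \<omega> > \<eta> * x \<and> X b j \<omega> * V b j t \<omega> > \<eta> * x) \<le> prob (B1 \<union> B2 \<union> B3)"
        using ev by (intro finite_measure_mono) auto
      also have "\<dots> \<le> prob B1 + prob B2 + prob B3"
        using ev measure_Un_le[of "B1 \<union> B2" M B3] measure_Un_le[of B1 M B2] by simp
      also have "prob B1 \<le> \<epsilon> / 4 * (G a x * \<L> a t)"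
        unfolding B1_def using elim(2) a t by blast
      also have "prob B2 \<le> \<epsilon> / 4 * (G b x * \<L> b t)"
        unfolding B2_def using elim(2) b t by blast
      also have "prob B3 \<le> \<epsilon> / 4 * (G a x * \<L> a t)"
      proof -
        have "prob B3 = p (s * x) * prob B"
          unfolding B3_def p_def by (rule XX_indep[OF a b B])
        also have "\<dots> \<le> (\<epsilon> / 4 * G a x) * \<L> a t"
        proof (intro mult_mono)
          show "p (s * x) \<le> \<epsilon> / 4 * G a x"
            using elim(1) G_pos[OF a, of x] by (simp add: field_simps)
          show "prob B \<le> \<L> a t"
            using V_pos[OF a t, of i] sub by (simp add: B_def subalgebra_def)
        qed (use \<epsilon> G_nonneg[OF a] in auto)
        finally show ?thesis by (simp add: ac_simps)
      qed
      also have "\<epsilon> / 4 * (G a x * \<L> a t) + \<epsilon> / 4 * (G b x * \<L> b t) + \<epsilon> / 4 * (G a x * \<L> a t)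
          \<le> \<epsilon> / 4 * scale x t + \<epsilon> / 4 * scale x t + \<epsilon> / 4 * scale x t"
        using \<epsilon> term_le_scale[OF a t] term_le_scale[OF b t] by (intro add_mono mult_left_mono) auto
      also have "\<dots> \<le> \<epsilon> * scale x t"
        using \<epsilon> scale_nonneg[OF t, of x] by simp
      finally show "\<P>(\<omega> in M. X a i \<omega> * V a i t \<omega> > \<eta> * x \<and> X b j \<omega> * V b j t \<omega> > \<eta> * x) \<le> \<epsilon> * scale x t"
        by simp
    qed
  qed
qed

lemma ev_gt[measurable]: "a \<in> A \<Longrightarrow> t \<in> \<Lambda> \<Longrightarrow> (exceed a i t y) \<in> events"
proof -
  assume a: "a \<in> A" and t: "t \<in> \<Lambda>"
  note [measurable] = X_meas[OF a] V_meas_M[OF a t]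
  show ?thesis by measurable
qed

text \<open>Since \<open>E (V a i t powr \<alpha>')\<close> decays like \<open>q ^ i\<close>, the level \<open>\<delta> x\<close> can be split among the claims
  with geometric weights \<open>y i\<close>, and the union bound needs no moment of the claims.\<close>

lemma tail_claims:
  assumes \<delta>: "0 < \<delta>" "\<delta> \<le> 1" and \<epsilon>: "0 < \<epsilon>"
  obtains N where "\<And>N'. N' \<ge> N \<Longrightarrow> \<forall>\<^sub>F x in at_top. \<forall>t\<in>\<Lambda>.
    \<P>(\<omega> in M. (\<Sum>a\<in>A. \<Sum>i. ennreal (X a (i + N') \<omega> * V a (i + N') t \<omega>)) > ennreal (\<delta> * x)) \<le> \<epsilon> * scale x t"
proof -
  \<comment> \<open>The power \<open>r powr \<alpha>' = (1 + q) / 2\<close> lies strictly between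
    \<open>q\<close> and \<open>1\<close>. So \<open>r < 1\<close> makes the levels
    \<open>y i\<close> summable, while the ratio \<open>z\<close> of \<open>q\<close> to this power
    is still below \<open>1\<close>, which makes the union bound summable.\<close>
  define r where "r = ((1 + q) / 2) powr (1 / \<alpha>')"
  have \<alpha>'_pos: "0 < \<alpha>'" using exps by linarith
  have r_pow: "r powr \<alpha>' = (1 + q) / 2"
    using q \<alpha>'_pos by (simp add: r_def powr_powr)
  have r: "0 < r" "r < 1"
  proof -
    show "0 < r" using q by (simp add: r_def)
    have "((1 + q) / 2) powr (1 / \<alpha>') < 1 powr (1 / \<alpha>')"
      using q \<alpha>'_pos by (intro powr_less_mono2) auto
    then show "r < 1" by (simp add: r_def)
  qed
  define s where "s = real (card A)"
  have s: "1 \<le> s" using finite_A A_nonempty by (simp add: s_def Suc_le_eq card_gt_0_iff)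
  \<comment> \<open>Normalised so that the \<open>y i\<close>, summed over all \<open>i\<close> and
    all \<open>s\<close> types, give \<open>1\<close>.\<close>
  define y where "y i = (1 - r) / s * r ^ i" for i
  have y: "0 < y i" "y i \<le> 1" for i
  proof -
    show "0 < y i" using r s by (simp add: y_def)
    have "(1 - r) / s \<le> 1" using r s by (simp add: field_simps)
    then show "y i \<le> 1" unfolding y_def using r s by (intro mult_le_one power_le_one; simp)+
  qed
  define D where "D = 2 * K * (\<delta> * ((1 - r) / s)) powr (- \<alpha>')"
  define z where "z = 2 * q / (1 + q)"
  have z: "0 \<le> z" "z < 1" using q by (auto simp: z_def field_simps)
  have D: "0 \<le> D" using K by (simp add: D_def)
  have yz: "2 * ((y i * \<delta>) powr (- \<alpha>') * (K * q ^ i)) = D * z ^ i" for i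
  proof -
    have "(y i * \<delta>) powr (- \<alpha>') = (\<delta> * ((1 - r) / s) * r ^ i) powr (- \<alpha>')"
      by (simp add: y_def ac_simps)
    also have "\<dots> = (\<delta> * ((1 - r) / s)) powr (- \<alpha>') * (r ^ i) powr (- \<alpha>')"
      by (rule powr_mult)
    also have "(r ^ i) powr (- \<alpha>') = (2 / (1 + q)) ^ i"
    proof -
      have "(r ^ i) powr (- \<alpha>') = (r powr \<alpha>') powr (- real i)"
        using r by (simp add: powr_realpow[symmetric] powr_powr ac_simps)
      also have "\<dots> = ((1 + q) / 2) powr (- real i)" by (simp only: r_pow)
      also have "\<dots> = (2 / (1 + q)) ^ i"
        using q by (simp add: powr_minus powr_realpow power_divide)
      finally show ?thesis .
    qed
    finally show ?thesis by (simp add: D_def z_def power_divide power_mult_distrib)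
  qed
  have "(\<lambda>N. D * z ^ N / (1 - z)) \<longlonglongrightarrow> D * 0 / (1 - z)"
    using z by (intro tendsto_intros LIMSEQ_realpow_zero) auto
  then have "\<forall>\<^sub>F N in sequentially. D * z ^ N / (1 - z) < \<epsilon>"
    using \<epsilon> by (intro order_tendstoD) auto
  then obtain N where N: "\<And>n. n \<ge> N \<Longrightarrow> D * z ^ n / (1 - z) < \<epsilon>"
    by (auto simp: eventually_sequentially)
  show thesis
  proof (rule that[of N])
    fix N' assume "N' \<ge> N"
    then have N': "D * z ^ N' / (1 - z) \<le> \<epsilon>" using N by (simp add: less_imp_le)
    show "\<forall>\<^sub>F x in at_top. \<forall>t\<in>\<Lambda>.
      \<P>(\<omega> in M. (\<Sum>a\<in>A. \<Sum>i. ennreal (X a (i + N') \<omega> * V a (i + N') t \<omega>)) > ennreal (\<delta> * x)) \<le> \<epsilon> * scale x t"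
      using eventually_product_le[OF exps(3)] eventually_gt_at_top[of 0]
    proof eventually_elim
      case (elim x)
      show ?case
      proof
        fix t assume t: "t \<in> \<Lambda>"
        define B where "B a i = (exceed a i t (y i * \<delta> * x))" for a i
        have B: "B a i \<in> events" if "a \<in> A" for a i
          unfolding B_def using that t by (rule ev_gt)
        have single: "prob (B a i) \<le> D * z ^ i * (G a x * \<L> a t)" if a: "a \<in> A" for a i
        proof -
          define c where "c = y i * \<delta>"
          have c: "0 < c" "c \<le> 1" using y[of i] \<delta> by (auto simp: c_def intro: mult_le_one)
          define U where "U \<omega> = V a i t \<omega> / c" for \<omega>
          have U: "U \<in> borel_measurable \<G>" unfolding U_def using V_meas[OF a t] by measurable
          have U0: "\<forall>\<omega>\<in>space M. 0 \<le> U \<omega>" using V_nonneg[OF a t] c by (auto simp: U_def)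
          have Up: "U \<omega> powr p = c powr (- p) * V a i t \<omega> powr p" if "\<omega> \<in> space M" for \<omega> p
            using c V_nonneg[OF a t that] by (simp add: U_def powr_divide powr_minus_divide)
          have int: "integrable M (\<lambda>\<omega>. U \<omega> powr p)" if "integrable M (\<lambda>\<omega>. V a i t \<omega> powr p)" for p
            using that by (subst Bochner_Integration.integrable_cong[OF refl Up]) auto
          have "B a i = {\<omega> \<in> space M. X a i \<omega> * U \<omega> > x}"
            using c(1) unfolding B_def c_def[symmetric] U_def by (simp add: pos_less_divide_eq ac_simps)
          then have "prob (B a i) \<le> 2 * G a x * two_moments \<alpha>' U"
            using elim(1) a U U0 int[OF V_int(1)[OF a t]] int[OF V_int(2)[OF a t]] by simp
          also have "two_moments \<alpha>' U
              \<le> expectation (\<lambda>\<omega>. c powr (- \<alpha>') * (V a i t \<omega> powr \<alpha>\<^sub>1 + V a i t \<omega> powr \<alpha>'))"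
          proof (rule integral_mono)
            fix \<omega> assume w: "\<omega> \<in> space M"
            \<comment> \<open>As \<open>c \<le> 1\<close>, the cost of rescaling the higher moment
              covers that of the lower one.\<close>
            have "c powr (- \<alpha>\<^sub>1) \<le> c powr (- \<alpha>')" using c exps by (intro powr_mono') auto
            then show "U \<omega> powr \<alpha>\<^sub>1 + U \<omega> powr \<alpha>' \<le> c powr (- \<alpha>') * (V a i t \<omega> powr \<alpha>\<^sub>1 + V a i t \<omega> powr \<alpha>')"
              by (simp add: Up[OF w] distrib_left mult_right_mono)
          qed (intro Bochner_Integration.integrable_add integrable_mult_right int V_int a t)+
          also have "\<dots> = c powr (- \<alpha>') * two_moments \<alpha>' (V a i t)"
            by simp
          also have "\<dots> \<le> c powr (- \<alpha>') * (K * q ^ i * \<L> a t)"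
            using V_bound[OF a t] by (intro mult_left_mono) auto
          finally have "prob (B a i) \<le> 2 * G a x * (c powr (- \<alpha>') * (K * q ^ i * \<L> a t))"
            using G_nonneg[OF a] by (simp add: mult_left_mono)
          also have "\<dots> = 2 * ((y i * \<delta>) powr (- \<alpha>') * (K * q ^ i)) * (G a x * \<L> a t)"
            by (simp add: c_def ac_simps)
          finally show ?thesis by (simp only: yz)
        qed
        define C where "C i = (\<Union>a\<in>A. B a (i + N'))" for i
        have C: "C i \<in> events" for i unfolding C_def using B finite_A by auto
        have pC: "prob (C i) \<le> D * z ^ N' * scale x t * z ^ i" for i
        proof -
          have "prob (C i) \<le> (\<Sum>a\<in>A. prob (B a (i + N')))"
            unfolding C_def using B finite_A by (intro finite_measure_subadditive_finite) auto
          also have "\<dots> \<le> (\<Sum>a\<in>A. D * z ^ (i + N') * (G a x * \<L> a t))"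
            by (intro sum_mono single)
          also have "\<dots> = D * z ^ N' * scale x t * z ^ i"
            by (simp add: scale_def sum_distrib_left sum_distrib_right power_add ac_simps)
          finally show ?thesis .
        qed
        have sg: "summable (\<lambda>i. D * z ^ N' * scale x t * z ^ i)"
          using z by (intro summable_mult summable_geometric) auto
        have sC: "summable (\<lambda>i. prob (C i))"
          by (rule summable_comparison_test'[OF sg]) (use pC in auto)
        have "{\<omega> \<in> space M. (\<Sum>a\<in>A. \<Sum>i. ennreal (X a (i + N') \<omega> * V a (i + N') t \<omega>)) > ennreal (\<delta> * x)} \<subseteq> (\<Union>i. C i)"
        proof (rule ccontr)
          assume "\<not> ?thesis"
          then obtain \<omega> where w: "\<omega> \<in> space M" "\<omega> \<notin> (\<Union>i. C i)"
            and gt: "(\<Sum>a\<in>A. \<Sum>i. ennreal (X a (i + N') \<omega> * V a (i + N') t \<omega>)) > ennreal (\<delta> * x)" by blast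
          have "(\<Sum>a\<in>A. \<Sum>i. ennreal (X a (i + N') \<omega> * V a (i + N') t \<omega>)) \<le> (\<Sum>a\<in>A. ennreal (\<delta> * x / s))"
          proof (rule sum_mono)
            fix a assume a: "a \<in> A"
            have "(\<Sum>i. ennreal (X a (i + N') \<omega> * V a (i + N') t \<omega>)) \<le> (\<Sum>i. ennreal ((1 - r) / s * \<delta> * x * r ^ i))"
            proof (intro suminf_le ennreal_leI)
              fix i
              \<comment> \<open>Levels are attached to absolute indices. Replacing
                \<open>y (i + N')\<close> by the larger \<open>y i\<close> keeps their total at most
                \<open>\<delta> * x\<close> for every \<open>N'\<close>.\<close>
              have "X a (i + N') \<omega> * V a (i + N') t \<omega> \<le> y (i + N') * \<delta> * x"
                using w a by (auto simp: C_def B_def not_less)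
              also have "\<dots> \<le> y i * \<delta> * x"
              proof -
                have "r ^ (i + N') \<le> r ^ i" using r by (intro power_decreasing) auto
                then have "y (i + N') \<le> y i" unfolding y_def using r s by (intro mult_left_mono) simp_all
                then show ?thesis using \<delta> elim(2) by (intro mult_right_mono) simp_all
              qed
              finally show "X a (i + N') \<omega> * V a (i + N') t \<omega> \<le> (1 - r) / s * \<delta> * x * r ^ i"
                by (simp add: y_def ac_simps)
            qed auto
            also have "\<dots> = ennreal ((1 - r) / s * \<delta> * x * (1 / (1 - r)))"
            proof (rule suminf_ennreal_eq)
              show "(\<lambda>i. (1 - r) / s * \<delta> * x * r ^ i) sums ((1 - r) / s * \<delta> * x * (1 / (1 - r)))"
                using r by (intro sums_mult geometric_sums) auto
            qed (use r s \<delta> elim(2) in auto)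
            also have "(1 - r) / s * \<delta> * x * (1 / (1 - r)) = \<delta> * x / s"
              using r by simp
            finally show "(\<Sum>i. ennreal (X a (i + N') \<omega> * V a (i + N') t \<omega>)) \<le> ennreal (\<delta> * x / s)" .
          qed
          also have "\<dots> = ennreal (\<Sum>a\<in>A. \<delta> * x / s)"
            using s \<delta> elim(2) by (intro sum_ennreal) auto
          also have "(\<Sum>a\<in>A. \<delta> * x / s) = \<delta> * x"
            using s by (simp add: s_def)
          finally show False using gt by simp
        qed
        then have "\<P>(\<omega> in M. (\<Sum>a\<in>A. \<Sum>i. ennreal (X a (i + N') \<omega> * V a (i + N') t \<omega>)) > ennreal (\<delta> * x)) \<le> prob (\<Union>i. C i)"
          using C by (intro finite_measure_mono) auto
        also have "\<dots> \<le> (\<Sum>i. prob (C i))"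
          using C sC by (intro finite_measure_subadditive_countably) auto
        also have "\<dots> \<le> (\<Sum>i. D * z ^ N' * scale x t * z ^ i)"
          by (rule suminf_le[OF pC sC sg])
        also have "\<dots> = D * z ^ N' * scale x t * (1 / (1 - z))"
          using z by (subst suminf_mult) (auto simp: suminf_geometric intro: summable_geometric)
        also have "\<dots> = (D * z ^ N' / (1 - z)) * scale x t" by simp
        also have "\<dots> \<le> \<epsilon> * scale x t"
          using N' scale_nonneg[OF t] by (rule mult_right_mono)
        finally show "\<P>(\<omega> in M. (\<Sum>a\<in>A. \<Sum>i. ennreal (X a (i + N') \<omega> * V a (i + N') t \<omega>)) > ennreal (\<delta> * x)) \<le> \<epsilon> * scale x t" .
      qed
    qed
  qed
qed

lemma joint_claims_finite:
  assumes I: "finite I" "I \<subseteq> A \<times> UNIV" and \<eta>: "0 < \<eta>" "\<eta> \<le> 1" and \<epsilon>: "0 < \<epsilon>"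
  shows "\<forall>\<^sub>F x in at_top. \<forall>t\<in>\<Lambda>. (\<Sum>n\<in>I. \<Sum>m\<in>I - {n}.
    prob ((exceed (fst n) (snd n) t (\<eta> * x)) \<inter>
      (exceed (fst m) (snd m) t (\<eta> * x)))) \<le> \<epsilon> * scale x t"
proof -
  \<comment> \<open>Bounds the number of ordered pairs; the \<open>+ 1\<close> allows division when
    \<open>I\<close> is empty.\<close>
  define k where "k = real (card I) * real (card I) + 1"
  have k: "0 < k" unfolding k_def by (intro add_nonneg_pos) auto
  have "\<forall>\<^sub>F x in at_top. \<forall>n\<in>I. \<forall>m\<in>I - {n}. \<forall>t\<in>\<Lambda>.
    \<P>(\<omega> in M. X (fst n) (snd n) \<omega> * V (fst n) (snd n) t \<omega> > \<eta> * x \<and>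
      X (fst m) (snd m) \<omega> * V (fst m) (snd m) t \<omega> > \<eta> * x) \<le> \<epsilon> / k * scale x t"
  proof (rule eventually_ball_finite[OF I(1)], rule ballI)
    fix n assume n: "n \<in> I"
    show "\<forall>\<^sub>F x in at_top. \<forall>m\<in>I - {n}. \<forall>t\<in>\<Lambda>.
      \<P>(\<omega> in M. X (fst n) (snd n) \<omega> * V (fst n) (snd n) t \<omega> > \<eta> * x \<and>
        X (fst m) (snd m) \<omega> * V (fst m) (snd m) t \<omega> > \<eta> * x) \<le> \<epsilon> / k * scale x t"
    proof (rule eventually_ball_finite, use I(1) in simp, rule ballI)
      fix m assume m: "m \<in> I - {n}"
      show "\<forall>\<^sub>F x in at_top. \<forall>t\<in>\<Lambda>.
      \<P>(\<omega> in M. X (fst n) (snd n) \<omega> * V (fst n) (snd n) t \<omega> > \<eta> * x \<and>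
        X (fst m) (snd m) \<omega> * V (fst m) (snd m) t \<omega> > \<eta> * x) \<le> \<epsilon> / k * scale x t"
        using I(2) \<eta> \<epsilon> k n m by (intro joint_claims) (auto simp: prod_eq_iff)
    qed
  qed
  then show ?thesis
  proof eventually_elim
    case (elim x)
    show ?case
    proof
      fix t assume t: "t \<in> \<Lambda>"
      have "(\<Sum>n\<in>I. \<Sum>m\<in>I - {n}.
        prob ((exceed (fst n) (snd n) t (\<eta> * x)) \<inter>
          (exceed (fst m) (snd m) t (\<eta> * x))))
        \<le> (\<Sum>n\<in>I. \<Sum>m\<in>I - {n}. \<epsilon> / k * scale x t)"
      proof (intro sum_mono)
        fix n m assume nm: "n \<in> I" "m \<in> I - {n}"
        have e: "(exceed (fst n) (snd n) t (\<eta> * x)) \<inter>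
          (exceed (fst m) (snd m) t (\<eta> * x)) =
          {\<omega> \<in> space M. X (fst n) (snd n) \<omega> * V (fst n) (snd n) t \<omega> > \<eta> * x \<and>
          X (fst m) (snd m) \<omega> * V (fst m) (snd m) t \<omega> > \<eta> * x}" by blast
        show "prob ((exceed (fst n) (snd n) t (\<eta> * x)) \<inter>
          (exceed (fst m) (snd m) t (\<eta> * x))) \<le> \<epsilon> / k * scale x t"
          unfolding e using elim nm t by blast
      qed
      also have "\<dots> \<le> (\<Sum>n\<in>I. \<Sum>m\<in>I. \<epsilon> / k * scale x t)"
        using I(1) \<epsilon> k scale_nonneg[OF t, of x] by (intro sum_mono sum_mono2) auto
      also have "\<dots> = (real (card I) * real (card I)) * (\<epsilon> / k * scale x t)" by simp
      also have "\<dots> \<le> k * (\<epsilon> / k * scale x t)"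
        using \<epsilon> k scale_nonneg[OF t, of x] by (intro mult_right_mono) (auto simp: k_def)
      also have "\<dots> = \<epsilon> * scale x t" using k by simp
      finally show "(\<Sum>n\<in>I. \<Sum>m\<in>I - {n}.
        prob ((exceed (fst n) (snd n) t (\<eta> * x)) \<inter>
          (exceed (fst m) (snd m) t (\<eta> * x)))) \<le> \<epsilon> * scale x t" .
    qed
  qed
qed

text \<open>The errors of \<open>single_claim\<close> are geometric in \<open>i\<close>. With
  tolerance \<open>\<epsilon> * (1 - q)\<close> their sum is at most \<epsilon> times
  \<open>scale\<close>, whatever the number \<open>N\<close> of claims.\<close>

lemma sum_single_claims:
  assumes c: "0 < c" and \<epsilon>: "0 < \<epsilon>"
  shows "\<forall>\<^sub>F x in at_top. \<forall>N. \<forall>t\<in>\<Lambda>.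
    \<bar>(\<Sum>n\<in>A \<times> {..<N}. prob (exceed (fst n) (snd n) t (c * x)))
      - c powr (- \<alpha>) * (\<Sum>a\<in>A. G a x * (\<Sum>i<N. moment a i t))\<bar> \<le> \<epsilon> * scale x t"
proof -
  have q': "0 < \<epsilon> * (1 - q)" using \<epsilon> q by simp
  show ?thesis
    using single_claim[OF c q']
  proof eventually_elim
    case (elim x)
    show ?case
    proof (intro allI ballI)
      fix N t assume t: "t \<in> \<Lambda>"
      let ?p = "\<lambda>a i. prob (exceed a i t (c * x))"
      let ?e = "\<lambda>a i. c powr (- \<alpha>) * (G a x * moment a i t)"
      have "\<bar>(\<Sum>a\<in>A. \<Sum>i<N. ?p a i) - (\<Sum>a\<in>A. \<Sum>i<N. ?e a i)\<bar> = \<bar>\<Sum>a\<in>A. \<Sum>i<N. (?p a i - ?e a i)\<bar>"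
        by (simp add: sum_subtractf)
      also have "\<dots> \<le> (\<Sum>a\<in>A. \<Sum>i<N. \<bar>?p a i - ?e a i\<bar>)"
        by (intro order.trans[OF sum_abs] sum_mono sum_abs)
      also have "\<dots> \<le> (\<Sum>a\<in>A. \<Sum>i<N. \<epsilon> * (1 - q) * q ^ i * (G a x * \<L> a t))"
        using elim t by (intro sum_mono) blast
      also have "\<dots> = (\<Sum>a\<in>A. \<epsilon> * (1 - q) * (\<Sum>i<N. q ^ i) * (G a x * \<L> a t))"
        by (simp add: sum_distrib_left sum_distrib_right)
      also have "\<dots> \<le> (\<Sum>a\<in>A. \<epsilon> * (G a x * \<L> a t))"
      proof (intro sum_mono mult_right_mono)
        fix a assume a: "a \<in> A"
        have "(1 - q) * (\<Sum>i<N. q ^ i) = 1 - q ^ N" using one_diff_power_eq[of q N] by simp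
        then have "\<epsilon> * (1 - q) * (\<Sum>i<N. q ^ i) = \<epsilon> * (1 - q ^ N)" by (simp add: mult.assoc)
        also have "\<dots> \<le> \<epsilon> * 1" using \<epsilon> q by (intro mult_left_mono) auto
        finally show "\<epsilon> * (1 - q) * (\<Sum>i<N. q ^ i) \<le> \<epsilon>" by simp
        show "0 \<le> G a x * \<L> a t" using G_nonneg[OF a] \<L>_nonneg[OF a t] by simp
      qed
      also have "\<dots> = \<epsilon> * scale x t" by (simp add: scale_def sum_distrib_left)
      finally have "\<bar>(\<Sum>a\<in>A. \<Sum>i<N. ?p a i) - (\<Sum>a\<in>A. \<Sum>i<N. ?e a i)\<bar> \<le> \<epsilon> * scale x t" .
      then show "\<bar>(\<Sum>n\<in>A \<times> {..<N}. prob (exceed (fst n) (snd n) t (c * x)))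
        - c powr (- \<alpha>) * (\<Sum>a\<in>A. G a x * (\<Sum>i<N. moment a i t))\<bar> \<le> \<epsilon> * scale x t"
        by (simp add: sum.cartesian_product' sum_distrib_left)
    qed
  qed
qed

lemma main_term_split:
  assumes t: "t \<in> \<Lambda>"
  shows "(\<Sum>a\<in>A. G a x * (\<Sum>i<N. moment a i t)) \<le> main_term x t" (is ?A)
    and "main_term x t \<le> (\<Sum>a\<in>A. G a x * (\<Sum>i<N. moment a i t)) + K * q ^ N / (1 - q) * scale x t" (is ?B)
proof -
  let ?e = "\<lambda>a i. moment a i t"
  have split: "(\<Sum>i. ?e a i) = (\<Sum>i. ?e a (i + N)) + (\<Sum>i<N. ?e a i)" if "a \<in> A" for a
    using summable_V_alpha[OF that t] by (rule suminf_split_initial_segment)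
  have "0 \<le> (\<Sum>i. ?e a (i + N))" if "a \<in> A" for a
    using summable_V_alpha[OF that t] by (intro suminf_nonneg summable_ignore_initial_segment) auto
  then have "(\<Sum>i<N. ?e a i) \<le> (\<Sum>i. ?e a i)" if "a \<in> A" for a
    using split[OF that] that by fastforce
  then show ?A
    unfolding main_term_def using G_nonneg by (intro sum_mono mult_left_mono) auto
  have "main_term x t \<le> (\<Sum>a\<in>A. G a x * (K * q ^ N / (1 - q) * \<L> a t + (\<Sum>i<N. ?e a i)))"
    unfolding main_term_def
  proof (intro sum_mono mult_left_mono)
    fix a assume a: "a \<in> A"
    show "(\<Sum>i. ?e a i) \<le> K * q ^ N / (1 - q) * \<L> a t + (\<Sum>i<N. ?e a i)"
      using split[OF a] V_alpha_tail_bound[OF a t, of N] by linarith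
  qed (use G_nonneg in auto)
  also have "\<dots> = (\<Sum>a\<in>A. G a x * (\<Sum>i<N. ?e a i)) + K * q ^ N / (1 - q) * scale x t"
    by (simp add: scale_def distrib_left sum.distrib sum_distrib_left ac_simps)
  finally show ?B .
qed

section \<open>Tail of the total of all weighted claims\<close>

definition total :: "'t \<Rightarrow> 'a \<Rightarrow> ennreal" where
  "total t \<omega> = (\<Sum>a\<in>A. \<Sum>i. ennreal (X a i \<omega> * V a i t \<omega>))"

lemma total_measurable:
  assumes "t \<in> \<Lambda>" shows "total t \<in> borel_measurable M"
proof -
  note [measurable] = V_meas_M[OF _ assms]
  show ?thesis unfolding total_def by measurable
qed

lemma total_split:
  "total t \<omega> = (\<Sum>a\<in>A. \<Sum>i. ennreal (X a (i + N) \<omega> * V a (i + N) t \<omega>))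
    + (\<Sum>n\<in>A \<times> {..<N}. ennreal (X (fst n) (snd n) \<omega> * V (fst n) (snd n) t \<omega>))"
proof -
  have "(\<Sum>i. ennreal (X a i \<omega> * V a i t \<omega>)) = (\<Sum>i. ennreal (X a (i + N) \<omega> * V a (i + N) t \<omega>))
      + (\<Sum>i<N. ennreal (X a i \<omega> * V a i t \<omega>))" for a
    by (rule suminf_offset) simp
  then show ?thesis
    by (simp add: total_def sum.distrib sum.cartesian_product')
qed

text \<open>Four errors share \<epsilon>: remote claims, joint exceedances, the one-claim
  approximation, and the lowering of the level from \<open>x\<close> to
  \<open>(1 - 2 * \<delta>) * x\<close>. The last one fixes \<delta>; then \<open>N\<close> is
  chosen for the remote claims, and only finitely many pairs remain.\<close>

lemma total_upper:
  assumes \<epsilon>: "0 < \<epsilon>"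
  shows "\<forall>\<^sub>F x in at_top. \<forall>t\<in>\<Lambda>. \<P>(\<omega> in M. total t \<omega> > ennreal x) \<le> main_term x t + \<epsilon> * scale x t"
proof -
  \<comment> \<open>Lowering the level by the factor \<open>1 - 2 * \<delta>\<close> multiplies the
    main term by a power that tends to \<open>1\<close>; \<open>K / (1 - q)\<close> is the constant
    of \<open>main_term_le\<close>.\<close>
  have "((\<lambda>\<delta>::real. ((1 - 2 * \<delta>) powr (- \<alpha>) - 1) * (K / (1 - q))) \<longlongrightarrow> ((1 - 2 * 0) powr (- \<alpha>) - 1) * (K / (1 - q))) (at_right 0)"
    by (intro tendsto_intros) auto
  then have "\<forall>\<^sub>F \<delta> in at_right 0. ((1 - 2 * \<delta>) powr (- \<alpha>) - 1) * (K / (1 - q)) < \<epsilon> / 4"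
    using \<epsilon> by (intro order_tendstoD(2)) auto
  moreover have "\<forall>\<^sub>F \<delta> in at_right (0::real). 0 < \<delta> \<and> \<delta> < 1 / 4"
    by (auto simp: eventually_at_right_field intro!: exI[of _ "1 / 4"])
  ultimately have "\<forall>\<^sub>F \<delta> in at_right (0::real). ((1 - 2 * \<delta>) powr (- \<alpha>) - 1) * (K / (1 - q)) < \<epsilon> / 4 \<and> 0 < \<delta> \<and> \<delta> < 1 / 4"
    by eventually_elim simp
  then obtain \<delta> where \<delta>: "((1 - 2 * \<delta>) powr (- \<alpha>) - 1) * (K / (1 - q)) < \<epsilon> / 4" "0 < \<delta>" "\<delta> < 1 / 4"
    using eventually_happens'[OF trivial_limit_at_right_real] by blast
  have \<epsilon>4: "0 < \<epsilon> / 4" using \<epsilon> by simp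
  define c where "c = 1 - 2 * \<delta>"
  have c: "0 < c" "c \<le> 1" using \<delta> by (auto simp: c_def)
  obtain N where tail: "\<forall>\<^sub>F x in at_top. \<forall>t\<in>\<Lambda>.
    \<P>(\<omega> in M. (\<Sum>a\<in>A. \<Sum>i. ennreal (X a (i + N) \<omega> * V a (i + N) t \<omega>)) > ennreal (\<delta> * x)) \<le> \<epsilon> / 4 * scale x t"
    using tail_claims[OF \<delta>(2) _ \<epsilon>4] \<delta>(3) by auto
  define I where "I = A \<times> {..<N}"
  have I: "finite I" "I \<subseteq> A \<times> UNIV" using finite_A by (auto simp: I_def)
  define m where "m = real (card I) + 1"
  have m: "real (card I) \<le> m" "1 \<le> m" by (auto simp: m_def)
  have \<eta>: "0 < \<delta> / m" "\<delta> / m \<le> 1" using \<delta> m by (auto simp: field_simps)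
  show ?thesis
    using tail joint_claims_finite[OF I \<eta> \<epsilon>4] sum_single_claims[OF c(1) \<epsilon>4] eventually_gt_at_top[of 0]
  proof eventually_elim
    case (elim x)
    show ?case
    proof
      fix t assume t: "t \<in> \<Lambda>"
      define Y where "Y n \<omega> = X (fst n) (snd n) \<omega> * V (fst n) (snd n) t \<omega>" for n \<omega>
      define T where "T = {\<omega> \<in> space M. (\<Sum>a\<in>A. \<Sum>i. ennreal (X a (i + N) \<omega> * V a (i + N) t \<omega>)) > ennreal (\<delta> * x)}"
      define B where "B n = {\<omega> \<in> space M. Y n \<omega> > c * x}" for n
      define C where "C n = {\<omega> \<in> space M. Y n \<omega> > \<delta> / m * x}" for n
      have B: "B n \<in> events" and C: "C n \<in> events" if "n \<in> I" for n
        using that I ev_gt[of "fst n" t] t by (auto simp: B_def C_def Y_def)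
      have T: "T \<in> events"
      proof -
        note [measurable] = V_meas_M[OF _ t]
        show ?thesis unfolding T_def by measurable
      qed
      define J where "J = (\<Union>n\<in>I. \<Union>n'\<in>I - {n}. C n \<inter> C n')"
      have J: "J \<in> events" unfolding J_def using C I by (intro sets.finite_UN sets.Int) auto
      have UB: "(\<Union>n\<in>I. B n) \<in> events" using B I by (intro sets.finite_UN) auto
      have "{\<omega> \<in> space M. total t \<omega> > ennreal x} \<subseteq> T \<union> (\<Union>n\<in>I. B n) \<union> J"
      proof
        fix \<omega> assume "\<omega> \<in> {\<omega> \<in> space M. total t \<omega> > ennreal x}"
        then have w: "\<omega> \<in> space M" and gt: "total t \<omega> > ennreal x" by auto
        have Y0: "0 \<le> Y n \<omega>" if "n \<in> I" for n
          unfolding Y_def using that I w t by (intro mult_nonneg_nonneg X_nonneg V_nonneg) auto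
        show "\<omega> \<in> T \<union> (\<Union>n\<in>I. B n) \<union> J"
        proof (cases "\<omega> \<in> T")
          case False
          have "(\<Sum>n\<in>I. Y n \<omega>) > (1 - \<delta>) * x"
          proof (rule ccontr)
            assume neg: "\<not> (\<Sum>n\<in>I. Y n \<omega>) > (1 - \<delta>) * x"
            have "total t \<omega> \<le> ennreal (\<delta> * x) + (\<Sum>n\<in>I. ennreal (Y n \<omega>))"
              unfolding total_split[of t \<omega> N] Y_def I_def using False w
              by (intro add_mono) (auto simp: T_def not_less)
            also have "(\<Sum>n\<in>I. ennreal (Y n \<omega>)) = ennreal (\<Sum>n\<in>I. Y n \<omega>)"
              using Y0 by (rule sum_ennreal)
            also have "\<dots> \<le> ennreal ((1 - \<delta>) * x)"
              using neg by (intro ennreal_leI) auto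
            also have "ennreal (\<delta> * x) + ennreal ((1 - \<delta>) * x) = ennreal x"
              using \<delta> elim(4) by (subst ennreal_plus[symmetric]) (auto simp: algebra_simps)
            finally show False using gt by (simp add: add_left_mono)
          qed
          then have "(\<exists>n\<in>I. Y n \<omega> > (1 - 2 * \<delta>) * x) \<or>
            (\<exists>n\<in>I. \<exists>n'\<in>I - {n}. Y n \<omega> > \<delta> / m * x \<and> Y n' \<omega> > \<delta> / m * x)"
            using \<delta> m elim(4) Y0 I by (intro sum_gt_cases) auto
          then show ?thesis
            using w unfolding B_def C_def J_def c_def by blast
        qed simp
      qed
      then have "\<P>(\<omega> in M. total t \<omega> > ennreal x) \<le> prob (T \<union> (\<Union>n\<in>I. B n) \<union> J)"
        using T UB J by (intro finite_measure_mono) auto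
      also have "\<dots> \<le> prob T + prob (\<Union>n\<in>I. B n) + prob J"
        using T UB J measure_Un_le[of "T \<union> (\<Union>n\<in>I. B n)" M J] measure_Un_le[of T M "\<Union>n\<in>I. B n"] by simp
      also have "prob T \<le> \<epsilon> / 4 * scale x t"
        unfolding T_def using elim(1) t by blast
      also have "prob J \<le> \<epsilon> / 4 * scale x t"
      proof -
        have "prob J \<le> (\<Sum>n\<in>I. prob (\<Union>n'\<in>I - {n}. C n \<inter> C n'))"
          unfolding J_def using C I by (intro finite_measure_subadditive_finite) (auto intro!: sets.finite_UN sets.Int)
        also have "\<dots> \<le> (\<Sum>n\<in>I. \<Sum>n'\<in>I - {n}. prob (C n \<inter> C n'))"
          using C I by (intro sum_mono finite_measure_subadditive_finite) auto
        also have "\<dots> \<le> \<epsilon> / 4 * scale x t"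
          using elim(2) t \<epsilon> by (simp add: C_def Y_def)
        finally show ?thesis .
      qed
      also have "prob (\<Union>n\<in>I. B n) \<le> main_term x t + \<epsilon> / 4 * scale x t + \<epsilon> / 4 * scale x t"
      proof -
        have "prob (\<Union>n\<in>I. B n) \<le> (\<Sum>n\<in>I. prob (B n))"
          using B I by (intro finite_measure_subadditive_finite) auto
        also have "\<dots> \<le> c powr (- \<alpha>) * (\<Sum>a\<in>A. G a x * (\<Sum>i<N. moment a i t)) + \<epsilon> / 4 * scale x t"
        proof -
          have "\<bar>(\<Sum>n\<in>I. prob (B n)) - c powr (- \<alpha>) * (\<Sum>a\<in>A. G a x * (\<Sum>i<N. moment a i t))\<bar> \<le> \<epsilon> / 4 * scale x t"
            using elim(3) t \<epsilon> unfolding B_def Y_def I_def by simp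
          then show ?thesis by linarith
        qed
        also have "c powr (- \<alpha>) * (\<Sum>a\<in>A. G a x * (\<Sum>i<N. moment a i t)) \<le> c powr (- \<alpha>) * main_term x t"
          using main_term_split(1)[OF t] by (intro mult_left_mono) auto
        also have "\<dots> = main_term x t + (c powr (- \<alpha>) - 1) * main_term x t"
          by (simp add: algebra_simps)
        also have "(c powr (- \<alpha>) - 1) * main_term x t \<le> (c powr (- \<alpha>) - 1) * (K / (1 - q) * scale x t)"
        proof (intro mult_left_mono main_term_le t)
          have "c powr 0 \<le> c powr (- \<alpha>)" using c exps by (intro powr_mono') auto
          then show "0 \<le> c powr (- \<alpha>) - 1" using c by simp
        qed
        also have "\<dots> = ((c powr (- \<alpha>) - 1) * (K / (1 - q))) * scale x t" by simp
        also have "\<dots> \<le> \<epsilon> / 4 * scale x t"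
          using \<delta>(1) scale_nonneg[OF t] unfolding c_def by (intro mult_right_mono) auto
        finally show ?thesis by simp
      qed
      finally show "\<P>(\<omega> in M. total t \<omega> > ennreal x) \<le> main_term x t + \<epsilon> * scale x t" by simp
    qed
  qed
qed

text \<open>Bonferroni for the first \<open>N\<close> claims of every type, the rest of the moment
  series being small. The bound concerns a union of one-claim events at level \<open>c * x\<close>,
  not \<open>total\<close>, because the net loss needs a single large claim that leaves room
  \<open>(c - 1) * x\<close> for the premium.\<close>

lemma union_lower:
  assumes c: "1 \<le> c" and \<epsilon>: "0 < \<epsilon>"
  obtains N where "\<forall>\<^sub>F x in at_top. \<forall>t\<in>\<Lambda>. c powr (- \<alpha>) * main_term x t - \<epsilon> * scale x t
    \<le> prob (\<Union>n\<in>A \<times> {..<N}. (exceed (fst n) (snd n) t (c * x)))"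
proof -
  have "(\<lambda>N. K * q ^ N / (1 - q)) \<longlonglongrightarrow> K * 0 / (1 - q)"
    using q by (intro tendsto_intros LIMSEQ_realpow_zero) auto
  then have "\<forall>\<^sub>F N in sequentially. K * q ^ N / (1 - q) < \<epsilon> / 4"
    using \<epsilon> by (intro order_tendstoD) auto
  then obtain N where N: "K * q ^ N / (1 - q) < \<epsilon> / 4"
    by (auto simp: eventually_sequentially)
  define I where "I = A \<times> {..<N}"
  have I: "finite I" "I \<subseteq> A \<times> UNIV" using finite_A by (auto simp: I_def)
  have c0: "0 < c" and \<epsilon>4: "0 < \<epsilon> / 4" using c \<epsilon> by auto
  have "\<forall>\<^sub>F x in at_top. \<forall>t\<in>\<Lambda>. c powr (- \<alpha>) * main_term x t - \<epsilon> * scale x t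
    \<le> prob (\<Union>n\<in>A \<times> {..<N}. (exceed (fst n) (snd n) t (c * x)))"
    using joint_claims_finite[OF I zero_less_one order_refl \<epsilon>4] sum_single_claims[OF c0 \<epsilon>4] eventually_gt_at_top[of 0]
  proof eventually_elim
    case (elim x)
    show ?case
    proof
      fix t assume t: "t \<in> \<Lambda>"
      define B where "B n = (exceed (fst n) (snd n) t (c * x))" for n
      \<comment> \<open>Pairs are estimated at the lower level \<open>x\<close>, because
        \<open>joint_claims_finite\<close> takes a factor of at most \<open>1\<close>; enlarging the
        events only increases the correction.\<close>
      define C where "C n = (exceed (fst n) (snd n) t (1 * x))" for n
      have B: "B n \<in> events" and C: "C n \<in> events" if "n \<in> I" for n
        using that I ev_gt[of "fst n" t] t unfolding B_def C_def by auto
      have "1 * x \<le> c * x" using c elim(3) by (intro mult_right_mono) auto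
      then have BC: "B n \<subseteq> C n" for n by (auto simp: B_def C_def)
      have pr: "(\<Sum>n\<in>I. \<Sum>m\<in>I - {n}. prob (B n \<inter> B m)) \<le> \<epsilon> / 4 * scale x t"
      proof -
        have "(\<Sum>n\<in>I. \<Sum>m\<in>I - {n}. prob (B n \<inter> B m)) \<le> (\<Sum>n\<in>I. \<Sum>m\<in>I - {n}. prob (C n \<inter> C m))"
          using BC C by (intro sum_mono finite_measure_mono) auto
        also have "\<dots> \<le> \<epsilon> / 4 * scale x t"
          unfolding C_def using elim(1) t by blast
        finally show ?thesis .
      qed
      have sg: "\<bar>(\<Sum>n\<in>I. prob (B n)) - c powr (- \<alpha>) * (\<Sum>a\<in>A. G a x * (\<Sum>i<N. moment a i t))\<bar> \<le> \<epsilon> / 4 * scale x t"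
        using elim(2) t unfolding B_def I_def by blast
      have cp: "0 \<le> c powr (- \<alpha>)" "c powr (- \<alpha>) \<le> 1"
      proof -
        have "c powr (- \<alpha>) \<le> c powr 0" using c exps by (intro powr_mono) auto
        then show "c powr (- \<alpha>) \<le> 1" using c by simp
      qed simp
      have sc: "0 \<le> scale x t" using t by (rule scale_nonneg)
      have "c powr (- \<alpha>) * main_term x t \<le> c powr (- \<alpha>) *
          ((\<Sum>a\<in>A. G a x * (\<Sum>i<N. moment a i t)) + K * q ^ N / (1 - q) * scale x t)"
        using main_term_split(2)[OF t] cp by (intro mult_left_mono) auto
      also have "\<dots> = c powr (- \<alpha>) * (\<Sum>a\<in>A. G a x * (\<Sum>i<N. moment a i t))
          + c powr (- \<alpha>) * (K * q ^ N / (1 - q) * scale x t)"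
        by (simp add: distrib_left)
      also have "c powr (- \<alpha>) * (K * q ^ N / (1 - q) * scale x t) \<le> 1 * (\<epsilon> / 4 * scale x t)"
        using N cp sc \<epsilon> K q by (intro mult_mono mult_right_mono mult_nonneg_nonneg divide_nonneg_pos) auto
      finally have "c powr (- \<alpha>) * main_term x t \<le>
        c powr (- \<alpha>) * (\<Sum>a\<in>A. G a x * (\<Sum>i<N. moment a i t)) + \<epsilon> / 4 * scale x t"
        by simp
      moreover have "(\<Sum>n\<in>I. prob (B n)) - (\<Sum>n\<in>I. \<Sum>m\<in>I - {n}. prob (B n \<inter> B m)) \<le> prob (\<Union>n\<in>I. B n)"
        using I(1) B by (rule bonferroni_lower)
      moreover have "0 \<le> \<epsilon> / 4 * scale x t" using sc \<epsilon> by simp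
      ultimately have "c powr (- \<alpha>) * main_term x t - 4 * (\<epsilon> / 4 * scale x t) \<le> prob (\<Union>n\<in>I. B n)"
        using pr sg by linarith
      then show "c powr (- \<alpha>) * main_term x t - \<epsilon> * scale x t
        \<le> prob (\<Union>n\<in>A \<times> {..<N}. (exceed (fst n) (snd n) t (c * x)))"
        by (simp add: B_def I_def)
    qed
  qed
  then show thesis by (rule that)
qed

lemma claim_le_total: "a \<in> A \<Longrightarrow> ennreal (X a i \<omega> * V a i t \<omega>) \<le> total t \<omega>"
proof -
  assume a: "a \<in> A"
  have "ennreal (X a i \<omega> * V a i t \<omega>) = (\<Sum>j\<in>{i}. ennreal (X a j \<omega> * V a j t \<omega>))" by simp
  also have "\<dots> \<le> (\<Sum>j. ennreal (X a j \<omega> * V a j t \<omega>))"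
    by (rule sum_le_suminf) auto
  also have "\<dots> \<le> total t \<omega>"
    unfolding total_def using finite_A a
    by (intro member_le_sum[of a A "\<lambda>a. \<Sum>j. ennreal (X a j \<omega> * V a j t \<omega>)"]) auto
  finally show ?thesis .
qed

text \<open>A single claim above \<open>x\<close> already lifts the total above \<open>x\<close>, so
  the lower bound needs no shift of level and \<open>union_lower\<close> is used with
  \<open>c = 1\<close>.\<close>

lemma total_asymp:
  assumes \<epsilon>: "0 < \<epsilon>"
  shows "\<forall>\<^sub>F x in at_top. \<forall>t\<in>\<Lambda>. \<bar>\<P>(\<omega> in M. total t \<omega> > ennreal x) - main_term x t\<bar> \<le> \<epsilon> * scale x t"
proof -
  obtain N where N: "\<forall>\<^sub>F x in at_top. \<forall>t\<in>\<Lambda>. 1 powr (- \<alpha>) * main_term x t - \<epsilon> * scale x t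
    \<le> prob (\<Union>n\<in>A \<times> {..<N}. (exceed (fst n) (snd n) t (1 * x)))"
    using union_lower[OF order_refl \<epsilon>] by blast
  show ?thesis
    using total_upper[OF \<epsilon>] N eventually_gt_at_top[of 0]
  proof eventually_elim
    case (elim x)
    show ?case
    proof
      fix t assume t: "t \<in> \<Lambda>"
      note [measurable] = total_measurable[OF t]
      have "1 powr (- \<alpha>) * main_term x t - \<epsilon> * scale x t
        \<le> prob (\<Union>n\<in>A \<times> {..<N}. (exceed (fst n) (snd n) t (1 * x)))"
        using elim(2) t by blast
      also have "\<dots> \<le> \<P>(\<omega> in M. total t \<omega> > ennreal x)"
      proof (rule finite_measure_mono)
        show "(\<Union>n\<in>A \<times> {..<N}. (exceed (fst n) (snd n) t (1 * x)))
          \<subseteq> {\<omega> \<in> space M. total t \<omega> > ennreal x}"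
        proof clarsimp
          fix a i \<omega> assume "a \<in> A" and gt: "x < X a i \<omega> * V a i t \<omega>"
          then have "ennreal x < ennreal (X a i \<omega> * V a i t \<omega>)" using elim(3) by (intro ennreal_lessI) auto
          also have "\<dots> \<le> total t \<omega>" using \<open>a \<in> A\<close> by (rule claim_le_total)
          finally show "ennreal x < total t \<omega>" .
        qed
        show "{\<omega> \<in> space M. total t \<omega> > ennreal x} \<in> events" by measurable
      qed
      finally have "main_term x t - \<epsilon> * scale x t \<le> \<P>(\<omega> in M. total t \<omega> > ennreal x)" by simp
      moreover have "\<P>(\<omega> in M. total t \<omega> > ennreal x) \<le> main_term x t + \<epsilon> * scale x t"
        using elim(1) t by blast
      ultimately show "\<bar>\<P>(\<omega> in M. total t \<omega> > ennreal x) - main_term x t\<bar> \<le> \<epsilon> * scale x t"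
        by linarith
    qed
  qed
qed

text \<open>Here \<open>D t x\<close> stands for the event that the net loss exceeds
  \<open>x\<close>, \<open>J\<close> for a bound on all premiums, and \<open>U\<close> for weights
  without time horizon. The upper bound ignores premiums. For the lower one, a claim above
  \<open>(1 + \<delta>) * x\<close> suffices unless \<open>J\<close> exceeds
  \<open>\<delta> * x\<close>. That exception is only small in absolute terms, uniformly in
  \<open>t\<close>; the lower bound \<open>l\<close> on \<open>\<L>\<close> turns it into an error
  relative to \<open>scale\<close>.\<close>

lemma net_asymp:
  fixes J :: "'a \<Rightarrow> ennreal" and U :: "'b \<Rightarrow> nat \<Rightarrow> 'a \<Rightarrow> real"
  assumes sub': "\<Lambda>' \<subseteq> \<Lambda>"
    and L0: "0 < l" "\<And>a t. a \<in> A \<Longrightarrow> t \<in> \<Lambda>' \<Longrightarrow> l \<le> \<L> a t"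
    and U: "\<And>a i. a \<in> A \<Longrightarrow> U a i \<in> borel_measurable \<G>"
      "\<And>a i. a \<in> A \<Longrightarrow> integrable M (\<lambda>\<omega>. U a i \<omega> powr \<alpha>\<^sub>1)"
      "\<And>a i. a \<in> A \<Longrightarrow> integrable M (\<lambda>\<omega>. U a i \<omega> powr \<alpha>')"
      "\<And>a i t \<omega>. a \<in> A \<Longrightarrow> \<omega> \<in> space M \<Longrightarrow> 0 \<le> U a i \<omega>"
      "\<And>a i t \<omega>. a \<in> A \<Longrightarrow> t \<in> \<Lambda>' \<Longrightarrow> \<omega> \<in> space M \<Longrightarrow> V a i t \<omega> \<le> U a i \<omega>"
    and J: "J \<in> borel_measurable \<G>" "AE \<omega> in M. J \<omega> < \<infinity>"
    and D: "\<And>t x. t \<in> \<Lambda>' \<Longrightarrow> D t x \<in> events"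
      "\<And>t x. t \<in> \<Lambda>' \<Longrightarrow> 0 < x \<Longrightarrow> D t x \<subseteq> {\<omega> \<in> space M. total t \<omega> > ennreal x}"
      "\<And>t x y a i \<omega>. t \<in> \<Lambda>' \<Longrightarrow> 0 < x \<Longrightarrow> 0 < y \<Longrightarrow> \<omega> \<in> space M \<Longrightarrow> a \<in> A \<Longrightarrow>
        X a i \<omega> * V a i t \<omega> > x + y \<Longrightarrow> J \<omega> \<le> ennreal y \<Longrightarrow> \<omega> \<in> D t x"
    and \<epsilon>: "0 < \<epsilon>"
  shows "\<forall>\<^sub>F x in at_top. \<forall>t\<in>\<Lambda>'. \<bar>prob (D t x) - main_term x t\<bar> \<le> \<epsilon> * scale x t"
proof -
  have "((\<lambda>\<delta>::real. (1 - (1 + \<delta>) powr (- \<alpha>)) * (K / (1 - q))) \<longlongrightarrow> (1 - (1 + 0) powr (- \<alpha>)) * (K / (1 - q))) (at_right 0)"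
    by (intro tendsto_intros) auto
  then have "\<forall>\<^sub>F \<delta> in at_right 0. (1 - (1 + \<delta>) powr (- \<alpha>)) * (K / (1 - q)) < \<epsilon> / 4"
    using \<epsilon> by (intro order_tendstoD(2)) auto
  moreover have "\<forall>\<^sub>F \<delta> in at_right (0::real). 0 < \<delta>"
    by (rule eventually_at_right_less)
  ultimately have "\<forall>\<^sub>F \<delta> in at_right (0::real). (1 - (1 + \<delta>) powr (- \<alpha>)) * (K / (1 - q)) < \<epsilon> / 4 \<and> 0 < \<delta>"
    by eventually_elim simp
  then obtain \<delta> where \<delta>: "(1 - (1 + \<delta>) powr (- \<alpha>)) * (K / (1 - q)) < \<epsilon> / 4" "0 < \<delta>"
    using eventually_happens'[OF trivial_limit_at_right_real] by blast
  define c where "c = 1 + \<delta>"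
  have c: "1 \<le> c" using \<delta> by (simp add: c_def)
  have \<epsilon>4: "0 < \<epsilon> / 4" using \<epsilon> by simp
  obtain N where lower: "\<forall>\<^sub>F x in at_top. \<forall>t\<in>\<Lambda>. c powr (- \<alpha>) * main_term x t - \<epsilon> / 4 * scale x t
    \<le> prob (\<Union>n\<in>A \<times> {..<N}. (exceed (fst n) (snd n) t (c * x)))"
    using union_lower[OF c \<epsilon>4] by blast
  \<comment> \<open>The bad event \<open>J > \<delta> * x\<close> is absorbed into the weight, which
    stays independent of the claims however \<open>J\<close> and \<open>V\<close> are related. As
    \<open>J\<close> is almost surely finite, \<open>W\<close> is eventually \<open>0\<close>, and
    its two moments vanish by dominated convergence.\<close>
  define W where "W x a i \<omega> = (if J \<omega> > ennreal (\<delta> * x) then U a i \<omega> else 0)" for x a i \<omega>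
  have W: "W x a i \<in> borel_measurable \<G>" if "a \<in> A" for x a i
    unfolding W_def using U(1)[OF that, of i] J(1) by measurable
  have Wint: "integrable M (\<lambda>\<omega>. W x a i \<omega> powr p)" if "integrable M (\<lambda>\<omega>. U a i \<omega> powr p)" "a \<in> A" for x a i p
  proof (rule Bochner_Integration.integrable_bound[OF that(1)])
    note [measurable] = measurable_sub[OF W[OF that(2)]]
    show "(\<lambda>\<omega>. W x a i \<omega> powr p) \<in> borel_measurable M" by measurable
    show "AE \<omega> in M. norm (W x a i \<omega> powr p) \<le> norm (U a i \<omega> powr p)"
      by (rule AE_I2) (simp add: W_def)
  qed
  have Wlim: "((\<lambda>x. two_moments \<alpha>' (W x a i)) \<longlongrightarrow> 0) at_top" if a: "a \<in> A" for a i
  proof -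
    note [measurable] = measurable_sub[OF W[OF a]]
    have "((\<lambda>x. two_moments \<alpha>' (W x a i)) \<longlongrightarrow> expectation (\<lambda>_. 0)) at_top"
    proof (rule integral_dominated_convergence_at_top)
      show "integrable M (\<lambda>\<omega>. U a i \<omega> powr \<alpha>\<^sub>1 + U a i \<omega> powr \<alpha>')"
        using U(2,3)[OF a] by (rule Bochner_Integration.integrable_add)
      show "\<forall>\<^sub>F x in at_top. AE \<omega> in M. norm (W x a i \<omega> powr \<alpha>\<^sub>1 + W x a i \<omega> powr \<alpha>') \<le> U a i \<omega> powr \<alpha>\<^sub>1 + U a i \<omega> powr \<alpha>'"
        by (intro always_eventually allI AE_I2) (simp add: W_def)
      show "AE \<omega> in M. ((\<lambda>x. W x a i \<omega> powr \<alpha>\<^sub>1 + W x a i \<omega> powr \<alpha>') \<longlongrightarrow> 0) at_top"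
        using J(2)
      proof eventually_elim
        case (elim \<omega>)
        define j where "j = enn2real (J \<omega>)"
        have j: "J \<omega> = ennreal j" using elim by (simp add: j_def)
        have "\<forall>\<^sub>F x in at_top. W x a i \<omega> powr \<alpha>\<^sub>1 + W x a i \<omega> powr \<alpha>' = 0"
          using eventually_ge_at_top[of "j / \<delta>"]
        proof eventually_elim
          case (elim x)
          then have "J \<omega> \<le> ennreal (\<delta> * x)" using \<delta> unfolding j by (intro ennreal_leI) (simp add: field_simps)
          then show ?case by (simp add: W_def not_less[symmetric])
        qed
        then show ?case by (rule tendsto_eventually)
      qed
    qed measurable
    then show ?thesis by simp
  qed
  \<comment> \<open>Compensates the factor \<open>2\<close> of \<open>eventually_product_le\<close>,
    the \<open>N\<close> claims of each type and the division by \<open>l\<close>, leaving at most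
    \<open>\<epsilon> / 4\<close>.\<close>
  define \<epsilon>' where "\<epsilon>' = \<epsilon> / 4 * l / (2 * real N + 1)"
  have \<epsilon>': "0 < \<epsilon>'" using \<epsilon> L0 by (simp add: \<epsilon>'_def)
  have small: "\<forall>\<^sub>F x in at_top. \<forall>n\<in>A \<times> {..<N}. two_moments \<alpha>' (W x (fst n) (snd n)) < \<epsilon>'"
    using \<epsilon>' finite_A by (intro eventually_ball_finite ballI order_tendstoD(2)[OF Wlim]) auto
  show ?thesis
    using total_upper[OF \<epsilon>] lower small eventually_product_le[OF exps(3)] eventually_gt_at_top[of 0]
  proof eventually_elim
    case (elim x)
    show ?case
    proof
      fix t assume t': "t \<in> \<Lambda>'"
      then have t: "t \<in> \<Lambda>" using sub' by auto
      have sc: "0 \<le> scale x t" using t by (rule scale_nonneg)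
      note [measurable] = total_measurable[OF t]
      have "prob (D t x) \<le> \<P>(\<omega> in M. total t \<omega> > ennreal x)"
        using D(2)[OF t' elim(5)] by (intro finite_measure_mono) auto
      also have "\<dots> \<le> main_term x t + \<epsilon> * scale x t"
        using elim(1) t by blast
      finally have up: "prob (D t x) \<le> main_term x t + \<epsilon> * scale x t" .
      define B where "B n = (exceed (fst n) (snd n) t (c * x))" for n
      define H where "H n = {\<omega> \<in> space M. X (fst n) (snd n) \<omega> * W x (fst n) (snd n) \<omega> > x}" for n
      have B: "B n \<in> events" if "n \<in> A \<times> {..<N}" for n
        unfolding B_def using that t by (intro ev_gt) auto
      have H: "H n \<in> events" if "n \<in> A \<times> {..<N}" for n
      proof -
        have a: "fst n \<in> A" using that by auto
        note [measurable] = X_meas[OF a] measurable_sub[OF W[OF a]]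
        show ?thesis unfolding H_def by measurable
      qed
      have "(\<Union>n\<in>A \<times> {..<N}. B n) \<subseteq> D t x \<union> (\<Union>n\<in>A \<times> {..<N}. H n)"
      proof
        fix \<omega> assume "\<omega> \<in> (\<Union>n\<in>A \<times> {..<N}. B n)"
        then obtain a i where ai: "a \<in> A" "i < N" and w: "\<omega> \<in> space M" and gt: "X a i \<omega> * V a i t \<omega> > c * x"
          by (auto simp: B_def)
        show "\<omega> \<in> D t x \<union> (\<Union>n\<in>A \<times> {..<N}. H n)"
        proof (cases "J \<omega> \<le> ennreal (\<delta> * x)")
          case True
          have "\<omega> \<in> D t x"
            using t' elim(5) \<delta> w ai gt True by (intro D(3)[of t x "\<delta> * x" \<omega> a i]) (auto simp: c_def algebra_simps)
          then show ?thesis by simp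
        next
          case False
          have "x \<le> c * x" using c elim(5) by simp
          also have "\<dots> < X a i \<omega> * V a i t \<omega>" by (rule gt)
          also have "\<dots> \<le> X a i \<omega> * W x a i \<omega>"
            using False U(5)[OF ai(1) t' w] X_nonneg[OF ai(1) w] by (auto simp: W_def intro: mult_left_mono)
          finally show ?thesis using w ai by (force simp: H_def)
        qed
      qed
      then have "prob (\<Union>n\<in>A \<times> {..<N}. B n) \<le> prob (D t x \<union> (\<Union>n\<in>A \<times> {..<N}. H n))"
        using D(1)[OF t'] H finite_A by (intro finite_measure_mono sets.Un sets.finite_UN) auto
      also have "\<dots> \<le> prob (D t x) + prob (\<Union>n\<in>A \<times> {..<N}. H n)"
        using D(1)[OF t'] H finite_A by (intro measure_Un_le sets.finite_UN) auto
      also have "prob (\<Union>n\<in>A \<times> {..<N}. H n) \<le> (\<Sum>n\<in>A \<times> {..<N}. prob (H n))"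
        using H finite_A by (intro finite_measure_subadditive_finite) auto
      also have "\<dots> \<le> (\<Sum>n\<in>A \<times> {..<N}. 2 * \<epsilon>' / l * (G (fst n) x * \<L> (fst n) t))"
      proof (rule sum_mono)
        fix n assume n: "n \<in> A \<times> {..<N}"
        then have a: "fst n \<in> A" by auto
        have "\<forall>\<omega>\<in>space M. 0 \<le> W x (fst n) (snd n) \<omega>" using U(4)[OF a] by (auto simp: W_def)
        then have "prob (H n) \<le> 2 * G (fst n) x * two_moments \<alpha>' (W x (fst n) (snd n))"
          unfolding H_def using elim(4) a W[OF a] Wint[OF U(2)[OF a] a] Wint[OF U(3)[OF a] a] by blast
        also have "\<dots> \<le> 2 * G (fst n) x * \<epsilon>'"
          using elim(3) n G_nonneg[OF a] by (intro mult_left_mono) (auto simp: less_imp_le)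
        also have "\<dots> = 2 * \<epsilon>' / l * (G (fst n) x * l)" using L0 by simp
        also have "\<dots> \<le> 2 * \<epsilon>' / l * (G (fst n) x * \<L> (fst n) t)"
          using L0(2)[OF a t'] G_nonneg[OF a] \<epsilon>' L0(1) by (intro mult_left_mono) auto
        finally show "prob (H n) \<le> 2 * \<epsilon>' / l * (G (fst n) x * \<L> (fst n) t)" .
      qed
      also have "\<dots> = (2 * real N * \<epsilon>' / l) * scale x t"
        by (simp add: sum.cartesian_product' scale_def sum_distrib_left sum_divide_distrib ac_simps)
      also have "\<dots> \<le> \<epsilon> / 4 * scale x t"
      proof (rule mult_right_mono[OF _ sc])
        have "2 * real N + 1 \<noteq> 0" by linarith
        then have "\<epsilon>' * (2 * real N + 1) = \<epsilon> / 4 * l" unfolding \<epsilon>'_def by (rule nonzero_divide_eq_eq[THEN iffD1, OF _ refl, symmetric])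
        then have "2 * real N * \<epsilon>' \<le> \<epsilon> / 4 * l" using \<epsilon>' by (simp add: algebra_simps)
        then show "2 * real N * \<epsilon>' / l \<le> \<epsilon> / 4" using L0(1) by (simp add: pos_divide_le_eq)
      qed
      finally have "prob (\<Union>n\<in>A \<times> {..<N}. B n) \<le> prob (D t x) + \<epsilon> / 4 * scale x t" by simp
      moreover have "c powr (- \<alpha>) * main_term x t - \<epsilon> / 4 * scale x t \<le> prob (\<Union>n\<in>A \<times> {..<N}. B n)"
        unfolding B_def using elim(2) t by blast
      moreover have "main_term x t - c powr (- \<alpha>) * main_term x t \<le> \<epsilon> / 4 * scale x t"
      proof -
        have "c powr (- \<alpha>) \<le> c powr 0" using c exps by (intro powr_mono) auto
        then have c1: "0 \<le> 1 - c powr (- \<alpha>)" using c by simp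
        have "main_term x t - c powr (- \<alpha>) * main_term x t = (1 - c powr (- \<alpha>)) * main_term x t"
          by (simp add: algebra_simps)
        also have "\<dots> \<le> (1 - c powr (- \<alpha>)) * (K / (1 - q) * scale x t)"
          using c1 by (intro mult_left_mono main_term_le t)
        also have "\<dots> = ((1 - c powr (- \<alpha>)) * (K / (1 - q))) * scale x t" by simp
        also have "\<dots> \<le> \<epsilon> / 4 * scale x t"
          using \<delta>(1) sc unfolding c_def by (intro mult_right_mono) auto
        finally show ?thesis .
      qed
      moreover have "0 \<le> \<epsilon> / 4 * scale x t" using sc \<epsilon> by simp
      ultimately have "main_term x t - 4 * (\<epsilon> / 4 * scale x t) \<le> prob (D t x)" by linarith
      then show "\<bar>prob (D t x) - main_term x t\<bar> \<le> \<epsilon> * scale x t" using up by simp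
    qed
  qed
qed

text \<open>Summing the lower bounds on the moment series over the types gives
  \<open>\<kappa> * scale \<le> main_term\<close>, with \<open>scale\<close> positive. An error of
  \<open>e / 2 * \<kappa> * scale\<close> is then strictly less than
  \<open>e * main_term\<close>.\<close>

lemma uniformly_asymp_equiv_main_term:
  assumes sub': "\<Lambda>' \<subseteq> \<Lambda>" and \<kappa>: "0 < \<kappa>"
    and pos: "\<And>a t. a \<in> A \<Longrightarrow> t \<in> \<Lambda>' \<Longrightarrow> 0 < \<L> a t"
    and low: "\<And>a t. a \<in> A \<Longrightarrow> t \<in> \<Lambda>' \<Longrightarrow> \<kappa> * \<L> a t \<le> (\<Sum>i. moment a i t)"
    and P: "\<And>\<epsilon>. 0 < \<epsilon> \<Longrightarrow> \<forall>\<^sub>F x in at_top. \<forall>t\<in>\<Lambda>'. \<bar>P x t - main_term x t\<bar> \<le> \<epsilon> * scale x t"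
  shows "uniformly_asymp_equiv \<Lambda>' P main_term"
  unfolding uniformly_asymp_equiv_def uniform_limit_iff
proof (intro allI impI)
  fix e :: real assume e: "0 < e"
  have "0 < e / 2 * \<kappa>" using e \<kappa> by simp
  from P[OF this] show "\<forall>\<^sub>F x in at_top. \<forall>t\<in>\<Lambda>'. dist (P x t / main_term x t) 1 < e"
  proof eventually_elim
    case (elim x)
    show ?case
    proof
      fix t assume t: "t \<in> \<Lambda>'"
      have "\<kappa> * scale x t \<le> main_term x t"
        unfolding scale_def main_term_def sum_distrib_left
      proof (rule sum_mono)
        fix a assume a: "a \<in> A"
        have "\<kappa> * (G a x * \<L> a t) = G a x * (\<kappa> * \<L> a t)" by simp
        also have "\<dots> \<le> G a x * (\<Sum>i. moment a i t)"
          using low[OF a t] G_nonneg[OF a] by (rule mult_left_mono)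
        finally show "\<kappa> * (G a x * \<L> a t) \<le> G a x * (\<Sum>i. moment a i t)" .
      qed
      moreover have "0 < scale x t"
        unfolding scale_def using finite_A A_nonempty G_pos pos[OF _ t] by (intro sum_pos mult_pos_pos) auto
      ultimately have m: "0 < main_term x t" using \<kappa> by (meson less_le_trans mult_pos_pos)
      have "\<bar>P x t - main_term x t\<bar> \<le> e / 2 * \<kappa> * scale x t" using elim t by blast
      also have "\<dots> = e / 2 * (\<kappa> * scale x t)" by simp
      also have "\<dots> \<le> e / 2 * main_term x t"
        using \<open>\<kappa> * scale x t \<le> main_term x t\<close> e by (intro mult_left_mono) auto
      also have "\<dots> < e * main_term x t" using e m by simp
      finally have "\<bar>P x t - main_term x t\<bar> / main_term x t < e" using m by (simp add: divide_less_eq)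
      moreover have "\<bar>P x t / main_term x t - 1\<bar> = \<bar>P x t - main_term x t\<bar> / main_term x t"
      proof -
        have "P x t / main_term x t - 1 = (P x t - main_term x t) / main_term x t"
          using m by (simp add: diff_divide_distrib)
        then show ?thesis using m by simp
      qed
      ultimately show "dist (P x t / main_term x t) 1 < e" by (simp add: dist_real_def)
    qed
  qed
qed

end

section \<open>Exponential moments and path bounds of Levy processes\<close>

text \<open>The \<open>+ 1\<close> makes the grid point lie strictly above \<open>t\<close> even
  when \<open>t\<close> itself is on the grid, as limits from the right require;
  \<open>Suc n\<close> avoids a zero mesh count.\<close>

definition grid_above :: "nat \<Rightarrow> real \<Rightarrow> real" where
  "grid_above n t = (of_int \<lfloor>t * real (Suc n)\<rfloor> + 1) / real (Suc n)"

lemma grid_above_gt: "t < grid_above n t"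
proof -
  have "t * real (Suc n) < of_int \<lfloor>t * real (Suc n)\<rfloor> + 1" by linarith
  then show ?thesis unfolding grid_above_def by (subst pos_less_divide_eq) auto
qed

lemma grid_above_le: "grid_above n t \<le> t + 1 / real (Suc n)"
proof -
  have "of_int \<lfloor>t * real (Suc n)\<rfloor> + 1 \<le> (t + 1 / real (Suc n)) * real (Suc n)"
    by (simp add: distrib_right del: of_nat_Suc)
  then show ?thesis unfolding grid_above_def by (subst pos_divide_le_eq) auto
qed

lemma grid_above_tendsto: "(\<lambda>n. grid_above n t) \<longlonglongrightarrow> t"
proof (rule tendsto_sandwich)
  show "\<forall>\<^sub>F n in sequentially. grid_above n t \<le> t + 1 / real (Suc n)"
    by (intro always_eventually allI grid_above_le)
  show "\<forall>\<^sub>F n in sequentially. t \<le> grid_above n t"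
    by (intro always_eventually allI less_imp_le grid_above_gt)
  show "(\<lambda>n. t + 1 / real (Suc n)) \<longlonglongrightarrow> t"
    using tendsto_add[OF tendsto_const LIMSEQ_Suc[OF lim_1_over_n], of t] by simp
qed simp

lemma right_continuous_LIMSEQ:
  fixes f :: "real \<Rightarrow> 'b :: topological_space"
  assumes f: "continuous (at_right s) f" and X: "X \<longlonglongrightarrow> s" "\<And>n. s < X n"
  shows "(\<lambda>n. f (X n)) \<longlonglongrightarrow> f s"
proof -
  have "filterlim X (at_right s) sequentially"
    using X by (auto simp: filterlim_at intro!: always_eventually)
  moreover have "(f \<longlongrightarrow> f s) (at_right s)"
    using f by (simp add: continuous_within)
  ultimately show ?thesis by (rule filterlim_compose[rotated])
qed

text \<open>Approximating the time from the right by a grid leaves countably many fixed times, at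
  each of which measurability is given; right-continuity passes to the limit. Negative times are
  clamped to \<open>0\<close> because nothing is assumed about the process there.\<close>

lemma borel_measurable_right_continuous_process:
  fixes R :: "real \<Rightarrow> 'a \<Rightarrow> real"
  assumes R: "\<And>s. 0 \<le> s \<Longrightarrow> R s \<in> borel_measurable N"
    and rc: "\<And>s \<omega>. \<omega> \<in> space N \<Longrightarrow> 0 \<le> s \<Longrightarrow> continuous (at_right s) (\<lambda>t. R t \<omega>)"
  shows "(\<lambda>p. R (max 0 (fst p)) (snd p)) \<in> borel_measurable (borel \<Otimes>\<^sub>M N)"
proof (rule borel_measurable_LIMSEQ_real)
  fix n
  have "(\<lambda>p. R (max 0 ((of_int k + 1) / real (Suc n))) (snd p)) \<in> borel_measurable (borel \<Otimes>\<^sub>M N)" for k :: int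
    by (rule measurable_compose[OF measurable_snd R]) simp
  moreover have "(\<lambda>p. \<lfloor>max 0 (fst p) * real (Suc n)\<rfloor>) \<in> measurable (borel \<Otimes>\<^sub>M N) (count_space UNIV)"
    by measurable
  ultimately have "(\<lambda>p. R (max 0 ((of_int \<lfloor>max 0 (fst p) * real (Suc n)\<rfloor> + 1) / real (Suc n))) (snd p)) \<in> borel_measurable (borel \<Otimes>\<^sub>M N)"
    by (rule measurable_compose_countable)
  then show "(\<lambda>p. R (max 0 (grid_above n (max 0 (fst p)))) (snd p)) \<in> borel_measurable (borel \<Otimes>\<^sub>M N)"
    by (simp add: grid_above_def)
next
  fix p :: "real \<times> 'a" assume p: "p \<in> space (borel \<Otimes>\<^sub>M N)"
  let ?s = "max 0 (fst p)"
  have "max 0 (grid_above n ?s) = grid_above n ?s" for n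
    using grid_above_gt[of ?s n] by simp
  moreover have "(\<lambda>n. R (grid_above n ?s) (snd p)) \<longlonglongrightarrow> R ?s (snd p)"
  proof (rule right_continuous_LIMSEQ[where f = "\<lambda>t. R t (snd p)"])
    show "continuous (at_right ?s) (\<lambda>t. R t (snd p))"
      using p by (intro rc) (auto simp: space_pair_measure)
  qed (rule grid_above_tendsto grid_above_gt)+
  ultimately show "(\<lambda>n. R (max 0 (grid_above n ?s)) (snd p)) \<longlonglongrightarrow> R ?s (snd p)"
    by simp
qed

text \<open>Cauchy's functional equation under lower semicontinuity from the right only, which is
  what Fatou's lemma yields for moments. Approximation by rationals from above gives just an upper
  bound; the lower bound comes from the complementary time.\<close>

lemma multiplicative_powr:
  fixes f :: "real \<Rightarrow> real"
  assumes pos: "\<And>t. 0 \<le> t \<Longrightarrow> 0 < f t"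
    and mult: "\<And>s h. 0 \<le> s \<Longrightarrow> 0 \<le> h \<Longrightarrow> f (s + h) = f s * f h"
    and lsc: "\<And>t c X. 0 \<le> t \<Longrightarrow> X \<longlonglongrightarrow> t \<Longrightarrow> (\<And>n. t < X n) \<Longrightarrow> (\<lambda>n. f (X n)) \<longlonglongrightarrow> c \<Longrightarrow> f t \<le> c"
    and t: "0 \<le> t"
  shows "f t = f 1 powr t"
proof -
  have f1: "0 < f 1" by (simp add: pos)
  have f0: "f 0 = 1" using mult[of 0 0] pos[of 0] by simp
  have pow: "f (real n * s) = f s ^ n" if "0 \<le> s" for n s
  proof (induction n)
    case (Suc n)
    have "f (real (Suc n) * s) = f (s + real n * s)" by (simp add: distrib_right)
    also have "\<dots> = f s * f (real n * s)" using that by (intro mult) auto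
    finally show ?case using Suc by simp
  qed (simp add: f0)
  have frac: "f (real m / real (Suc n)) = f 1 powr (real m / real (Suc n))" for m n
  proof -
    let ?x = "real m / real (Suc n)"
    have "f ?x ^ Suc n = f (real (Suc n) * ?x)"
      by (rule pow[symmetric]) simp
    also have "real (Suc n) * ?x = real m * 1"
      by (simp only: mult_1_right) (rule nonzero_mult_div_cancel_left[of "real (Suc n)" "real m", unfolded times_divide_eq_right[symmetric]], simp)
    also have "f (real m * 1) = f 1 ^ m" by (rule pow) simp
    also have "\<dots> = f 1 powr (?x * real (Suc n))"
      using f1 by (simp add: powr_realpow del: of_nat_Suc)
    also have "\<dots> = (f 1 powr ?x) powr real (Suc n)" by (rule powr_powr[symmetric])
    also have "\<dots> = (f 1 powr ?x) ^ Suc n"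
      using f1 by (intro powr_realpow) simp
    finally show ?thesis
      by (rule power_eq_imp_eq_base) (use pos[of ?x] in \<open>simp_all add: less_imp_le\<close>)
  qed
  have upper: "f s \<le> f 1 powr s" if s: "0 \<le> s" for s
  proof (rule lsc[OF s grid_above_tendsto grid_above_gt])
    have "f (grid_above n s) = f 1 powr grid_above n s" for n
    proof -
      have "0 \<le> \<lfloor>s * real (Suc n)\<rfloor>" using s by simp
      then have "grid_above n s = real (nat (\<lfloor>s * real (Suc n)\<rfloor> + 1)) / real (Suc n)"
        by (simp add: grid_above_def del: of_nat_Suc)
      then show ?thesis by (simp only: frac)
    qed
    then show "(\<lambda>n. f (grid_above n s)) \<longlonglongrightarrow> f 1 powr s"
      using f1 grid_above_tendsto[of s] by (auto intro!: tendsto_intros)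
  qed
  \<comment> \<open>Since \<open>f t * f (m - t) = f 1 ^ m\<close>, the upper bound at
    \<open>m - t\<close> is a lower bound at \<open>t\<close>.\<close>
  obtain m :: nat where m: "t \<le> real m" using real_arch_simple by blast
  have "f 1 powr t * f 1 powr (real m - t) = f 1 ^ m"
    using f1 by (simp add: powr_add[symmetric] powr_realpow)
  also have "\<dots> = f (real m * 1)" by (rule pow[symmetric]) simp
  also have "\<dots> = f (t + (real m - t))" by simp
  also have "\<dots> = f t * f (real m - t)" using t m by (intro mult) auto
  also have "\<dots> \<le> f t * f 1 powr (real m - t)"
    using upper[of "real m - t"] m pos[OF t] by (intro mult_left_mono) auto
  finally have "f 1 powr t \<le> f t" using f1 by simp
  with upper[OF t] show ?thesis by simp
qed

context prob_space
begin

text \<open>In the integrable case this is the exponential of the Laplace exponent at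
  \<open>p\<close>, so it is below \<open>1\<close> exactly when the exponent is negative.\<close>

abbreviation laplace :: "(real \<Rightarrow> 'a \<Rightarrow> real) \<Rightarrow> real \<Rightarrow> real" where
  "laplace R p \<equiv> expectation (\<lambda>\<omega>. exp (- p * R 1 \<omega>))"

lemma cadlag_levy_processD:
  assumes "cadlag_levy_process R"
  shows levy_rv: "0 \<le> t \<Longrightarrow> random_variable borel (R t)"
    and levy_zero: "AE \<omega> in M. R 0 \<omega> = 0"
    and levy_indep: "0 \<le> u 0 \<Longrightarrow> (\<And>i. i < n \<Longrightarrow> u i \<le> u (Suc i)) \<Longrightarrow>
      indep_vars (\<lambda>_. borel) (\<lambda>i \<omega>. R (u (Suc i)) \<omega> - R (u i) \<omega>) {..<n}"
    and levy_stationary: "0 \<le> s \<Longrightarrow> 0 \<le> h \<Longrightarrow> distr M borel (\<lambda>\<omega>. R (s + h) \<omega> - R s \<omega>) = distr M borel (R h)"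
    and levy_right_continuous: "\<omega> \<in> space M \<Longrightarrow> 0 \<le> s \<Longrightarrow> continuous (at_right s) (\<lambda>t. R t \<omega>)"
  using assms unfolding cadlag_levy_process_def cadlag_def by auto

lemma nn_integral_levy_increment:
  assumes levy: "cadlag_levy_process R" and st: "0 \<le> s" "0 \<le> h"
    and [measurable]: "H \<in> borel_measurable borel"
  shows "(\<integral>\<^sup>+\<omega>. H (R (s + h) \<omega> - R s \<omega>) \<partial>M) = (\<integral>\<^sup>+\<omega>. H (R h \<omega>) \<partial>M)"
proof -
  have [measurable]: "random_variable borel (R s)" "random_variable borel (R h)" "random_variable borel (R (s + h))"
    using st by (auto intro!: levy_rv[OF levy])
  have "(\<integral>\<^sup>+\<omega>. H (R (s + h) \<omega> - R s \<omega>) \<partial>M) = (\<integral>\<^sup>+x. H x \<partial>distr M borel (\<lambda>\<omega>. R (s + h) \<omega> - R s \<omega>))"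
    by (subst nn_integral_distr) auto
  also have "\<dots> = (\<integral>\<^sup>+x. H x \<partial>distr M borel (R h))"
    by (simp only: levy_stationary[OF levy st])
  also have "\<dots> = (\<integral>\<^sup>+\<omega>. H (R h \<omega>) \<partial>M)"
    by (subst nn_integral_distr) auto
  finally show ?thesis .
qed

lemma levy_exp_moment_mult:
  assumes levy: "cadlag_levy_process R" and st: "0 \<le> s" "0 \<le> h"
  shows "(\<integral>\<^sup>+\<omega>. ennreal (exp (- p * R (s + h) \<omega>)) \<partial>M) =
    (\<integral>\<^sup>+\<omega>. ennreal (exp (- p * R s \<omega>)) \<partial>M) * (\<integral>\<^sup>+\<omega>. ennreal (exp (- p * R h \<omega>)) \<partial>M)"
proof -
  \<comment> \<open>The two increments over the grid \<open>0\<close>, \<open>s\<close>,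
    \<open>s + h\<close>. The first agrees with \<open>R s\<close> only almost surely, because
    \<open>R 0 = 0\<close> holds only almost surely.\<close>
  define u :: "nat \<Rightarrow> real" where "u i = (if i = 0 then 0 else if i = 1 then s else s + h)" for i
  have "indep_vars (\<lambda>_. borel) (\<lambda>i \<omega>. R (u (Suc i)) \<omega> - R (u i) \<omega>) {..<2}"
    using st by (intro levy_indep[OF levy]) (auto simp: u_def)
  then have "indep_vars (\<lambda>_. borel) (\<lambda>i \<omega>. ennreal (exp (- p * (R (u (Suc i)) \<omega> - R (u i) \<omega>)))) {..<2}"
    by (rule indep_vars_compose2[where Y = "\<lambda>i x. ennreal (exp (- p * x))"]) measurable
  then have "(\<integral>\<^sup>+\<omega>. (\<Prod>i<2. ennreal (exp (- p * (R (u (Suc i)) \<omega> - R (u i) \<omega>)))) \<partial>M) =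
      (\<Prod>i<2. \<integral>\<^sup>+\<omega>. ennreal (exp (- p * (R (u (Suc i)) \<omega> - R (u i) \<omega>))) \<partial>M)"
    by (intro indep_vars_nn_integral) auto
  also have "\<dots> = (\<integral>\<^sup>+\<omega>. ennreal (exp (- p * (R (0 + s) \<omega> - R 0 \<omega>))) \<partial>M) *
      (\<integral>\<^sup>+\<omega>. ennreal (exp (- p * (R (s + h) \<omega> - R s \<omega>))) \<partial>M)"
    by (simp add: numeral_2_eq_2 u_def)
  also have "\<dots> = (\<integral>\<^sup>+\<omega>. ennreal (exp (- p * R s \<omega>)) \<partial>M) * (\<integral>\<^sup>+\<omega>. ennreal (exp (- p * R h \<omega>)) \<partial>M)"
    using st by (intro arg_cong2[where f = "(*)"] nn_integral_levy_increment[OF levy, where H = "\<lambda>x. ennreal (exp (- p * x))"]) auto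
  also have "(\<integral>\<^sup>+\<omega>. (\<Prod>i<2. ennreal (exp (- p * (R (u (Suc i)) \<omega> - R (u i) \<omega>)))) \<partial>M)
      = (\<integral>\<^sup>+\<omega>. ennreal (exp (- p * R (s + h) \<omega>)) \<partial>M)"
  proof (rule nn_integral_cong_AE)
    show "AE \<omega> in M. (\<Prod>i<2. ennreal (exp (- p * (R (u (Suc i)) \<omega> - R (u i) \<omega>)))) = ennreal (exp (- p * R (s + h) \<omega>))"
      using levy_zero[OF levy]
    proof eventually_elim
      case (elim \<omega>)
      then show ?case
        by (simp add: numeral_2_eq_2 u_def ennreal_mult[symmetric] exp_add[symmetric] algebra_simps)
    qed
  qed
  finally show ?thesis .
qed

text \<open>Integrability is known only at time \<open>1\<close>, hence the start in
  \<open>ennreal\<close>. Multiplicativity gives finiteness at integers, and then at any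
  \<open>s\<close>, since an infinite \<open>g s\<close> times the nonzero \<open>g (n - s)\<close>
  would make \<open>g n\<close> infinite. Fatou's lemma along right-continuous paths supplies the
  semicontinuity for \<open>multiplicative_powr\<close>.\<close>

lemma levy_exp_moment:
  assumes levy: "cadlag_levy_process R" and int: "integrable M (\<lambda>\<omega>. exp (- p * R 1 \<omega>))" and t: "0 \<le> t"
  shows "(\<integral>\<^sup>+\<omega>. ennreal (exp (- p * R t \<omega>)) \<partial>M) = ennreal (laplace R p powr t)"
proof -
  define g where "g s = (\<integral>\<^sup>+\<omega>. ennreal (exp (- p * R s \<omega>)) \<partial>M)" for s
  have g_mult: "g (s + h) = g s * g h" if "0 \<le> s" "0 \<le> h" for s h
    unfolding g_def using that by (rule levy_exp_moment_mult[OF levy])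
  have g_pos: "g s \<noteq> 0" if "0 \<le> s" for s
  proof
    note [measurable] = levy_rv[OF levy that]
    assume "g s = 0"
    then have "AE \<omega> in M. ennreal (exp (- p * R s \<omega>)) = 0"
      unfolding g_def by (subst (asm) nn_integral_0_iff_AE) auto
    then have "AE \<omega> in M. False" by eventually_elim simp
    then show False by simp
  qed
  have g1: "g 1 = ennreal (laplace R p)"
    unfolding g_def by (rule nn_integral_eq_integral[OF int]) simp
  have g_nat: "g (real n) \<noteq> \<top>" for n
  proof (induction n)
    case 0
    have "g 0 = (\<integral>\<^sup>+\<omega>. 1 \<partial>M)"
      unfolding g_def using levy_zero[OF levy] by (intro nn_integral_cong_AE) auto
    then show ?case by (simp add: emeasure_space_1)
  next
    case (Suc n)
    have "g (real (Suc n)) = g (real n) * g 1"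
      using g_mult[of "real n" 1] by (simp add: add.commute)
    then show ?case using Suc g1 by (simp add: ennreal_mult_eq_top_iff)
  qed
  have g_fin: "g s \<noteq> \<top>" if s: "0 \<le> s" for s
  proof
    assume top: "g s = \<top>"
    obtain n :: nat where n: "s \<le> real n" using real_arch_simple by blast
    have "g (real n) = g s * g (real n - s)" using g_mult[of s "real n - s"] s n by simp
    then have "g (real n) = \<top>" using top g_pos[of "real n - s"] n by (simp add: ennreal_top_mult)
    with g_nat show False by blast
  qed
  define f where "f s = enn2real (g s)" for s
  have fg: "g s = ennreal (f s)" if "0 \<le> s" for s
    using g_fin[OF that] by (simp add: f_def less_top)
  have "f t = f 1 powr t"
  proof (rule multiplicative_powr[OF _ _ _ t])
    show "0 < f s" if "0 \<le> s" for s
      using g_pos[OF that] g_fin[OF that] by (simp add: f_def enn2real_positive_iff less_top zero_less_iff_neq_zero)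
    show "f (s + h) = f s * f h" if "0 \<le> s" "0 \<le> h" for s h
      using g_mult[OF that] by (simp add: f_def enn2real_mult)
    show "f s \<le> c" if s: "0 \<le> s" and X: "X \<longlonglongrightarrow> s" "\<And>n. s < X n" and lim: "(\<lambda>n. f (X n)) \<longlonglongrightarrow> c" for s c X
    proof -
      have X0: "0 \<le> X n" for n using X(2)[of n] s by linarith
      note [measurable] = levy_rv[OF levy s] levy_rv[OF levy X0]
      have c0: "0 \<le> c" by (rule LIMSEQ_le_const[OF lim]) (simp add: f_def)
      have "g s = (\<integral>\<^sup>+\<omega>. liminf (\<lambda>n. ennreal (exp (- p * R (X n) \<omega>))) \<partial>M)"
        unfolding g_def
      proof (rule nn_integral_cong)
        fix \<omega> assume w: "\<omega> \<in> space M"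
        have "(\<lambda>n. R (X n) \<omega>) \<longlonglongrightarrow> R s \<omega>"
          by (rule right_continuous_LIMSEQ[OF levy_right_continuous[OF levy w s] X])
        then have "(\<lambda>n. ennreal (exp (- p * R (X n) \<omega>))) \<longlonglongrightarrow> ennreal (exp (- p * R s \<omega>))"
          by (intro tendsto_intros tendsto_ennrealI)
        then show "ennreal (exp (- p * R s \<omega>)) = liminf (\<lambda>n. ennreal (exp (- p * R (X n) \<omega>)))"
          by (rule lim_imp_Liminf[symmetric, rotated]) simp
      qed
      also have "\<dots> \<le> liminf (\<lambda>n. g (X n))"
        unfolding g_def by (rule nn_integral_liminf) measurable
      also have "\<dots> = liminf (\<lambda>n. ennreal (f (X n)))" by (simp only: fg[OF X0])
      also have "\<dots> = ennreal c"
        using lim by (intro lim_imp_Liminf tendsto_ennrealI) simp_all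
      finally show "f s \<le> c" using c0 by (simp add: fg[OF s])
    qed
  qed
  moreover have "f 1 = laplace R p" by (simp add: f_def g1)
  ultimately show ?thesis using fg[OF t] by (simp add: g_def)
qed

text \<open>Stopping the product martingale the first time it exceeds \<open>y\<close> preserves its expectation.\<close>

lemma product_maximal_inequality:
  fixes V :: "nat \<Rightarrow> 'a \<Rightarrow> real"
  assumes indep: "indep_vars (\<lambda>_. borel) V {..<m}"
    and nonneg: "\<And>i \<omega>. 0 \<le> V i \<omega>"
    and int: "\<And>i. i < m \<Longrightarrow> integrable M (V i)" "\<And>i. i < m \<Longrightarrow> expectation (V i) = 1"
    and y: "0 < y"
  shows "\<P>(\<omega> in M. \<exists>i\<le>m. (\<Prod>h<i. V h \<omega>) > y) \<le> 1 / y"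
proof -
  \<comment> \<open>The stopped product as a function of the whole sequence: it freezes once it
    exceeds \<open>y\<close>. As \<open>z i\<close> reads only the first \<open>i\<close>
    coordinates, it is independent of the next factor.\<close>
  define z :: "nat \<Rightarrow> (nat \<Rightarrow> real) \<Rightarrow> real" where
    "z = rec_nat (\<lambda>_. 1) (\<lambda>i f v. if f v > y then f v else f v * v i)"
  have z0: "z 0 v = 1" and zS: "z (Suc i) v = (if z i v > y then z i v else z i v * v i)" for i v
    by (simp_all add: z_def)
  have z_meas: "z i \<in> borel_measurable (PiM {..<n} (\<lambda>_. borel))" if "i \<le> n" for i n
    using that
  proof (induction i)
    case 0
    then show ?case by (simp add: z0[abs_def])
  next
    case (Suc i)
    then have [measurable]: "z i \<in> borel_measurable (PiM {..<n} (\<lambda>_. borel))" by simp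
    have [measurable]: "(\<lambda>v. v i) \<in> borel_measurable (PiM {..<n} (\<lambda>_. borel :: real measure))"
      using Suc.prems by (intro measurable_component_singleton) auto
    show ?case unfolding zS[abs_def] by measurable
  qed
  have z_restrict: "z i (restrict v {..<n}) = z i v" if "i \<le> n" for i n v
    using that by (induction i) (auto simp: z0 zS)
  define Z where "Z i \<omega> = z i (\<lambda>h. V h \<omega>)" for i \<omega>
  have Z_nonneg: "0 \<le> Z i \<omega>" for i \<omega>
    unfolding Z_def by (induction i) (auto simp: z0 zS nonneg)
  have Z: "integrable M (Z i) \<and> expectation (Z i) = 1" if "i \<le> m" for i
    using that
  proof (induction i)
    case 0
    then show ?case by (simp add: Z_def[abs_def] z0 prob_space)
  next
    case (Suc i)
    then have IH: "integrable M (Z i)" "expectation (Z i) = 1" and im: "i < m" by auto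
    note [measurable] = borel_measurable_integrable[OF IH(1)]
    define A where "A \<omega> = (if Z i \<omega> > y then Z i \<omega> else 0)" for \<omega>
    define B where "B \<omega> = (if Z i \<omega> > y then 0 else Z i \<omega>)" for \<omega>
    have [measurable]: "A \<in> borel_measurable M" "B \<in> borel_measurable M"
      unfolding A_def[abs_def] B_def[abs_def] by measurable
    have int_A: "integrable M A" and int_B: "integrable M B"
      by (rule Bochner_Integration.integrable_bound[OF IH(1)], simp, simp add: A_def B_def)+
    have "indep_var (PiM {..<i} (\<lambda>_. borel)) (\<lambda>\<omega>. restrict (\<lambda>h. V h \<omega>) {..<i})
        (PiM {i} (\<lambda>_. borel)) (\<lambda>\<omega>. restrict (\<lambda>h. V h \<omega>) {i})"
      using im by (intro indep_var_restrict[OF indep]) auto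
    then have "indep_var borel ((\<lambda>v. if z i v > y then 0 else z i v) \<circ> (\<lambda>\<omega>. restrict (\<lambda>h. V h \<omega>) {..<i}))
        borel ((\<lambda>v. v i) \<circ> (\<lambda>\<omega>. restrict (\<lambda>h. V h \<omega>) {i}))"
    proof (rule indep_var_compose)
      note [measurable] = z_meas[OF order_refl, of i]
      show "(\<lambda>v. if z i v > y then 0 else z i v) \<in> measurable (PiM {..<i} (\<lambda>_. borel)) borel"
        by measurable
      show "(\<lambda>v. v i) \<in> measurable (PiM {i} (\<lambda>_. borel)) borel"
        by (rule measurable_component_singleton) simp
    qed
    then have iB: "indep_var borel B borel (V i)"
      by (simp add: comp_def z_restrict B_def[abs_def] Z_def cong: if_cong)
    have eq: "Z (Suc i) \<omega> = A \<omega> + B \<omega> * V i \<omega>" for \<omega>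
      by (simp add: Z_def zS A_def B_def)
    have "expectation (Z (Suc i)) = expectation A + expectation B * expectation (V i)"
      unfolding eq[abs_def]
      using int_A indep_var_integrable[OF iB int_B int(1)[OF im]] indep_var_lebesgue_integral[OF iB int_B int(1)[OF im]]
      by simp
    also have "\<dots> = expectation A + expectation B" by (simp add: int(2)[OF im])
    also have "\<dots> = expectation (\<lambda>\<omega>. A \<omega> + B \<omega>)" using int_A int_B by simp
    also have "(\<lambda>\<omega>. A \<omega> + B \<omega>) = Z i" by (auto simp: A_def B_def)
    finally have "expectation (Z (Suc i)) = 1" using IH by simp
    moreover have "integrable M (Z (Suc i))"
      unfolding eq[abs_def] using int_A indep_var_integrable[OF iB int_B int(1)[OF im]] by simp
    ultimately show ?case by simp
  qed
  have stay: "z j v = z i v" if "i \<le> j" "z i v > y" for i j v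
    using that(1)
  proof (induction j rule: dec_induct)
    case (step n)
    then show ?case using that(2) by (simp add: zS)
  qed simp
  \<comment> \<open>A stopped product that is not above \<open>y\<close> at \<open>m\<close> never
    froze, so it agrees with the plain product throughout.\<close>
  have dom: "z m v > y" if iy: "i \<le> m" "(\<Prod>h<i. v h) > y" for i v
  proof (rule ccontr)
    assume neg: "\<not> z m v > y"
    have "z j v = (\<Prod>h<j. v h)" if "j \<le> m" for j
      using that
    proof (induction j)
      case (Suc j)
      then have "\<not> z j v > y" using stay[of j m v] neg by auto
      then show ?case using Suc by (simp add: zS mult.commute)
    qed (simp add: z0)
    then show False using iy neg stay[of i m v] by auto
  qed
  have Zm: "integrable M (Z m)" "expectation (Z m) = 1" using Z[OF order_refl] by auto
  note [measurable] = borel_measurable_integrable[OF Zm(1)]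
  have "\<P>(\<omega> in M. \<exists>i\<le>m. (\<Prod>h<i. V h \<omega>) > y) \<le> \<P>(\<omega> in M. Z m \<omega> \<ge> y)"
  proof (rule finite_measure_mono)
    show "{\<omega> \<in> space M. \<exists>i\<le>m. (\<Prod>h<i. V h \<omega>) > y} \<subseteq> {\<omega> \<in> space M. Z m \<omega> \<ge> y}"
      using dom unfolding Z_def by (auto intro: less_imp_le)
    show "{\<omega> \<in> space M. Z m \<omega> \<ge> y} \<in> events" by measurable
  qed
  also have "\<dots> \<le> expectation (Z m) / y"
    using Zm(1) Z_nonneg y by (intro integral_Markov_inequality_measure[where A = "{}"]) auto
  finally show ?thesis using Zm(2) by simp
qed

text \<open>Exponentials of the increments, divided by their mean \<open>f1 powr h\<close>, are
  independent with mean \<open>1\<close>, and their products telescope. The bound depends neither on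
  the mesh nor on the number of steps, which permits refinement of the grid.\<close>

lemma levy_grid_maximal:
  assumes levy: "cadlag_levy_process R" and int: "integrable M (\<lambda>\<omega>. exp (- p * R 1 \<omega>))"
    and h: "0 < h" and y: "0 < y"
  defines "f1 \<equiv> laplace R p"
  shows "\<P>(\<omega> in M. \<exists>i\<le>m. exp (- p * (R (real i * h) \<omega> - R 0 \<omega>)) / f1 powr (real i * h) > y) \<le> 1 / y"
proof -
  have f1: "0 < f1" unfolding f1_def by (rule expectation_greater[OF int]) simp
  define V where "V i \<omega> = exp (- p * (R (real (Suc i) * h) \<omega> - R (real i * h) \<omega>)) / f1 powr h" for i \<omega>
  have "indep_vars (\<lambda>_. borel) (\<lambda>i \<omega>. R (real (Suc i) * h) \<omega> - R (real i * h) \<omega>) {..<m}"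
    using h by (intro levy_indep[OF levy, where u = "\<lambda>i. real i * h"]) (auto intro!: mult_right_mono)
  then have indep: "indep_vars (\<lambda>_. borel) V {..<m}"
    unfolding V_def by (rule indep_vars_compose2[where Y = "\<lambda>i x. exp (- p * x) / f1 powr h"]) measurable
  have V: "integrable M (V i) \<and> expectation (V i) = 1" for i
  proof -
    have ih: "0 \<le> real i * h" "0 \<le> real (Suc i) * h" "real (Suc i) * h = real i * h + h"
      using h by (auto simp: algebra_simps)
    note [measurable] = levy_rv[OF levy ih(1)] levy_rv[OF levy ih(2)]
    have [measurable]: "V i \<in> borel_measurable M" unfolding V_def by measurable
    have "(\<integral>\<^sup>+\<omega>. ennreal (V i \<omega>) \<partial>M) = (\<integral>\<^sup>+\<omega>. ennreal (1 / f1 powr h) * ennreal (exp (- p * (R (real i * h + h) \<omega> - R (real i * h) \<omega>))) \<partial>M)"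
      unfolding V_def ih(3) by (intro nn_integral_cong) (simp add: ennreal_mult[symmetric])
    also have "\<dots> = ennreal (1 / f1 powr h) * (\<integral>\<^sup>+\<omega>. ennreal (exp (- p * (R (real i * h + h) \<omega> - R (real i * h) \<omega>))) \<partial>M)"
    proof (rule nn_integral_cmult)
      show "(\<lambda>\<omega>. ennreal (exp (- p * (R (real i * h + h) \<omega> - R (real i * h) \<omega>)))) \<in> borel_measurable M"
        unfolding ih(3)[symmetric] by measurable
    qed
    also have "(\<integral>\<^sup>+\<omega>. ennreal (exp (- p * (R (real i * h + h) \<omega> - R (real i * h) \<omega>))) \<partial>M) = (\<integral>\<^sup>+\<omega>. ennreal (exp (- p * R h \<omega>)) \<partial>M)"
      using h by (intro nn_integral_levy_increment[OF levy ih(1), where H = "\<lambda>x. ennreal (exp (- p * x))"]) auto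
    also have "\<dots> = ennreal (f1 powr h)"
      unfolding f1_def using h by (intro levy_exp_moment[OF levy int]) simp
    also have "ennreal (1 / f1 powr h) * ennreal (f1 powr h) = ennreal 1"
      using f1 by (subst ennreal_mult[symmetric]) auto
    finally show ?thesis
      by (subst (asm) nn_integral_eq_integrable) (auto simp: V_def)
  qed
  have "(\<Prod>k<i. V k \<omega>) = exp (- p * (R (real i * h) \<omega> - R 0 \<omega>)) / f1 powr (real i * h)" for i \<omega>
  proof (induction i)
    case (Suc i)
    have "(\<Prod>k<Suc i. V k \<omega>) = (exp (- p * (R (real i * h) \<omega> - R 0 \<omega>)) * exp (- p * (R (real (Suc i) * h) \<omega> - R (real i * h) \<omega>))) / (f1 powr (real i * h) * f1 powr h)"
      using Suc by (simp add: V_def del: of_nat_Suc)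
    also have "exp (- p * (R (real i * h) \<omega> - R 0 \<omega>)) * exp (- p * (R (real (Suc i) * h) \<omega> - R (real i * h) \<omega>))
        = exp (- p * (R (real (Suc i) * h) \<omega> - R 0 \<omega>))"
      by (simp add: exp_add[symmetric] algebra_simps del: of_nat_Suc)
    also have "f1 powr (real i * h) * f1 powr h = f1 powr (real (Suc i) * h)"
      by (simp add: powr_add[symmetric] algebra_simps)
    finally show ?case .
  qed (use f1 in simp)
  then show ?thesis
    using product_maximal_inequality[OF indep _ _ _ y] V by (simp add: V_def)
qed

text \<open>Nested dyadic grids carry the maximal inequality to all dyadic times: the normalised
  path exceeds \<open>Suc n\<close> somewhere with probability at most \<open>1 / Suc n\<close>, so
  it is almost surely bounded there. Right-continuity extends the bound to every time.\<close>

lemma levy_path_bound: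
  assumes levy: "cadlag_levy_process R" and int: "integrable M (\<lambda>\<omega>. exp (- p * R 1 \<omega>))"
  defines "f1 \<equiv> laplace R p"
  shows "AE \<omega> in M. \<exists>C. \<forall>s\<ge>0. exp (- p * R s \<omega>) \<le> C * f1 powr s"
proof -
  have f1: "0 < f1" unfolding f1_def by (rule expectation_greater[OF int]) simp
  define Y where "Y s \<omega> = exp (- p * (R s \<omega> - R 0 \<omega>)) / f1 powr s" for s \<omega>
  \<comment> \<open>The index \<open>l\<close> is both the time horizon and the dyadic level, so a
    single limit refines the grid and lengthens the interval.\<close>
  define A where "A n l = {\<omega> \<in> space M. \<exists>i\<le>l * 2 ^ l. Y (real i * (1 / 2 ^ l)) \<omega> > real (Suc n)}" for n l :: nat
  have A_meas: "A n l \<in> events" for n l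
  proof -
    have [measurable]: "random_variable borel (R (real i * (1 / 2 ^ l)))" for i
      by (rule levy_rv[OF levy]) simp
    have [measurable]: "random_variable borel (R 0)" by (rule levy_rv[OF levy]) simp
    show ?thesis unfolding A_def Y_def by measurable
  qed
  have A_prob: "prob (A n l) \<le> 1 / real (Suc n)" for n l
    unfolding A_def Y_def f1_def by (rule levy_grid_maximal[OF levy int]) auto
  have A_inc: "incseq (A n)" for n
  proof (rule incseq_SucI)
    fix l
    show "A n l \<subseteq> A n (Suc l)"
    proof
      fix \<omega> assume "\<omega> \<in> A n l"
      then obtain i where i: "\<omega> \<in> space M" "i \<le> l * 2 ^ l" "Y (real i * (1 / 2 ^ l)) \<omega> > real (Suc n)"
        by (auto simp: A_def)
      have "2 * i \<le> Suc l * 2 ^ Suc l" using i(2) by simp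
      moreover have "real (2 * i) * (1 / 2 ^ Suc l) = real i * (1 / 2 ^ l)" by simp
      ultimately show "\<omega> \<in> A n (Suc l)" unfolding A_def using i by (auto intro!: exI[of _ "2 * i"])
    qed
  qed
  define B where "B n = (\<Union>l. A n l)" for n
  have B_meas: "B n \<in> events" for n unfolding B_def using A_meas by auto
  have B_prob: "prob (B n) \<le> 1 / real (Suc n)" for n
  proof (rule LIMSEQ_le_const2)
    show "(\<lambda>l. prob (A n l)) \<longlonglongrightarrow> prob (B n)"
      unfolding B_def using A_inc A_meas by (intro finite_Lim_measure_incseq) auto
  qed (use A_prob in auto)
  have "prob (\<Inter>n. B n) \<le> 0"
  proof (rule LIMSEQ_le_const)
    show "(\<lambda>n. 1 / real (Suc n)) \<longlonglongrightarrow> 0" by (rule LIMSEQ_Suc[OF lim_1_over_n])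
    have "prob (\<Inter>n. B n) \<le> prob (B n)" for n
      using B_meas by (intro finite_measure_mono) auto
    then show "\<exists>N. \<forall>n\<ge>N. prob (\<Inter>n. B n) \<le> 1 / real (Suc n)"
      using B_prob order_trans by blast
  qed
  then have "prob (\<Inter>n. B n) = 0" by (simp add: measure_le_0_iff)
  then have "AE \<omega> in M. \<omega> \<notin> (\<Inter>n. B n)"
    using B_meas by (subst (asm) prob_eq_0) auto
  then show ?thesis
    using levy_zero[OF levy] AE_space
  proof eventually_elim
    case (elim \<omega>)
    then obtain n where n: "\<omega> \<notin> B n" by blast
    have "exp (- p * R s \<omega>) \<le> real (Suc n) * f1 powr s" if s: "0 \<le> s" for s
    proof -
      have rc: "continuous (at_right s) (\<lambda>t. R t \<omega>)"
        by (rule levy_right_continuous[OF levy elim(3) s])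
      \<comment> \<open>\<open>grid_above\<close> divides by the successor of its index, so
        \<open>2 ^ l - 1\<close> yields denominator \<open>2 ^ l\<close>.\<close>
      define X where "X l = grid_above (2 ^ l - 1) s" for l
      have X_eq: "X l = real (nat (\<lfloor>s * 2 ^ l\<rfloor> + 1)) * (1 / 2 ^ l)" for l
      proof -
        have "0 \<le> \<lfloor>s * 2 ^ l\<rfloor>" using s by simp
        then show ?thesis by (simp add: X_def grid_above_def of_nat_diff)
      qed
      have sub: "strict_mono (\<lambda>l::nat. 2 ^ l - 1 :: nat)"
        by (rule strict_monoI_Suc) (simp add: less_diff_conv)
      have X_lim: "X \<longlonglongrightarrow> s"
        using LIMSEQ_subseq_LIMSEQ[OF grid_above_tendsto sub, of s] by (simp add: X_def[abs_def] comp_def)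
      have X_gt: "s < X l" for l unfolding X_def by (rule grid_above_gt)
      have "(\<lambda>l. R (X l) \<omega>) \<longlonglongrightarrow> R s \<omega>" by (rule right_continuous_LIMSEQ[OF rc X_lim X_gt])
      then have "(\<lambda>l. Y (X l) \<omega>) \<longlonglongrightarrow> Y s \<omega>"
        unfolding Y_def using X_lim f1 by (intro tendsto_intros) auto
      moreover have "\<forall>\<^sub>F l in sequentially. Y (X l) \<omega> \<le> real (Suc n)"
        \<comment> \<open>From here on \<open>s + 1 \<le> l\<close>, so the approximating dyadic
          time lies within the horizon \<open>l\<close> of the grid.\<close>
        using eventually_ge_at_top[of "nat (\<lceil>s\<rceil> + 1)"]
      proof eventually_elim
        case (elim l)
        have "s + 1 \<le> real l" using elim s by linarith
        have "real (nat (\<lfloor>s * 2 ^ l\<rfloor> + 1)) = of_int \<lfloor>s * 2 ^ l\<rfloor> + 1" using s by simp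
        also have "\<dots> \<le> s * 2 ^ l + 1" by simp
        also have "\<dots> \<le> s * 2 ^ l + 1 * 2 ^ l" by simp
        also have "\<dots> = (s + 1) * 2 ^ l" by (simp add: distrib_right)
        also have "\<dots> \<le> real l * 2 ^ l" using \<open>s + 1 \<le> real l\<close> by (intro mult_right_mono) auto
        also have "\<dots> = real (l * 2 ^ l)" by simp
        finally have "nat (\<lfloor>s * 2 ^ l\<rfloor> + 1) \<le> l * 2 ^ l" by (simp only: of_nat_le_iff)
        moreover have "\<omega> \<notin> A n l" using n by (auto simp: B_def)
        ultimately show ?case unfolding X_eq using \<open>\<omega> \<in> space M\<close> by (auto simp: A_def not_less)
      qed
      ultimately have "Y s \<omega> \<le> real (Suc n)" by (intro tendsto_upperbound[of "\<lambda>l. Y (X l) \<omega>" _ sequentially]) auto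
      then show ?thesis using f1 \<open>R 0 \<omega> = 0\<close> by (simp add: Y_def divide_le_eq)
    qed
    then show ?case by blast
  qed
qed

text \<open>Taking the root of order \<open>p\<close> in the path bound gives exponential decay at
  rate \<open>- ln f1 / p\<close>, positive because \<open>f1 < 1\<close>. The majorant is a
  multiple of an exponential density, whose total mass is known.\<close>

lemma discount_integral_finite:
  assumes levy: "cadlag_levy_process R" and int: "integrable M (\<lambda>\<omega>. exp (- p * R 1 \<omega>))"
    and p: "0 < p" and lt1: "laplace R p < 1"
  shows "AE \<omega> in M. discount_integral R \<infinity> \<omega> < \<infinity>"
  using levy_path_bound[OF levy int]
proof eventually_elim
  case (elim \<omega>)
  define f1 where "f1 = laplace R p"
  have f1: "0 < f1" unfolding f1_def by (rule expectation_greater[OF int]) simp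
  obtain C where C: "\<And>s. 0 \<le> s \<Longrightarrow> exp (- p * R s \<omega>) \<le> C * f1 powr s"
    using elim by (auto simp: f1_def)
  have C0: "0 < C" using less_le_trans[OF exp_gt_zero C[of 0]] f1 by simp
  define l where "l = - ln f1 / p"
  have "f1 < 1" using lt1 by (simp only: f1_def)
  then have l: "0 < l" using f1 p by (simp add: l_def divide_neg_pos)
  have bd: "exp (- R s \<omega>) \<le> C powr (1 / p) / l * exponential_density l s" if s: "0 \<le> s" for s
  proof -
    have "exp (- R s \<omega>) = exp (- p * R s \<omega>) powr (1 / p)"
      using p by (simp add: powr_def)
    also have "\<dots> \<le> (C * f1 powr s) powr (1 / p)"
      using C[OF s] p by (intro powr_mono2) auto
    also have "\<dots> = C powr (1 / p) * (f1 powr s) powr (1 / p)" by (rule powr_mult)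
    also have "(f1 powr s) powr (1 / p) = exp (- s * l)"
      using f1 p by (simp add: powr_powr powr_def l_def)
    finally show ?thesis using s l by (simp add: exponential_density_def)
  qed
  interpret E: prob_space "density lborel (exponential_density l)"
    using l by (rule prob_space_exponential_density)
  have "discount_integral R \<infinity> \<omega> = (\<integral>\<^sup>+s. ennreal (exp (- R s \<omega>)) * indicator {0..} s \<partial>lborel)"
    unfolding discount_integral_def by (intro nn_integral_cong) (auto simp: indicator_def)
  also have "\<dots> \<le> (\<integral>\<^sup>+s. ennreal (C powr (1 / p) / l) * ennreal (exponential_density l s) \<partial>lborel)"
  proof (rule nn_integral_mono)
    fix s
    show "ennreal (exp (- R s \<omega>)) * indicator {0..} s \<le> ennreal (C powr (1 / p) / l) * ennreal (exponential_density l s)"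
    proof (cases "0 \<le> s")
      case True
      have "0 \<le> exponential_density l s" using l by (simp add: exponential_density_def)
      then show ?thesis using bd[OF True] True l by (simp add: ennreal_mult[symmetric] ennreal_leI)
    qed simp
  qed
  also have "\<dots> = ennreal (C powr (1 / p) / l) * (\<integral>\<^sup>+s. ennreal (exponential_density l s) \<partial>lborel)"
    by (rule nn_integral_cmult) simp
  also have "(\<integral>\<^sup>+s. ennreal (exponential_density l s) \<partial>lborel) = 1"
    using E.emeasure_space_1 by (simp add: emeasure_density)
  finally have "discount_integral R \<infinity> \<omega> \<le> ennreal (C powr (1 / p) / l)" by simp
  also have "\<dots> < \<infinity>" by simp
  finally show ?case .
qed

text \<open>The outcome itself, viewed through the identity map into \<open>N\<close>, plays the
  part of the whole return path. Independence of a time from \<open>N\<close> then becomes a product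
  law, and no separate path space has to be built.\<close>

lemma distr_pair_subalgebra:
  assumes \<tau>[measurable]: "\<tau> \<in> measurable M S" and sub: "subalgebra M N"
    and indep: "\<And>A B. A \<in> sets S \<Longrightarrow> B \<in> sets N \<Longrightarrow>
      prob (\<tau> -` A \<inter> space M \<inter> B) = prob (\<tau> -` A \<inter> space M) * prob B"
  shows "distr M S \<tau> \<Otimes>\<^sub>M distr M N (\<lambda>\<omega>. \<omega>) = distr M (S \<Otimes>\<^sub>M N) (\<lambda>\<omega>. (\<tau> \<omega>, \<omega>))"
proof (rule pair_measure_eqI)
  have id[measurable]: "(\<lambda>\<omega>. \<omega>) \<in> measurable M N"
    using sub by (auto simp: subalgebra_def measurable_def)
  interpret A: prob_space "distr M S \<tau>" by (rule prob_space_distr) simp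
  interpret B: prob_space "distr M N (\<lambda>\<omega>. \<omega>)" by (rule prob_space_distr) simp
  show "sigma_finite_measure (distr M S \<tau>)" "sigma_finite_measure (distr M N (\<lambda>\<omega>. \<omega>))"
    by unfold_locales
  show "sets (distr M S \<tau> \<Otimes>\<^sub>M distr M N (\<lambda>\<omega>. \<omega>)) = sets (distr M (S \<Otimes>\<^sub>M N) (\<lambda>\<omega>. (\<tau> \<omega>, \<omega>)))"
    by (simp add: sets_pair_measure_cong[OF sets_distr sets_distr])
  fix A B assume "A \<in> sets (distr M S \<tau>)" "B \<in> sets (distr M N (\<lambda>\<omega>. \<omega>))"
  then have AB[measurable]: "A \<in> sets S" "B \<in> sets N" by auto
  have BM: "B \<in> events" "B \<subseteq> space M"
    using sub AB(2) sets.sets_into_space[OF AB(2)] by (auto simp: subalgebra_def)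
  have pre: "(\<lambda>\<omega>. (\<tau> \<omega>, \<omega>)) -` (A \<times> B) \<inter> space M = \<tau> -` A \<inter> space M \<inter> B" by auto
  have "emeasure (distr M S \<tau>) A * emeasure (distr M N (\<lambda>\<omega>. \<omega>)) B
      = emeasure M (\<tau> -` A \<inter> space M) * emeasure M B"
    using BM(2) by (simp add: emeasure_distr Int_absorb2)
  also have "\<dots> = emeasure M (\<tau> -` A \<inter> space M \<inter> B)"
    by (simp add: emeasure_eq_measure indep[OF AB] ennreal_mult)
  also have "\<dots> = emeasure (distr M (S \<Otimes>\<^sub>M N) (\<lambda>\<omega>. (\<tau> \<omega>, \<omega>))) (A \<times> B)"
    by (subst emeasure_distr) (simp_all add: pre)
  finally show "emeasure (distr M S \<tau>) A * emeasure (distr M N (\<lambda>\<omega>. \<omega>)) B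
      = emeasure (distr M (S \<Otimes>\<^sub>M N) (\<lambda>\<omega>. (\<tau> \<omega>, \<omega>))) (A \<times> B)" .
qed

text \<open>Fubini freezes the time and leaves the moment at a deterministic time; right-continuity
  makes the path jointly measurable in time and outcome. The function \<open>H\<close> will carry
  the restriction to arrivals before \<open>t\<close>.\<close>

lemma levy_exp_moment_indep_time:
  assumes levy: "cadlag_levy_process R" and int: "integrable M (\<lambda>\<omega>. exp (- p * R 1 \<omega>))"
    and sub: "subalgebra M N" and RN: "\<And>s. 0 \<le> s \<Longrightarrow> R s \<in> borel_measurable N"
    and \<tau>_rv[measurable]: "\<tau> \<in> borel_measurable M"
    and indep: "\<And>A B. A \<in> sets borel \<Longrightarrow> B \<in> sets N \<Longrightarrow>
      prob (\<tau> -` A \<inter> space M \<inter> B) = prob (\<tau> -` A \<inter> space M) * prob B"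
    and \<tau>: "\<And>\<omega>. \<omega> \<in> space M \<Longrightarrow> 0 \<le> \<tau> \<omega>" and H[measurable]: "H \<in> borel_measurable borel"
  shows "(\<integral>\<^sup>+\<omega>. H (\<tau> \<omega>) * ennreal (exp (- p * R (\<tau> \<omega>) \<omega>)) \<partial>M) =
    (\<integral>\<^sup>+\<omega>. H (\<tau> \<omega>) * ennreal (laplace R p powr \<tau> \<omega>) \<partial>M)"
proof -
  have space_N: "space N = space M" using sub by (simp add: subalgebra_def)
  have id[measurable]: "(\<lambda>\<omega>. \<omega>) \<in> measurable M N"
    using sub by (auto simp: subalgebra_def measurable_def)
  have joint[measurable]: "(\<lambda>q. R (max 0 (fst q)) (snd q)) \<in> borel_measurable (borel \<Otimes>\<^sub>M N)"
    using RN levy_right_continuous[OF levy] by (intro borel_measurable_right_continuous_process) (auto simp: space_N)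
  define h where "h q = H (fst q) * ennreal (exp (- p * R (max 0 (fst q)) (snd q)))" for q
  have h_meas[measurable]: "h \<in> borel_measurable (borel \<Otimes>\<^sub>M N)"
    unfolding h_def by measurable
  interpret D: prob_space "distr M N (\<lambda>\<omega>. \<omega>)" by (rule prob_space_distr) simp
  have "(\<integral>\<^sup>+\<omega>. H (\<tau> \<omega>) * ennreal (exp (- p * R (\<tau> \<omega>) \<omega>)) \<partial>M) = (\<integral>\<^sup>+\<omega>. h (\<tau> \<omega>, \<omega>) \<partial>M)"
    using \<tau> by (intro nn_integral_cong) (simp add: h_def)
  also have "\<dots> = (\<integral>\<^sup>+q. h q \<partial>distr M (borel \<Otimes>\<^sub>M N) (\<lambda>\<omega>. (\<tau> \<omega>, \<omega>)))"
    by (subst nn_integral_distr) auto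
  also have "\<dots> = (\<integral>\<^sup>+q. h q \<partial>(distr M borel \<tau> \<Otimes>\<^sub>M distr M N (\<lambda>\<omega>. \<omega>)))"
    by (simp only: distr_pair_subalgebra[OF \<tau>_rv sub indep])
  also have "\<dots> = (\<integral>\<^sup>+s. \<integral>\<^sup>+\<omega>. h (s, \<omega>) \<partial>distr M N (\<lambda>\<omega>. \<omega>) \<partial>distr M borel \<tau>)"
    by (rule D.nn_integral_fst[symmetric]) (simp cong: measurable_cong_sets add: sets_pair_measure_cong[OF sets_distr sets_distr])
  also have "\<dots> = (\<integral>\<^sup>+s. H s * ennreal (laplace R p powr max 0 s) \<partial>distr M borel \<tau>)"
  proof (rule nn_integral_cong)
    fix s :: real
    have "(\<integral>\<^sup>+\<omega>. h (s, \<omega>) \<partial>distr M N (\<lambda>\<omega>. \<omega>)) = (\<integral>\<^sup>+\<omega>. h (s, \<omega>) \<partial>M)"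
    proof (subst nn_integral_distr)
      show "(\<lambda>\<omega>. h (s, \<omega>)) \<in> borel_measurable (distr M N (\<lambda>\<omega>. \<omega>))"
        using measurable_compose[OF measurable_Pair1'[of s borel N] h_meas] by simp
    qed simp_all
    also have "\<dots> = (\<integral>\<^sup>+\<omega>. H s * ennreal (exp (- p * R (max 0 s) \<omega>)) \<partial>M)" by (simp add: h_def)
    also have "\<dots> = H s * (\<integral>\<^sup>+\<omega>. ennreal (exp (- p * R (max 0 s) \<omega>)) \<partial>M)"
    proof (rule nn_integral_cmult)
      have "random_variable borel (R (max 0 s))" by (rule levy_rv[OF levy]) simp
      then show "(\<lambda>\<omega>. ennreal (exp (- p * R (max 0 s) \<omega>))) \<in> borel_measurable M" by measurable
    qed
    also have "\<dots> = H s * ennreal (laplace R p powr max 0 s)"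
      by (subst levy_exp_moment[OF levy int]) auto
    finally show "(\<integral>\<^sup>+\<omega>. h (s, \<omega>) \<partial>distr M N (\<lambda>\<omega>. \<omega>)) = H s * ennreal (laplace R p powr max 0 s)" .
  qed
  also have "\<dots> = (\<integral>\<^sup>+\<omega>. H (\<tau> \<omega>) * ennreal (laplace R p powr max 0 (\<tau> \<omega>)) \<partial>M)"
    by (subst nn_integral_distr) auto
  also have "\<dots> = (\<integral>\<^sup>+\<omega>. H (\<tau> \<omega>) * ennreal (laplace R p powr \<tau> \<omega>) \<partial>M)"
    using \<tau> by (intro nn_integral_cong) simp
  finally show ?thesis .
qed

text \<open>Convexity of \<open>exp\<close> between \<open>0\<close> and \<open>- b * Y\<close>:
  with weight \<open>a / b\<close> the smaller exponential is at most a convex combination of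
  \<open>1\<close> and the larger one, whose mean is below \<open>1\<close>.\<close>

lemma exp_moment_smaller_exponent:
  fixes a b :: real
  assumes meas[measurable]: "Y \<in> borel_measurable M" and int: "integrable M (\<lambda>\<omega>. exp (- b * Y \<omega>))"
    and lt1: "expectation (\<lambda>\<omega>. exp (- b * Y \<omega>)) < 1" and a: "0 < a" "a \<le> b"
  shows "integrable M (\<lambda>\<omega>. exp (- a * Y \<omega>))" "expectation (\<lambda>\<omega>. exp (- a * Y \<omega>)) < 1"
proof -
  define \<theta> where "\<theta> = a / b"
  have \<theta>: "0 < \<theta>" "\<theta> \<le> 1" "\<theta> * b = a" using a by (auto simp: \<theta>_def)
  have bd: "exp (- a * Y \<omega>) \<le> 1 + \<theta> * (exp (- b * Y \<omega>) - 1)" for \<omega>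
  proof -
    have "exp ((1 - \<theta>) *\<^sub>R 0 + \<theta> *\<^sub>R (- b * Y \<omega>)) \<le> (1 - \<theta>) * exp 0 + \<theta> * exp (- b * Y \<omega>)"
      using \<theta> exp_convex by (intro convex_onD[of UNIV]) auto
    moreover have "(1 - \<theta>) *\<^sub>R 0 + \<theta> *\<^sub>R (- b * Y \<omega>) = - (\<theta> * b) * Y \<omega>" by simp
    ultimately have "exp (- a * Y \<omega>) \<le> (1 - \<theta>) * exp 0 + \<theta> * exp (- b * Y \<omega>)"
      by (simp only: \<theta>(3))
    then show ?thesis by (simp add: algebra_simps)
  qed
  have intb: "integrable M (\<lambda>\<omega>. 1 + \<theta> * (exp (- b * Y \<omega>) - 1))" using int by simp
  show inta: "integrable M (\<lambda>\<omega>. exp (- a * Y \<omega>))"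
    by (rule Bochner_Integration.integrable_bound[OF intb]) (use order_trans[OF bd abs_ge_self] in auto)
  have "expectation (\<lambda>\<omega>. exp (- a * Y \<omega>)) \<le> expectation (\<lambda>\<omega>. 1 + \<theta> * (exp (- b * Y \<omega>) - 1))"
    using inta intb bd by (rule integral_mono)
  also have "\<dots> = 1 + \<theta> * (expectation (\<lambda>\<omega>. exp (- b * Y \<omega>)) - 1)"
    using int by (simp add: prob_space)
  also have "\<dots> < 1" using \<theta> lt1 by (simp add: mult_pos_neg)
  finally show "expectation (\<lambda>\<omega>. exp (- a * Y \<omega>)) < 1" .
qed

end

section \<open>Claim sizes, arrivals and weights in the renewal model\<close>

lemma (in prob_space) tail_cdf_distr:
  assumes [measurable]: "Y \<in> borel_measurable M"
  shows "tail (cdf (distr M borel Y)) u = \<P>(\<omega> in M. Y \<omega> > u)"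
proof -
  have "cdf (distr M borel Y) u = \<P>(\<omega> in M. Y \<omega> \<le> u)"
    by (simp add: cdf_def measure_distr vimage_def Int_def conj_commute)
  moreover have "\<P>(\<omega> in M. \<not> Y \<omega> \<le> u) = 1 - \<P>(\<omega> in M. Y \<omega> \<le> u)"
    by (rule prob_neg) measurable
  ultimately show ?thesis by (simp add: tail_def not_le)
qed

text \<open>The quantile at \<open>1 / m\<close> is the infimum of the levels whose tail is at most
  \<open>m\<close>. Nonnegativity together with \<open>m < 1\<close> bounds that set from below, so
  the infimum is genuine, and right-continuity of the distribution function shows that it is
  attained.\<close>

lemma (in prob_space) tail_quantile_bounds:
  fixes Y :: "'a \<Rightarrow> real"
  assumes Y[measurable]: "Y \<in> borel_measurable M" and nonneg: "\<And>\<omega>. \<omega> \<in> space M \<Longrightarrow> 0 \<le> Y \<omega>"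
    and pos: "\<And>u. 0 < \<P>(\<omega> in M. Y \<omega> > u)"
    and m: "0 < m" "m < 1" and le: "\<P>(\<omega> in M. Y \<omega> > y) \<le> m"
  shows "tail_quantile Y (1 / m) \<le> y" "\<P>(\<omega> in M. Y \<omega> > tail_quantile Y (1 / m)) \<le> m"
proof -
  define G where "G u = \<P>(\<omega> in M. Y \<omega> > u)" for u
  have G_mono: "G v \<le> G u" if "u \<le> v" for u v
    unfolding G_def using that by (intro finite_measure_mono) auto
  define S where "S = {z. G z \<le> m}"
  have q: "tail_quantile Y (1 / m) = Inf S"
  proof -
    have "(1 / m \<le> 1 / G z) = (G z \<le> m)" for z
      using m pos[of z] by (simp add: G_def field_simps)
    then show ?thesis
      by (simp add: tail_quantile_def left_inverse_def tail_cdf_distr[OF Y] S_def G_def)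
  qed
  have S0: "0 \<le> z" if "z \<in> S" for z
  proof (rule ccontr)
    assume "\<not> 0 \<le> z"
    then have "{\<omega> \<in> space M. Y \<omega> > z} = space M" using nonneg by force
    then have "G z = 1" by (simp add: G_def prob_space)
    then show False using that m by (simp add: S_def)
  qed
  have bdd: "bdd_below S" by (rule bdd_belowI[of _ 0]) (rule S0)
  have yS: "y \<in> S" using le by (simp add: S_def G_def)
  show "tail_quantile Y (1 / m) \<le> y" unfolding q using yS bdd by (rule cInf_lower)
  interpret D: real_distribution "distr M borel Y"
    by (rule real_distribution_distr) simp
  define X where "X n = Inf S + 1 / real (Suc n)" for n
  have X: "X \<longlonglongrightarrow> Inf S" "\<And>n. Inf S < X n"
    unfolding X_def[abs_def] using tendsto_add[OF tendsto_const LIMSEQ_Suc[OF lim_1_over_n], of "Inf S"] by auto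
  have "(\<lambda>n. cdf (distr M borel Y) (X n)) \<longlonglongrightarrow> cdf (distr M borel Y) (Inf S)"
    by (rule right_continuous_LIMSEQ[OF D.cdf_is_right_cont X])
  then have "(\<lambda>n. 1 - cdf (distr M borel Y) (X n)) \<longlonglongrightarrow> 1 - cdf (distr M borel Y) (Inf S)"
    by (intro tendsto_intros)
  then have "(\<lambda>n. G (X n)) \<longlonglongrightarrow> G (Inf S)"
    by (simp only: tail_def[symmetric] tail_cdf_distr[OF Y] G_def)
  moreover have "G (X n) \<le> m" for n
  proof -
    have "S \<noteq> {}" using yS by blast
    then obtain z where "z \<in> S" "z < X n" using cInf_lessD[OF _ X(2)[of n]] by blast
    then show ?thesis using G_mono[of z "X n"] by (auto simp: S_def)
  qed
  ultimately have "G (Inf S) \<le> m" by (intro LIMSEQ_le_const2) auto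
  then show "\<P>(\<omega> in M. Y \<omega> > tail_quantile Y (1 / m)) \<le> m" unfolding q G_def .
qed

text \<open>The definition lets each variable exceed its own quantile. Evaluated at a suitable
  argument, both quantiles lie below the common level \<open>y\<close>, so the joint exceedance of
  \<open>y\<close> is contained in the one of the definition; the bound on the tail of
  \<open>Z\<close> by that of \<open>Y\<close> controls the change of denominator.\<close>

lemma (in prob_space) asymptotically_independent_joint_tail:
  fixes Y Z :: "'a \<Rightarrow> real"
  assumes ai: "asymptotically_independent Y Z"
    and Y[measurable]: "Y \<in> borel_measurable M" and Z[measurable]: "Z \<in> borel_measurable M"
    and nonneg: "\<And>\<omega>. \<omega> \<in> space M \<Longrightarrow> 0 \<le> Y \<omega>" "\<And>\<omega>. \<omega> \<in> space M \<Longrightarrow> 0 \<le> Z \<omega>"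
    and pos: "\<And>u. 0 < \<P>(\<omega> in M. Y \<omega> > u)" "\<And>u. 0 < \<P>(\<omega> in M. Z \<omega> > u)"
    and comp: "(\<lambda>u. \<P>(\<omega> in M. Z \<omega> > u)) \<in> O(\<lambda>u. \<P>(\<omega> in M. Y \<omega> > u))"
  shows "((\<lambda>y. \<P>(\<omega> in M. Y \<omega> > y \<and> Z \<omega> > y) / \<P>(\<omega> in M. Y \<omega> > y)) \<longlongrightarrow> 0) at_top"
proof -
  define G where "G u = \<P>(\<omega> in M. Y \<omega> > u)" for u
  define H where "H u = \<P>(\<omega> in M. Z \<omega> > u)" for u
  have G: "0 < G u" and H: "0 < H u" for u using pos by (simp_all add: G_def H_def)
  have lim0: "((\<lambda>u. \<P>(\<omega> in M. W \<omega> > u)) \<longlongrightarrow> 0) at_top" if [measurable]: "W \<in> borel_measurable M" for W :: "'a \<Rightarrow> real"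
  proof -
    interpret D: real_distribution "distr M borel W"
      by (rule real_distribution_distr) simp
    have "((\<lambda>u. 1 - cdf (distr M borel W) u) \<longlongrightarrow> 1 - 1) at_top"
      by (intro tendsto_intros D.cdf_lim_at_top_prob)
    then show ?thesis by (simp only: tail_def[symmetric] tail_cdf_distr[OF that] diff_self)
  qed
  \<comment> \<open>The larger of the two tails is the smallest value that puts both quantiles at
    \<open>1 / m y\<close> below \<open>y\<close>.\<close>
  define m where "m y = max (G y) (H y)" for y
  have m0: "0 < m y" for y using G[of y] by (simp add: m_def less_max_iff_disj)
  have "((\<lambda>y. m y) \<longlongrightarrow> max 0 0) at_top"
    unfolding m_def G_def H_def by (intro tendsto_max lim0 Y Z)
  then have m_lim: "(m \<longlongrightarrow> 0) at_top" by simp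
  have x_lim: "filterlim (\<lambda>y. 1 / m y) at_top at_top"
  proof -
    have "filterlim m (at_right 0) at_top"
      unfolding filterlim_at using m_lim m0 by (intro conjI always_eventually allI) (auto simp: less_imp_neq[OF m0, symmetric])
    then show ?thesis
      using filterlim_compose[OF filterlim_inverse_at_top_right] by (simp add: inverse_eq_divide)
  qed
  define J where "J x = \<P>(\<omega> in M. Y \<omega> > tail_quantile Y x \<and> Z \<omega> > tail_quantile Z x)" for x
  define P where "P x = \<P>(\<omega> in M. Y \<omega> > tail_quantile Y x)" for x
  have "((\<lambda>x. J x / P x) \<longlongrightarrow> 0) at_top"
    using ai by (simp add: asymptotically_independent_def J_def P_def)
  then have JP: "((\<lambda>y. J (1 / m y) / P (1 / m y)) \<longlongrightarrow> 0) at_top"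
    using x_lim by (rule filterlim_compose)
  obtain K where K: "0 < K" "\<forall>\<^sub>F u in at_top. norm (H u) \<le> K * norm (G u)"
    using comp unfolding G_def H_def by (auto elim: landau_o.bigE)
  have "((\<lambda>y. (1 + K) * (J (1 / m y) / P (1 / m y))) \<longlongrightarrow> (1 + K) * 0) at_top"
    by (intro tendsto_intros JP)
  then have up: "((\<lambda>y. (1 + K) * (J (1 / m y) / P (1 / m y))) \<longlongrightarrow> 0) at_top" by simp
  have m1: "\<forall>\<^sub>F y in at_top. m y < 1"
    using m_lim by (rule order_tendstoD) simp
  show ?thesis
  proof (rule tendsto_sandwich[OF _ _ tendsto_const up])
    show "\<forall>\<^sub>F y in at_top. 0 \<le> \<P>(\<omega> in M. Y \<omega> > y \<and> Z \<omega> > y) / \<P>(\<omega> in M. Y \<omega> > y)"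
      by (intro always_eventually allI) simp
    show "\<forall>\<^sub>F y in at_top. \<P>(\<omega> in M. Y \<omega> > y \<and> Z \<omega> > y) / \<P>(\<omega> in M. Y \<omega> > y) \<le> (1 + K) * (J (1 / m y) / P (1 / m y))"
      using m1 K(2)
    proof eventually_elim
      case (elim y)
      have le: "\<P>(\<omega> in M. Y \<omega> > y) \<le> m y" "\<P>(\<omega> in M. Z \<omega> > y) \<le> m y"
        by (simp_all add: m_def G_def H_def)
      have qY: "tail_quantile Y (1 / m y) \<le> y" "P (1 / m y) \<le> m y"
        unfolding P_def by (rule tail_quantile_bounds[OF Y nonneg(1) pos(1) m0 elim(1) le(1)]; assumption)+
      have qZ: "tail_quantile Z (1 / m y) \<le> y"
        by (rule tail_quantile_bounds(1)[OF Z nonneg(2) pos(2) m0 elim(1) le(2)])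
      \<comment> \<open>This is where comparability enters: the larger tail is of the order of the
        tail of \<open>Y\<close>.\<close>
      have mK: "m y \<le> (1 + K) * G y"
        using elim(2) G[of y] H[of y] K(1) by (auto simp: m_def algebra_simps)
      have J_le: "\<P>(\<omega> in M. Y \<omega> > y \<and> Z \<omega> > y) \<le> J (1 / m y)"
        unfolding J_def using qY qZ by (intro finite_measure_mono) auto
      have Pp: "0 < P (1 / m y)" unfolding P_def by (rule pos)
      have J0: "0 \<le> J (1 / m y)" by (simp add: J_def)
      have "\<P>(\<omega> in M. Y \<omega> > y \<and> Z \<omega> > y) / G y \<le> J (1 / m y) / G y"
        using J_le G[of y] by (intro divide_right_mono) auto
      also have "\<dots> = (P (1 / m y) / G y) * (J (1 / m y) / P (1 / m y))" using Pp by simp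
      also have "\<dots> \<le> (1 + K) * (J (1 / m y) / P (1 / m y))"
      proof (rule mult_right_mono)
        show "P (1 / m y) / G y \<le> 1 + K"
          using qY(2) mK G[of y] by (simp add: pos_divide_le_eq)
      qed (use J0 Pp in simp)
      finally show ?case unfolding G_def .
    qed
  qed
qed

section \<open>Sigma-algebras of the model components and their independence\<close>

lemma sigma_algebra_component_sigma: "sigma_algebra (space M) (component_sigma M d r X \<theta> R q)"
  unfolding component_sigma_def generated_sigma_def
  by (cases q) (auto intro!: sigma_algebra_sigma_sets)

lemma generated_sigma_measurable:
  assumes "i \<in> I" "Y i \<in> borel_measurable M"
    and N: "space N = space M" "generated_sigma M I Y \<subseteq> sets N"
  shows "Y i \<in> borel_measurable N"
proof (rule measurableI)
  fix A :: "real set" assume "A \<in> sets borel"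
  then have "Y i -` A \<inter> space M \<in> generated_sigma M I Y"
    using assms(1) unfolding generated_sigma_def by (intro sigma_sets.Basic) auto
  then show "Y i -` A \<inter> space N \<in> sets N" using N by auto
qed simp

context renewal_model
begin

abbreviation component where "component \<equiv> component_sigma M d r X \<theta> R"

definition component_algebra :: "model_component \<Rightarrow> 'a measure" where
  "component_algebra q = sigma (space M) (component q)"

definition weight_algebra :: "'a measure" where
  "weight_algebra = sigma (space M) (\<Union>q\<in>insert Returns (Inter_Arrivals ` {1..d}). component q)"

lemma component_events: "q \<in> {Claim_Sizes, Returns} \<union> Inter_Arrivals ` {1..d} \<Longrightarrow> component q \<subseteq> events"
  using components_indep by (auto simp: indep_sets_def)

lemma component_Pow: "component q \<subseteq> Pow (space M)"
  using sigma_algebra_component_sigma by (rule sigma_algebra.axioms(1)[THEN algebra.axioms(1)[THEN ring_of_sets.axioms(1)[THEN semiring_of_sets.axioms(1)[THEN subset_class.space_closed]]]])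

lemma sets_component_algebra: "sets (component_algebra q) = component q"
  and space_component_algebra: "space (component_algebra q) = space M"
  unfolding component_algebra_def
  using sigma_algebra.sets_measure_of_eq[OF sigma_algebra_component_sigma] by (simp_all add: space_measure_of_conv)

lemma subalgebra_component:
  "q \<in> {Claim_Sizes, Returns} \<union> Inter_Arrivals ` {1..d} \<Longrightarrow> subalgebra M (component_algebra q)"
  using component_events by (simp add: subalgebra_def sets_component_algebra space_component_algebra)

lemma space_weight_algebra: "space weight_algebra = space M"
  and sets_weight_algebra: "sets weight_algebra =
    sigma_sets (space M) (\<Union>q\<in>insert Returns (Inter_Arrivals ` {1..d}). component q)"
  unfolding weight_algebra_def using component_Pow by (auto simp: space_measure_of_conv sets_measure_of_conv)

lemma subalgebra_weight: "subalgebra M weight_algebra"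
  unfolding subalgebra_def space_weight_algebra sets_weight_algebra
  using component_events by (auto intro!: sets.sigma_sets_subset)

lemma component_subalgebra_weight:
  "q \<in> insert Returns (Inter_Arrivals ` {1..d}) \<Longrightarrow> subalgebra weight_algebra (component_algebra q)"
  unfolding subalgebra_def space_weight_algebra sets_weight_algebra space_component_algebra sets_component_algebra
  by (auto intro: sigma_sets.Basic)

text \<open>Mutual independence of all components is grouped into two blocks, indexed by
  \<open>bool\<close>: the claims against everything else.\<close>

lemma indep_set_claims_weights: "indep_set (component Claim_Sizes) (sets weight_algebra)"
proof -
  define I where "I b = (if b then {Claim_Sizes} else insert Returns (Inter_Arrivals ` {1..d}))" for b :: bool
  have "indep_sets (\<lambda>b. sigma_sets (space M) (\<Union>q\<in>I b. component q)) UNIV"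
  proof (rule indep_sets_collect_sigma)
    have "(\<Union>b\<in>UNIV. I b) = {Claim_Sizes, Returns} \<union> Inter_Arrivals ` {1..d}"
      by (auto simp: I_def UNIV_bool)
    then show "indep_sets component (\<Union>b\<in>UNIV. I b)" using components_indep by simp
    show "Int_stable (component q)" for q
      using sigma_algebra_component_sigma[of M d r X \<theta> R q]
      by (auto simp: Int_stable_def sigma_algebra_def algebra_def ring_of_sets_def semiring_of_sets_def semiring_of_sets_axioms_def)
    show "disjoint_family_on I UNIV" by (auto simp: disjoint_family_on_def I_def)
  qed
  moreover have "sigma_sets (space M) (\<Union>q\<in>I b. component q) = case_bool (component Claim_Sizes) (sets weight_algebra) b" for b
    using sigma_algebra.sigma_sets_eq[OF sigma_algebra_component_sigma[of M d r X \<theta> R Claim_Sizes]]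
    by (cases b) (simp_all add: I_def sets_weight_algebra)
  ultimately show ?thesis by (simp add: indep_set_def)
qed

lemma claim_measurable:
  assumes "k \<in> {1..d}" "j \<in> {1..r}" "i \<ge> 1"
  shows "X k j i \<in> borel_measurable (component_algebra Claim_Sizes)"
  using generated_sigma_measurable[of "(k, j, i)" "{1..d} \<times> {1..r} \<times> {1..}" "\<lambda>(k, j, i). X k j i" M "component_algebra Claim_Sizes"]
    assms claim_rv[OF assms]
  by (simp add: space_component_algebra sets_component_algebra component_sigma_def)

lemma inter_arrival_measurable:
  assumes "k \<in> {1..d}" "j \<in> {1..r}" "i \<ge> 1"
  shows "\<theta> k j i \<in> borel_measurable (component_algebra (Inter_Arrivals k))"
  using generated_sigma_measurable[of "(j, i)" "{1..r} \<times> {1..}" "\<lambda>(j, i). \<theta> k j i" M "component_algebra (Inter_Arrivals k)"]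
    assms inter_arrival_rv[OF assms]
  by (simp add: space_component_algebra sets_component_algebra component_sigma_def)

lemma returns_measurable:
  assumes "0 \<le> s"
  shows "R s \<in> borel_measurable (component_algebra Returns)"
  using generated_sigma_measurable[of s "{0..}" R M "component_algebra Returns"]
    assms levy_rv[OF levy assms]
  by (simp add: space_component_algebra sets_component_algebra component_sigma_def)

lemma claim_weight_indep_var:
  assumes k: "k \<in> {1..d}" "j \<in> {1..r}" "i \<ge> 1" and U: "U \<in> borel_measurable weight_algebra"
  shows "indep_var borel (X k j i) borel U"
  unfolding indep_var_eq
proof (intro conjI)
  show "random_variable borel (X k j i)" using k by (rule claim_rv)
  show "random_variable borel U" using U by (rule measurable_from_subalg[OF subalgebra_weight])
  have "{X k j i -` A \<inter> space M |A. A \<in> sets borel} \<subseteq> sets (component_algebra Claim_Sizes)"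
    using measurable_sets[OF claim_measurable[OF k]] by (auto simp: space_component_algebra)
  then have 1: "sigma_sets (space M) {X k j i -` A \<inter> space M |A. A \<in> sets borel} \<subseteq> component Claim_Sizes"
    using sets.sigma_sets_subset[of _ "component_algebra Claim_Sizes"]
    by (simp add: space_component_algebra sets_component_algebra)
  have "{U -` A \<inter> space M |A. A \<in> sets borel} \<subseteq> sets weight_algebra"
    using measurable_sets[OF U] by (auto simp: space_weight_algebra)
  then have 2: "sigma_sets (space M) {U -` A \<inter> space M |A. A \<in> sets borel} \<subseteq> sets weight_algebra"
    using sets.sigma_sets_subset[of _ weight_algebra] by (simp add: space_weight_algebra)
  show "indep_set (sigma_sets (space M) {X k j i -` A \<inter> space M |A. A \<in> sets borel})
      (sigma_sets (space M) {U -` A \<inter> space M |A. A \<in> sets borel})"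
    using indep_set_claims_weights unfolding indep_set_def
    by (rule indep_sets_mono_sets) (use 1 2 in \<open>simp split: bool.split\<close>)
qed

lemma claims_weight_indep:
  assumes k: "k \<in> {1..d}" "j \<in> {1..r}" "i \<ge> 1" and k': "k' \<in> {1..d}" "j' \<in> {1..r}" "i' \<ge> 1"
    and B: "B \<in> sets weight_algebra"
  shows "\<P>(\<omega> in M. X k j i \<omega> > u \<and> X k' j' i' \<omega> > u \<and> \<omega> \<in> B) =
    \<P>(\<omega> in M. X k j i \<omega> > u \<and> X k' j' i' \<omega> > u) * prob B"
proof -
  note [measurable] = claim_measurable[OF k] claim_measurable[OF k']
  have "{\<omega> \<in> space (component_algebra Claim_Sizes). X k j i \<omega> > u \<and> X k' j' i' \<omega> > u} \<in> sets (component_algebra Claim_Sizes)"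
    by measurable
  then have A: "{\<omega> \<in> space M. X k j i \<omega> > u \<and> X k' j' i' \<omega> > u} \<in> component Claim_Sizes"
    by (simp add: space_component_algebra sets_component_algebra)
  have "{\<omega> \<in> space M. X k j i \<omega> > u \<and> X k' j' i' \<omega> > u \<and> \<omega> \<in> B}
      = {\<omega> \<in> space M. X k j i \<omega> > u \<and> X k' j' i' \<omega> > u} \<inter> B"
    by blast
  then show ?thesis using indep_setD[OF indep_set_claims_weights A B] by simp
qed

lemma arrival_returns_indep:
  assumes k: "k \<in> {1..d}" and T: "T \<in> borel_measurable (component_algebra (Inter_Arrivals k))"
    and A: "A \<in> sets borel" and B: "B \<in> sets (component_algebra Returns)"
  shows "prob (T -` A \<inter> space M \<inter> B) = prob (T -` A \<inter> space M) * prob B"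
proof -
  have A': "T -` A \<inter> space M \<in> component (Inter_Arrivals k)"
    using measurable_sets[OF T A] by (simp add: space_component_algebra sets_component_algebra)
  have B': "B \<in> component Returns" using B by (simp add: sets_component_algebra)
  define E where "E q = (if q = Returns then B else T -` A \<inter> space M)" for q
  have "prob (\<Inter>q\<in>{Inter_Arrivals k, Returns}. E q) = (\<Prod>q\<in>{Inter_Arrivals k, Returns}. prob (E q))"
    using k A' B' by (intro indep_setsD[OF components_indep]) (auto simp: E_def)
  then show ?thesis by (simp add: E_def)
qed

section \<open>Arrival times\<close>

abbreviation \<tau> :: "nat \<Rightarrow> nat \<Rightarrow> nat \<Rightarrow> 'a \<Rightarrow> real" where
  "\<tau> k j i \<equiv> arrival_time \<theta> k j (Suc i)"

text \<open>As \<tau> is shifted by \<open>Suc\<close>, index \<open>0\<close> refers to the first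
  claim: \<open>arrived k j 0 t\<close> is the event whose probability serves as
  \<open>\<L>\<close>.\<close>

abbreviation arrived :: "nat \<Rightarrow> nat \<Rightarrow> nat \<Rightarrow> ereal \<Rightarrow> 'a set" where
  "arrived k j i t \<equiv> {\<omega> \<in> space M. ereal (\<tau> k j i \<omega>) \<le> t}"

abbreviation waiting_moment :: "real \<Rightarrow> nat \<Rightarrow> nat \<Rightarrow> real" where
  "waiting_moment b k j \<equiv> expectation (\<lambda>\<omega>. b powr \<theta> k j 1 \<omega>)"

lemma arrival_measurable_component:
  assumes "k \<in> {1..d}" "j \<in> {1..r}"
  shows "arrival_time \<theta> k j i \<in> borel_measurable (component_algebra (Inter_Arrivals k))"
proof -
  have "(\<lambda>\<omega>. \<Sum>h=1..i. \<theta> k j h \<omega>) \<in> borel_measurable (component_algebra (Inter_Arrivals k))"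
    using assms by (intro borel_measurable_sum inter_arrival_measurable) auto
  moreover have "arrival_time \<theta> k j i = (\<lambda>\<omega>. \<Sum>h=1..i. \<theta> k j h \<omega>)"
    by (rule ext) (rule arrival_time_def)
  ultimately show ?thesis by (simp only:)
qed

lemma arrival_measurable:
  assumes "k \<in> {1..d}" "j \<in> {1..r}"
  shows "arrival_time \<theta> k j i \<in> borel_measurable M"
proof (rule measurable_from_subalg)
  show "subalgebra M (component_algebra (Inter_Arrivals k))"
    using assms by (intro subalgebra_component) simp
qed (rule arrival_measurable_component[OF assms])

lemma arrival_mono:
  assumes "k \<in> {1..d}" "j \<in> {1..r}" "\<omega> \<in> space M" "i \<le> i'"
  shows "arrival_time \<theta> k j i \<omega> \<le> arrival_time \<theta> k j i' \<omega>"
  unfolding arrival_time_def using assms by (intro sum_mono2 inter_arrival_nonneg) simp_all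

lemma arrival_nonneg:
  assumes "k \<in> {1..d}" "j \<in> {1..r}" "\<omega> \<in> space M"
  shows "0 \<le> arrival_time \<theta> k j i \<omega>"
  unfolding arrival_time_def using assms by (intro sum_nonneg inter_arrival_nonneg) simp_all

lemma arrival_1: "\<tau> k j 0 = \<theta> k j 1"
  by (simp add: arrival_time_def fun_eq_iff)

lemma inter_arrival_indep_scalar:
  assumes "k \<in> {1..d}" "j \<in> {1..r}"
  shows "indep_vars (\<lambda>_. borel) (\<theta> k j) {1..}"
proof -
  have "indep_vars (\<lambda>_. borel) (\<lambda>i \<omega>. inter_arrival_vector r \<theta> k i \<omega> j) {1..}"
    by (rule indep_vars_compose2[OF inter_arrival_indep[OF assms(1)], where Y = "\<lambda>_ v. v j"])
      (rule measurable_component_singleton[OF assms(2)])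
  then show ?thesis using assms(2) by (simp add: inter_arrival_vector_def)
qed

lemma nn_integral_inter_arrival:
  assumes "k \<in> {1..d}" "j \<in> {1..r}" "i \<ge> 1" and [measurable]: "H \<in> borel_measurable borel"
  shows "(\<integral>\<^sup>+\<omega>. H (\<theta> k j i \<omega>) \<partial>M) = (\<integral>\<^sup>+\<omega>. H (\<theta> k j 1 \<omega>) \<partial>M)"
proof -
  have rv: "inter_arrival_vector r \<theta> k i' \<in> measurable M (\<Pi>\<^sub>M j\<in>{1..r}. borel)" if "i' \<ge> 1" for i'
    using inter_arrival_indep[OF assms(1)] that by (auto simp: indep_vars_def)
  have [measurable]: "(\<lambda>v. H (v j)) \<in> borel_measurable (\<Pi>\<^sub>M j\<in>{1..r}. borel :: real measure)"
    by (rule measurable_compose[OF measurable_component_singleton[OF assms(2)]]) simp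
  have eq: "(\<integral>\<^sup>+\<omega>. H (\<theta> k j i' \<omega>) \<partial>M) = (\<integral>\<^sup>+v. H (v j) \<partial>distr M (\<Pi>\<^sub>M j\<in>{1..r}. borel) (inter_arrival_vector r \<theta> k i'))"
    if "i' \<ge> 1" for i'
    using rv[OF that] assms(2) by (subst nn_integral_distr) (auto simp: inter_arrival_vector_def)
  show ?thesis
    using inter_arrival_ident[OF assms(1,3) order_refl] by (simp only: eq[OF assms(3)] eq[OF order_refl])
qed

text \<open>Strictness is the point: for \<open>b < 1\<close> the mean of
  \<open>b powr \<theta>\<close> equals \<open>1\<close> only if \<theta> vanishes almost surely.
  This is the source of the ratio of the geometric decay.\<close>

lemma inter_arrival_moment:
  assumes kj: "k \<in> {1..d}" "j \<in> {1..r}" and b: "0 < b" "b < 1"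
  shows "integrable M (\<lambda>\<omega>. b powr \<theta> k j 1 \<omega>)" "0 \<le> waiting_moment b k j"
    "waiting_moment b k j < 1"
proof -
  note [measurable] = inter_arrival_rv[OF kj order_refl]
  have le1: "b powr \<theta> k j 1 \<omega> \<le> 1" if "\<omega> \<in> space M" for \<omega>
    using b inter_arrival_nonneg[OF kj order_refl that] powr_mono'[of 0 "\<theta> k j 1 \<omega>" b] by simp
  show int: "integrable M (\<lambda>\<omega>. b powr \<theta> k j 1 \<omega>)"
  proof (rule integrable_const_bound[of _ 1])
    show "AE \<omega> in M. norm (b powr \<theta> k j 1 \<omega>) \<le> 1" using le1 by (intro AE_I2) simp
    show "(\<lambda>\<omega>. b powr \<theta> k j 1 \<omega>) \<in> borel_measurable M" by measurable
  qed
  show "0 \<le> waiting_moment b k j" by simp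
  have "waiting_moment b k j \<le> expectation (\<lambda>_. 1)"
    using int le1 by (intro integral_mono) auto
  moreover have "waiting_moment b k j \<noteq> 1"
  proof
    assume "waiting_moment b k j = 1"
    then have "expectation (\<lambda>\<omega>. 1 - b powr \<theta> k j 1 \<omega>) = 0" using int by (simp add: prob_space)
    then have "AE \<omega> in M. 1 - b powr \<theta> k j 1 \<omega> = 0"
      using int le1 by (subst (asm) integral_nonneg_eq_0_iff_AE) auto
    then have "AE \<omega> in M. \<theta> k j 1 \<omega> = 0"
    proof eventually_elim
      case (elim \<omega>)
      then have "\<theta> k j 1 \<omega> * ln b = 0" using b by (simp add: powr_def)
      then show ?case using b by simp
    qed
    then show False using inter_arrival_not_AE_0[OF kj order_refl] by blast
  qed
  ultimately show "waiting_moment b k j < 1" by (simp add: prob_space)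
qed

text \<open>The event is relaxed to the first arrival before \<open>t\<close>, and the first waiting
  time is dropped from the exponent. What remains is a product of independent factors: the first one
  gives the probability, and the other \<open>i\<close> waiting times give one moment each.\<close>

lemma arrival_moment_bound:
  assumes kj: "k \<in> {1..d}" "j \<in> {1..r}" and b: "0 < b" "b < 1"
  shows "(\<integral>\<^sup>+\<omega>. of_bool (ereal (\<tau> k j i \<omega>) \<le> t) * ennreal (b powr \<tau> k j i \<omega>) \<partial>M)
    \<le> ennreal (waiting_moment b k j ^ i * prob (arrived k j 0 t))"
proof -
  \<comment> \<open>The first waiting time enters only through the event, the others only through
    the power.\<close>
  define Y :: "nat \<Rightarrow> real \<Rightarrow> ennreal" where
    "Y h s = (if h = 1 then indicator {s. ereal s \<le> t} s else ennreal (b powr s))" for h s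
  note [measurable] = inter_arrival_rv[OF kj order_refl]
  have Y[measurable]: "Y h \<in> borel_measurable borel" for h
    unfolding Y_def by measurable
  have "indep_vars (\<lambda>_. borel) (\<lambda>h \<omega>. Y h (\<theta> k j h \<omega>)) {1..}"
    by (rule indep_vars_compose2[OF inter_arrival_indep_scalar[OF kj]]) simp
  then have indep: "indep_vars (\<lambda>_. borel) (\<lambda>h \<omega>. Y h (\<theta> k j h \<omega>)) {1..Suc i}"
    by (rule indep_vars_subset) auto
  have "(\<integral>\<^sup>+\<omega>. of_bool (ereal (\<tau> k j i \<omega>) \<le> t) * ennreal (b powr \<tau> k j i \<omega>) \<partial>M)
      \<le> (\<integral>\<^sup>+\<omega>. (\<Prod>h\<in>{1..Suc i}. Y h (\<theta> k j h \<omega>)) \<partial>M)"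
  proof (rule nn_integral_mono)
    fix \<omega> assume w: "\<omega> \<in> space M"
    let ?T = "\<tau> k j i \<omega>"
    have split: "{1..Suc i} = insert 1 {2..Suc i}" by auto
    have sum_split: "?T = \<theta> k j 1 \<omega> + (\<Sum>h\<in>{2..Suc i}. \<theta> k j h \<omega>)"
      unfolding arrival_time_def split by (subst sum.insert) auto
    have Tle: "(\<Sum>h\<in>{2..Suc i}. \<theta> k j h \<omega>) \<le> ?T"
      using inter_arrival_nonneg[OF kj order_refl w] by (simp add: sum_split)
    have le1: "\<tau> k j 0 \<omega> \<le> ?T" using kj w by (intro arrival_mono) auto
    have "(\<Prod>h\<in>{1..Suc i}. Y h (\<theta> k j h \<omega>)) = indicator {s. ereal s \<le> t} (\<theta> k j 1 \<omega>) * (\<Prod>h\<in>{2..Suc i}. ennreal (b powr \<theta> k j h \<omega>))"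
      unfolding split by (subst prod.insert) (auto simp: Y_def intro!: prod.cong)
    also have "(\<Prod>h\<in>{2..Suc i}. ennreal (b powr \<theta> k j h \<omega>)) = ennreal (b powr (\<Sum>h\<in>{2..Suc i}. \<theta> k j h \<omega>))"
      using b powr_sum[of b "\<lambda>h. \<theta> k j h \<omega>" "{2..Suc i}"] by (subst prod_ennreal) (simp_all del: prod.cl_ivl_Suc sum.cl_ivl_Suc)
    finally have eq: "(\<Prod>h\<in>{1..Suc i}. Y h (\<theta> k j h \<omega>)) = indicator {s. ereal s \<le> t} (\<theta> k j 1 \<omega>) * ennreal (b powr (\<Sum>h\<in>{2..Suc i}. \<theta> k j h \<omega>))" .
    show "of_bool (ereal ?T \<le> t) * ennreal (b powr ?T) \<le> (\<Prod>h\<in>{1..Suc i}. Y h (\<theta> k j h \<omega>))"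
      unfolding eq
    proof (rule mult_mono)
      show "of_bool (ereal ?T \<le> t) \<le> (indicator {s. ereal s \<le> t} (\<theta> k j 1 \<omega>) :: ennreal)"
      proof (cases "ereal ?T \<le> t")
        case True
        have "ereal (\<theta> k j 1 \<omega>) \<le> ereal ?T" using le1 by (simp add: arrival_1)
        then have "ereal (\<theta> k j 1 \<omega>) \<le> t" using True by (rule order_trans)
        then show ?thesis by simp
      qed simp
      show "ennreal (b powr ?T) \<le> ennreal (b powr (\<Sum>h\<in>{2..Suc i}. \<theta> k j h \<omega>))"
        using b Tle by (intro ennreal_leI powr_mono') auto
    qed auto
  qed
  also have "\<dots> = (\<Prod>h\<in>{1..Suc i}. \<integral>\<^sup>+\<omega>. Y h (\<theta> k j h \<omega>) \<partial>M)"
    using indep by (intro indep_vars_nn_integral) auto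
  also have "\<dots> = (\<integral>\<^sup>+\<omega>. Y 1 (\<theta> k j 1 \<omega>) \<partial>M) * (\<Prod>h\<in>{2..Suc i}. \<integral>\<^sup>+\<omega>. Y h (\<theta> k j h \<omega>) \<partial>M)"
  proof -
    have split: "{1..Suc i} = insert 1 {2..Suc i}" by auto
    show ?thesis unfolding split by (subst prod.insert) auto
  qed
  also have "(\<integral>\<^sup>+\<omega>. Y 1 (\<theta> k j 1 \<omega>) \<partial>M) = ennreal (prob (arrived k j 0 t))"
  proof -
    have "(\<integral>\<^sup>+\<omega>. Y 1 (\<theta> k j 1 \<omega>) \<partial>M) = (\<integral>\<^sup>+\<omega>. indicator {\<omega> \<in> space M. ereal (\<theta> k j 1 \<omega>) \<le> t} \<omega> \<partial>M)"
      by (intro nn_integral_cong) (auto simp: Y_def indicator_def)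
    also have "\<dots> = emeasure M {\<omega> \<in> space M. ereal (\<theta> k j 1 \<omega>) \<le> t}"
      by (rule nn_integral_indicator) measurable
    finally show ?thesis by (simp add: emeasure_eq_measure arrival_1)
  qed
  also have "(\<Prod>h\<in>{2..Suc i}. \<integral>\<^sup>+\<omega>. Y h (\<theta> k j h \<omega>) \<partial>M) = (\<Prod>h\<in>{2..Suc i}. ennreal (waiting_moment b k j))"
  proof (rule prod.cong[OF refl])
    fix h assume h: "h \<in> {2..Suc i}"
    have "(\<integral>\<^sup>+\<omega>. Y h (\<theta> k j h \<omega>) \<partial>M) = (\<integral>\<^sup>+\<omega>. ennreal (b powr \<theta> k j h \<omega>) \<partial>M)"
      using h by (simp add: Y_def)
    also have "\<dots> = (\<integral>\<^sup>+\<omega>. ennreal (b powr \<theta> k j 1 \<omega>) \<partial>M)"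
      using h by (intro nn_integral_inter_arrival[OF kj, where H = "\<lambda>s. ennreal (b powr s)"]) auto
    also have "\<dots> = ennreal (waiting_moment b k j)"
      by (rule nn_integral_eq_integral[OF inter_arrival_moment(1)[OF kj b]]) simp
    finally show "(\<integral>\<^sup>+\<omega>. Y h (\<theta> k j h \<omega>) \<partial>M) = ennreal (waiting_moment b k j)" .
  qed
  also have "\<dots> = ennreal (waiting_moment b k j ^ i)"
    by (simp add: ennreal_power)
  also have "ennreal (prob (arrived k j 0 t)) * ennreal (waiting_moment b k j ^ i)
      = ennreal (waiting_moment b k j ^ i * prob (arrived k j 0 t))"
    by (subst ennreal_mult[symmetric]) (auto simp: mult.commute)
  finally show ?thesis .
qed

text \<open>Fix a time \<open>s\<close> by which the first claim has arrived with probability above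
  \<open>1 / 2\<close>. For \<open>t \<le> s\<close> the power is at least \<open>b powr s\<close>
  on the whole event. For larger \<open>t\<close> the part before \<open>s\<close> alone suffices,
  at the cost of a factor \<open>2\<close>.\<close>

lemma first_arrival_lower:
  assumes kj: "k \<in> {1..d}" "j \<in> {1..r}" and b: "0 < b" "b < 1"
  obtains \<kappa> where "0 < \<kappa>" "\<And>t. \<kappa> * prob (arrived k j 0 t)
    \<le> expectation (\<lambda>\<omega>. of_bool (ereal (\<tau> k j 0 \<omega>) \<le> t) * b powr \<tau> k j 0 \<omega>)"
proof -
  define T where "T = \<tau> k j 0"
  have T[measurable]: "T \<in> borel_measurable M" unfolding T_def by (rule arrival_measurable[OF kj])
  have T0: "0 \<le> T \<omega>" if "\<omega> \<in> space M" for \<omega> unfolding T_def using kj that by (rule arrival_nonneg)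
  interpret D: real_distribution "distr M borel T" by (rule real_distribution_distr) simp
  have "\<forall>\<^sub>F s in at_top. 1 / 2 < cdf (distr M borel T) s"
    using D.cdf_lim_at_top_prob by (rule order_tendstoD) simp
  then obtain s where s: "1 / 2 < cdf (distr M borel T) s"
    by (auto simp: eventually_at_top_linorder)
  have ps: "1 / 2 < \<P>(\<omega> in M. T \<omega> \<le> s)"
    using s by (simp add: cdf_def measure_distr vimage_def Int_def conj_commute)
  have le1: "b powr T \<omega> \<le> 1" if "\<omega> \<in> space M" for \<omega>
    using b T0[OF that] powr_mono'[of 0 "T \<omega>" b] by simp
  have int: "integrable M (\<lambda>\<omega>. of_bool (ereal (T \<omega>) \<le> t) * b powr T \<omega>)" for t
  proof (rule integrable_const_bound[of _ 1])
    show "AE \<omega> in M. norm (of_bool (ereal (T \<omega>) \<le> t) * b powr T \<omega>) \<le> 1"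
      using le1 by (intro AE_I2) (simp add: of_bool_def)
    show "(\<lambda>\<omega>. of_bool (ereal (T \<omega>) \<le> t) * b powr T \<omega>) \<in> borel_measurable M" by measurable
  qed
  have low: "b powr s * \<P>(\<omega> in M. ereal (T \<omega>) \<le> u) \<le> expectation (\<lambda>\<omega>. of_bool (ereal (T \<omega>) \<le> t) * b powr T \<omega>)"
    if u: "u \<le> t" "u \<le> ereal s" for u t
  proof -
    have "b powr s * \<P>(\<omega> in M. ereal (T \<omega>) \<le> u) = expectation (\<lambda>\<omega>. b powr s * indicator {\<omega> \<in> space M. ereal (T \<omega>) \<le> u} \<omega>)"
      by simp
    also have "\<dots> \<le> expectation (\<lambda>\<omega>. of_bool (ereal (T \<omega>) \<le> t) * b powr T \<omega>)"
    proof (rule integral_mono[OF _ int])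
      show "integrable M (\<lambda>\<omega>. b powr s * indicator {\<omega> \<in> space M. ereal (T \<omega>) \<le> u} \<omega>)"
        by (intro integrable_mult_right integrable_real_indicator) (auto simp: emeasure_eq_measure)
      fix \<omega> assume "\<omega> \<in> space M"
      show "b powr s * indicator {\<omega> \<in> space M. ereal (T \<omega>) \<le> u} \<omega> \<le> of_bool (ereal (T \<omega>) \<le> t) * b powr T \<omega>"
      proof (cases "ereal (T \<omega>) \<le> u")
        case True
        then have "ereal (T \<omega>) \<le> t" "ereal (T \<omega>) \<le> ereal s"
          by (rule order_trans[OF _ u(1)], rule order_trans[OF _ u(2)])
        moreover from this(2) have "b powr s \<le> b powr T \<omega>" using b by (intro powr_mono') auto
        ultimately show ?thesis using True by (simp add: indicator_def)
      qed simp
    qed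
    finally show ?thesis .
  qed
  show thesis
  proof (rule that[of "b powr s / 2"])
    show "0 < b powr s / 2" using b by simp
    fix t
    have "b powr s / 2 * \<P>(\<omega> in M. ereal (T \<omega>) \<le> t) \<le> expectation (\<lambda>\<omega>. of_bool (ereal (T \<omega>) \<le> t) * b powr T \<omega>)"
    proof (cases "t \<le> ereal s")
      case True
      have "b powr s / 2 * \<P>(\<omega> in M. ereal (T \<omega>) \<le> t) \<le> b powr s * \<P>(\<omega> in M. ereal (T \<omega>) \<le> t)"
        by (intro mult_right_mono) auto
      also have "\<dots> \<le> expectation (\<lambda>\<omega>. of_bool (ereal (T \<omega>) \<le> t) * b powr T \<omega>)"
        using True by (intro low) auto
      finally show ?thesis .
    next
      case False
      have "b powr s / 2 * \<P>(\<omega> in M. ereal (T \<omega>) \<le> t) \<le> b powr s / 2 * 1"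
        by (intro mult_left_mono) auto
      also have "\<dots> \<le> b powr s * \<P>(\<omega> in M. T \<omega> \<le> s)"
      proof -
        have "b powr s * (1 / 2) \<le> b powr s * \<P>(\<omega> in M. T \<omega> \<le> s)" using ps by (intro mult_left_mono) auto
        then show ?thesis by simp
      qed
      also have "\<dots> \<le> expectation (\<lambda>\<omega>. of_bool (ereal (T \<omega>) \<le> t) * b powr T \<omega>)"
        using low[of "ereal s" t] False by simp
      finally show ?thesis .
    qed
    then show "b powr s / 2 * prob (arrived k j 0 t)
      \<le> expectation (\<lambda>\<omega>. of_bool (ereal (\<tau> k j 0 \<omega>) \<le> t) * b powr \<tau> k j 0 \<omega>)"
      by (simp add: T_def)
  qed
qed

text \<open>Arrival times are nondecreasing, so the admissible indices form an initial segment and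
  its supremum counts the arrivals. For \<open>t \<ge> 0\<close> index \<open>0\<close> is always
  admissible.\<close>

lemma claim_count_eq:
  assumes kj: "k \<in> {1..d}" "j \<in> {1..r}" and w: "\<omega> \<in> space M" and t: "0 \<le> t"
  shows "claim_count \<theta> k j t \<omega> = (\<Sum>i. of_bool (ereal (\<tau> k j i \<omega>) \<le> t))"
proof (rule antisym)
  let ?S = "{m. ereal (arrival_time \<theta> k j m \<omega>) \<le> t}"
  let ?f = "\<lambda>i. of_bool (ereal (\<tau> k j i \<omega>) \<le> t) :: ennreal"
  show "claim_count \<theta> k j t \<omega> \<le> (\<Sum>i. ?f i)"
    unfolding claim_count_def
  proof (rule SUP_least)
    fix m assume m: "m \<in> ?S"
    have "?f i = 1" if "i < m" for i
    proof -
      have "ereal (\<tau> k j i \<omega>) \<le> ereal (arrival_time \<theta> k j m \<omega>)"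
        using that by (simp add: arrival_mono[OF kj w])
      moreover have "ereal (arrival_time \<theta> k j m \<omega>) \<le> t" using m by simp
      ultimately have "ereal (\<tau> k j i \<omega>) \<le> t" by (rule order_trans)
      then show ?thesis by simp
    qed
    then have "of_nat m = (\<Sum>i<m. ?f i)" by simp
    also have "\<dots> \<le> (\<Sum>i. ?f i)" by (rule sum_le_suminf) auto
    finally show "of_nat m \<le> (\<Sum>i. ?f i)" .
  qed
  have ex: "\<exists>m\<in>?S. (\<Sum>i<n. ?f i) \<le> of_nat m" for n
  proof (induction n)
    case 0
    have "0 \<in> ?S" using t by (simp add: arrival_time_def zero_ereal_def)
    then show ?case by (intro bexI[of _ 0]) auto
  next
    case (Suc n)
    show ?case
    proof (cases "Suc n \<in> ?S")
      case True
      have "(\<Sum>i<Suc n. ?f i) \<le> (\<Sum>i<Suc n. 1)" by (intro sum_mono) simp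
      then show ?thesis using True by (intro bexI[of _ "Suc n"]) auto
    qed (use Suc in simp)
  qed
  have "(\<Sum>i<n. ?f i) \<le> claim_count \<theta> k j t \<omega>" for n
  proof -
    from ex obtain m where "m \<in> ?S" "(\<Sum>i<n. ?f i) \<le> of_nat m" by blast
    then show ?thesis unfolding claim_count_def by (rule SUP_upper2)
  qed
  then show "(\<Sum>i. ?f i) \<le> claim_count \<theta> k j t \<omega>"
    by (intro suminf_le_const) auto
qed

lemma renewal_function_eq:
  assumes kj: "k \<in> {1..d}" "j \<in> {1..r}" and t: "0 \<le> t"
  shows "renewal_function M \<theta> k j t = (\<Sum>i. emeasure M (arrived k j i t))"
proof -
  note [measurable] = arrival_measurable[OF kj]
  have "renewal_function M \<theta> k j t = (\<integral>\<^sup>+\<omega>. (\<Sum>i. indicator (arrived k j i t) \<omega>) \<partial>M)"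
    unfolding renewal_function_def
    by (intro nn_integral_cong) (auto simp: claim_count_eq[OF kj _ t] indicator_def intro!: arg_cong[where f = suminf])
  also have "\<dots> = (\<Sum>i. \<integral>\<^sup>+\<omega>. indicator (arrived k j i t) \<omega> \<partial>M)"
    by (rule nn_integral_suminf) measurable
  also have "\<dots> = (\<Sum>i. emeasure M (arrived k j i t))"
    by (intro arg_cong[where f = suminf] ext nn_integral_indicator) measurable
  finally show ?thesis .
qed

text \<open>The first arrival is the earliest: if it almost surely misses \<open>t\<close>, so do
  all the others. This links membership in \<open>renewal_times\<close> to a positive error
  scale.\<close>

lemma renewal_function_pos_first_arrival:
  assumes kj: "k \<in> {1..d}" "j \<in> {1..r}" and t: "0 \<le> t" and pos: "0 < renewal_function M \<theta> k j t"
  shows "0 < prob (arrived k j 0 t)"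
proof (rule ccontr)
  assume "\<not> ?thesis"
  then have z: "prob (arrived k j 0 t) = 0" by (simp add: zero_less_measure_iff)
  note [measurable] = arrival_measurable[OF kj]
  have "emeasure M (arrived k j i t) = 0" for i
  proof -
    have "prob (arrived k j i t) \<le> prob (arrived k j 0 t)"
    proof (rule finite_measure_mono)
      show "arrived k j i t \<subseteq> (arrived k j 0 t)"
      proof safe
        fix \<omega> assume w: "\<omega> \<in> space M" and le: "ereal (\<tau> k j i \<omega>) \<le> t"
        have "ereal (\<tau> k j 0 \<omega>) \<le> ereal (\<tau> k j i \<omega>)"
          by (simp add: arrival_mono[OF kj w])
        then show "ereal (\<tau> k j 0 \<omega>) \<le> t" using le by (rule order_trans)
      qed
    qed measurable
    then have "prob (arrived k j i t) = 0" using z by (simp add: measure_le_0_iff)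
    then show ?thesis by (simp add: emeasure_eq_measure)
  qed
  then show False using pos by (simp add: renewal_function_eq[OF kj t])
qed

end

section \<open>The renewal integral\<close>

text \<open>The value of \<open>interval_measure\<close> on half-open intervals is available only
  for a nondecreasing right-continuous function. Both properties are inherited from
  \<open>N\<close>, and agreement on half-open intervals determines the measure.\<close>

lemma interval_measure_eqI:
  fixes F :: "real \<Rightarrow> real" and N :: "real measure"
  assumes sets: "sets N = sets borel" and F: "\<And>s. emeasure N {..s} = ennreal (F s)" "\<And>s. 0 \<le> F s"
  shows "interval_measure F = N"
proof -
  have meas: "measure N {..s} = F s" for s
    using F by (simp add: measure_def)
  have ev: "{..s} \<in> sets N" for s :: real by (simp add: sets)
  have mono: "F x \<le> F y" if "x \<le> y" for x y
  proof -
    have "emeasure N {..x} \<le> emeasure N {..y}" using that by (intro emeasure_mono ev) auto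
    then show ?thesis using F by (simp add: ennreal_le_iff)
  qed
  have rc: "continuous (at_right a) F" for a
    unfolding continuous_within
  proof (rule tendsto_at_right_sequentially[of a "a + 1"])
    fix S :: "nat \<Rightarrow> real" assume S: "\<And>n. a < S n" "decseq S" "S \<longlonglongrightarrow> a" and "\<And>n. S n < a + 1"
    have "(\<lambda>n. measure N {..S n}) \<longlonglongrightarrow> measure N (\<Inter>n. {..S n})"
      using S(2) F by (intro Lim_measure_decseq) (auto simp: sets decseq_def)
    also have "(\<Inter>n. {..S n}) = {..a}"
    proof (intro equalityI subsetI)
      fix x assume "x \<in> (\<Inter>n. {..S n})"
      then have "x \<le> a" by (intro LIMSEQ_le_const[OF S(3)]) auto
      then show "x \<in> {..a}" by simp
    next
      fix x assume "x \<in> {..a}"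
      then show "x \<in> (\<Inter>n. {..S n})" using S(1) by (auto intro: order_trans less_imp_le)
    qed
    finally show "(\<lambda>n. F (S n)) \<longlonglongrightarrow> F a" by (simp add: meas)
  qed simp
  have Ioc: "emeasure (interval_measure F) {a<..b} = emeasure N {a<..b}" for a b
  proof (cases "a \<le> b")
    case True
    have "{a<..b} = {..b} - {..a}" by auto
    then have "emeasure N {a<..b} = emeasure N {..b} - emeasure N {..a}"
      using True F ev by (simp add: emeasure_Diff)
    also have "\<dots> = ennreal (F b - F a)" using F by (simp add: ennreal_minus)
    finally show ?thesis
      using emeasure_interval_measure_Ioc[OF True mono rc] by simp
  qed simp
  define E where "E = range (\<lambda>(a, b). {a<..b::real})"
  have gen: "sets borel = sigma_sets UNIV E"
    unfolding E_def by (subst borel_sigma_sets_Ioc) (simp add: sets_measure_of_conv)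
  show ?thesis
  proof (rule measure_eqI_generator_eq[where \<Omega> = UNIV and E = E and A = "\<lambda>n. {- real n<..real n}"])
    show "Int_stable E"
    proof (rule Int_stableI)
      fix A B assume "A \<in> E" "B \<in> E"
      then obtain a b a' b' where "A = {a<..b}" "B = {a'<..b'}" by (auto simp: E_def)
      then have "A \<inter> B = {max a a'<..min b b'}" by auto
      then show "A \<inter> B \<in> E" by (auto simp: E_def)
    qed
    show "(\<Union>n. {- real n<..real n}) = UNIV"
    proof (intro equalityI subsetI UNIV_I)
      fix x :: real
      obtain n where "\<bar>x\<bar> < real n" using reals_Archimedean2 by blast
      then show "x \<in> (\<Union>n. {- real n<..real n})" by (intro UN_I[of n]) auto
    qed
    show "emeasure (interval_measure F) {- real n<..real n} \<noteq> \<infinity>" for n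
      by (subst emeasure_interval_measure_Ioc[OF _ mono rc]) auto
  qed (use Ioc in \<open>auto simp: E_def gen[unfolded E_def] sets\<close>)
qed

context renewal_model
begin

text \<open>The expected number of arrivals in a set, obtained by pushing forward the product of
  counting measure on the claim numbers and \<open>M\<close>. In this form integrals unfold by
  Fubini into series of expectations.\<close>

definition renewal_measure :: "nat \<Rightarrow> nat \<Rightarrow> real measure" where
  "renewal_measure k j = distr (count_space UNIV \<Otimes>\<^sub>M M) borel (\<lambda>p. arrival_time \<theta> k j (Suc (fst p)) (snd p))"

lemma nn_integral_renewal_measure:
  assumes kj: "k \<in> {1..d}" "j \<in> {1..r}" and f[measurable]: "f \<in> borel_measurable borel"
  shows "(\<integral>\<^sup>+s. f s \<partial>renewal_measure k j) = (\<Sum>i. \<integral>\<^sup>+\<omega>. f (\<tau> k j i \<omega>) \<partial>M)"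
proof -
  have T[measurable]: "(\<lambda>p. arrival_time \<theta> k j (Suc (fst p)) (snd p)) \<in> borel_measurable (count_space UNIV \<Otimes>\<^sub>M M)"
    by (rule measurable_pair_measure_countable1) (simp_all add: arrival_measurable[OF kj])
  have "(\<integral>\<^sup>+s. f s \<partial>renewal_measure k j) = (\<integral>\<^sup>+p. f (arrival_time \<theta> k j (Suc (fst p)) (snd p)) \<partial>(count_space UNIV \<Otimes>\<^sub>M M))"
    unfolding renewal_measure_def by (subst nn_integral_distr) auto
  also have "\<dots> = (\<integral>\<^sup>+i. \<integral>\<^sup>+\<omega>. f (\<tau> k j i \<omega>) \<partial>M \<partial>count_space UNIV)"
    by (subst nn_integral_fst[symmetric]) auto
  also have "\<dots> = (\<Sum>i. \<integral>\<^sup>+\<omega>. f (\<tau> k j i \<omega>) \<partial>M)"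
    by (rule nn_integral_count_space_nat)
  finally show ?thesis .
qed

lemma emeasure_renewal_measure_atMost:
  assumes kj: "k \<in> {1..d}" "j \<in> {1..r}"
  shows "emeasure (renewal_measure k j) {..s} = renewal_function M \<theta> k j (ereal s)"
proof -
  note [measurable] = arrival_measurable[OF kj]
  have "emeasure (renewal_measure k j) {..s} = (\<integral>\<^sup>+u. indicator {..s} u \<partial>renewal_measure k j)"
    by (rule nn_integral_indicator[symmetric]) (simp add: renewal_measure_def)
  also have "\<dots> = (\<Sum>i. \<integral>\<^sup>+\<omega>. indicator {..s} (\<tau> k j i \<omega>) \<partial>M)"
    by (rule nn_integral_renewal_measure[OF kj]) simp
  also have "\<dots> = (\<Sum>i. \<integral>\<^sup>+\<omega>. indicator (arrived k j i (ereal s)) \<omega> \<partial>M)"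
    by (intro arg_cong[where f = suminf] ext nn_integral_cong) (auto simp: indicator_def)
  also have "\<dots> = (\<Sum>i. emeasure M (arrived k j i (ereal s)))"
    by (intro arg_cong[where f = suminf] ext nn_integral_indicator) measurable
  also have "\<dots> = renewal_function M \<theta> k j (ereal s)"
  proof (cases "0 \<le> s")
    case True
    then show ?thesis by (subst renewal_function_eq[OF kj]) auto
  next
    case False
    have neg: "\<not> arrival_time \<theta> k j i \<omega> \<le> s" if "\<omega> \<in> space M" for i \<omega>
      using arrival_nonneg[OF kj that, of i] False by linarith
    then have "arrived k j i (ereal s) = {}" for i by auto
    then have "(\<Sum>i. emeasure M (arrived k j i (ereal s))) = 0"
      by (simp only: emeasure_empty suminf_zero)
    moreover have "renewal_function M \<theta> k j (ereal s) = (\<integral>\<^sup>+\<omega>. 0 \<partial>M)"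
      unfolding renewal_function_def claim_count_def
      using neg by (intro nn_integral_cong) (simp add: bot_ennreal)
    ultimately show ?thesis by (simp only: nn_integral_const mult_zero_left)
  qed
  finally show ?thesis .
qed

text \<open>A Chernoff bound: on \<open>\<tau> \<le> s\<close> one has
  \<open>1 \<le> b powr (- s) * b powr \<tau>\<close>, and the moments on the right decay
  geometrically. Any \<open>b\<close> strictly between \<open>0\<close> and \<open>1\<close> would
  do; \<open>1 / 2\<close> is chosen.\<close>

lemma renewal_function_finite:
  assumes kj: "k \<in> {1..d}" "j \<in> {1..r}"
  shows "renewal_function M \<theta> k j (ereal s) < \<top>"
proof (cases "0 \<le> s")
  case True
  note [measurable] = arrival_measurable[OF kj]
  define b :: real where "b = 1 / 2"
  have b: "0 < b" "b < 1" by (simp_all add: b_def)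
  define \<rho> where "\<rho> = waiting_moment b k j"
  have \<rho>: "0 \<le> \<rho>" "\<rho> < 1" unfolding \<rho>_def by (rule inter_arrival_moment[OF kj b])+
  have bd: "emeasure M (arrived k j i (ereal s)) \<le> ennreal (b powr (- s) * \<rho> ^ i)" for i
  proof -
    have "emeasure M (arrived k j i (ereal s))
        = (\<integral>\<^sup>+\<omega>. indicator (arrived k j i (ereal s)) \<omega> \<partial>M)"
      by (rule nn_integral_indicator[symmetric]) measurable
    also have "\<dots> \<le> (\<integral>\<^sup>+\<omega>. ennreal (b powr (- s)) * (of_bool (ereal (\<tau> k j i \<omega>) \<le> ereal s) * ennreal (b powr \<tau> k j i \<omega>)) \<partial>M)"
    proof (rule nn_integral_mono)
      fix \<omega>
      let ?T = "\<tau> k j i \<omega>"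
      show "indicator (arrived k j i (ereal s)) \<omega>
          \<le> ennreal (b powr (- s)) * (of_bool (ereal ?T \<le> ereal s) * ennreal (b powr ?T))"
      proof (cases "?T \<le> s")
        case True
        have "b powr 0 \<le> b powr (- s + ?T)" using b True by (intro powr_mono') auto
        moreover have "b powr (- s + ?T) = b powr (- s) * b powr ?T" by (rule powr_add)
        ultimately have "1 \<le> b powr (- s) * b powr ?T" using b by simp
        then have "ennreal 1 \<le> ennreal (b powr (- s) * b powr ?T)" by (rule ennreal_leI)
        then show ?thesis using True by (simp add: ennreal_mult indicator_def)
      qed simp
    qed
    also have "\<dots> = ennreal (b powr (- s)) * (\<integral>\<^sup>+\<omega>. of_bool (ereal (\<tau> k j i \<omega>) \<le> ereal s) * ennreal (b powr \<tau> k j i \<omega>) \<partial>M)"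
      by (rule nn_integral_cmult) measurable
    also have "\<dots> \<le> ennreal (b powr (- s)) * ennreal (\<rho> ^ i * prob (arrived k j 0 (ereal s)))"
      unfolding \<rho>_def by (intro mult_left_mono arrival_moment_bound[OF kj b]) auto
    also have "\<dots> \<le> ennreal (b powr (- s)) * ennreal (\<rho> ^ i)"
      using \<rho> by (intro mult_left_mono ennreal_leI mult_left_le) auto
    finally show ?thesis using \<rho> by (simp add: ennreal_mult)
  qed
  have "renewal_function M \<theta> k j (ereal s) \<le> (\<Sum>i. ennreal (b powr (- s) * \<rho> ^ i))"
  proof (subst renewal_function_eq[OF kj])
    show "(\<Sum>i. emeasure M (arrived k j i (ereal s))) \<le> (\<Sum>i. ennreal (b powr (- s) * \<rho> ^ i))"
      by (rule suminf_le[OF bd]) simp_all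
  qed (use True in simp)
  also have "\<dots> = ennreal (\<Sum>i. b powr (- s) * \<rho> ^ i)"
    using \<rho> by (intro suminf_ennreal2 summable_mult summable_geometric) auto
  also have "\<dots> < \<top>" by simp
  finally show ?thesis .
next
  case False
  have "renewal_function M \<theta> k j (ereal s) = (\<integral>\<^sup>+\<omega>. 0 \<partial>M)"
    unfolding renewal_function_def claim_count_def
  proof (intro nn_integral_cong)
    fix \<omega> assume "\<omega> \<in> space M"
    then have "\<not> arrival_time \<theta> k j i \<omega> \<le> s" for i
      using arrival_nonneg[OF kj, of \<omega> i] False by linarith
    then show "(SUP m\<in>{m. ereal (arrival_time \<theta> k j m \<omega>) \<le> ereal s}. of_nat m) = (0 :: ennreal)"
      by (simp add: bot_ennreal)
  qed
  then show ?thesis by simp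
qed

lemma interval_measure_renewal_function:
  assumes kj: "k \<in> {1..d}" "j \<in> {1..r}"
  shows "interval_measure (\<lambda>s. enn2real (renewal_function M \<theta> k j (ereal s))) = renewal_measure k j"
proof (rule interval_measure_eqI)
  show "emeasure (renewal_measure k j) {..s} = ennreal (enn2real (renewal_function M \<theta> k j (ereal s)))" for s
    using renewal_function_finite[OF kj] by (simp add: emeasure_renewal_measure_atMost[OF kj])
qed (simp_all add: renewal_measure_def)

text \<open>A divergent Bochner integral and \<open>enn2real\<close> of infinity are both
  \<open>0\<close>, so the identity presupposes no convergence.\<close>

lemma renewal_integral_eq:
  assumes kj: "k \<in> {1..d}" "j \<in> {1..r}" and f[measurable]: "f \<in> borel_measurable borel" and nonneg: "\<And>s. 0 \<le> f s"
  shows "renewal_integral M \<theta> k j f t =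
    enn2real (\<Sum>i. \<integral>\<^sup>+\<omega>. of_bool (ereal (\<tau> k j i \<omega>) \<le> t) * ennreal (f (\<tau> k j i \<omega>)) \<partial>M)"
proof -
  have "renewal_integral M \<theta> k j f t = (LINT s|renewal_measure k j. indicator {s. 0 \<le> s \<and> ereal s \<le> t} s * f s)"
    unfolding renewal_integral_def interval_measure_renewal_function[OF kj] set_lebesgue_integral_def by simp
  also have "\<dots> = enn2real (\<integral>\<^sup>+s. ennreal (indicator {s. 0 \<le> s \<and> ereal s \<le> t} s * f s) \<partial>renewal_measure k j)"
    using nonneg by (intro integral_eq_nn_integral) (auto simp: renewal_measure_def)
  also have "(\<integral>\<^sup>+s. ennreal (indicator {s. 0 \<le> s \<and> ereal s \<le> t} s * f s) \<partial>renewal_measure k j)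
      = (\<Sum>i. \<integral>\<^sup>+\<omega>. ennreal (indicator {s. 0 \<le> s \<and> ereal s \<le> t} (\<tau> k j i \<omega>) * f (\<tau> k j i \<omega>)) \<partial>M)"
    by (rule nn_integral_renewal_measure[OF kj]) measurable
  also have "\<dots> = (\<Sum>i. \<integral>\<^sup>+\<omega>. of_bool (ereal (\<tau> k j i \<omega>) \<le> t) * ennreal (f (\<tau> k j i \<omega>)) \<partial>M)"
    by (intro arg_cong[where f = suminf] ext nn_integral_cong) (auto simp: indicator_def arrival_nonneg[OF kj])
  finally show ?thesis .
qed

section \<open>Discount weights of the claims and the premium integral\<close>

definition weight :: "nat \<times> nat \<Rightarrow> nat \<Rightarrow> ereal \<Rightarrow> 'a \<Rightarrow> real" where
  "weight a i t \<omega> = of_bool (ereal (\<tau> (fst a) (snd a) i \<omega>) \<le> t)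
     * exp (- R (\<tau> (fst a) (snd a) i \<omega>) \<omega>)"

abbreviation mean_weight :: "real \<Rightarrow> nat \<times> nat \<Rightarrow> nat \<Rightarrow> ereal \<Rightarrow> real" where
  "mean_weight p a i t \<equiv> expectation (\<lambda>\<omega>. weight a i t \<omega> powr p)"

lemma weight_nonneg: "0 \<le> weight a i t \<omega>"
  by (simp add: weight_def)

text \<open>The return path is evaluated at a random time, which calls for joint measurability of
  the process; clamping at \<open>0\<close> changes nothing because arrival times are
  nonnegative.\<close>

lemma weight_measurable:
  assumes kj: "k \<in> {1..d}" "j \<in> {1..r}"
  shows "weight (k, j) i t \<in> borel_measurable weight_algebra"
proof -
  have T[measurable]: "\<tau> k j i \<in> borel_measurable weight_algebra"
    using kj by (intro measurable_from_subalg[OF component_subalgebra_weight[of "Inter_Arrivals k"] arrival_measurable_component]) auto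
  have id[measurable]: "(\<lambda>\<omega>. \<omega>) \<in> measurable weight_algebra (component_algebra Returns)"
    using component_subalgebra_weight[of Returns] by (auto simp: subalgebra_def measurable_def)
  have [measurable]: "(\<lambda>q. R (max 0 (fst q)) (snd q)) \<in> borel_measurable (borel \<Otimes>\<^sub>M component_algebra Returns)"
    using returns_measurable levy_right_continuous[OF levy]
    by (intro borel_measurable_right_continuous_process) (auto simp: space_component_algebra)
  have "(\<lambda>\<omega>. (\<tau> k j i \<omega>, \<omega>)) \<in> measurable weight_algebra (borel \<Otimes>\<^sub>M component_algebra Returns)"
    by measurable
  from measurable_compose[OF this \<open>(\<lambda>q. R (max 0 (fst q)) (snd q)) \<in> _\<close>]
  have [measurable]: "(\<lambda>\<omega>. R (max 0 (\<tau> k j i \<omega>)) \<omega>) \<in> borel_measurable weight_algebra" by simp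
  have "(\<lambda>\<omega>. of_bool (ereal (\<tau> k j i \<omega>) \<le> t) * exp (- R (max 0 (\<tau> k j i \<omega>)) \<omega>)) \<in> borel_measurable weight_algebra"
    by measurable
  then show ?thesis
    by (rule measurable_cong[THEN iffD1, rotated])
      (simp add: weight_def space_weight_algebra max_absorb2[OF arrival_nonneg[OF kj]])
qed

text \<open>Since \<open>0 powr p = 0\<close>, a power of the weight is the same indicator times
  \<open>exp (- p * R \<tau>)\<close>. Arrivals are independent of the returns, so the exponential
  moment can be taken at a fixed time.\<close>

lemma weight_moment:
  assumes kj: "k \<in> {1..d}" "j \<in> {1..r}" and int: "integrable M (\<lambda>\<omega>. exp (- p * R 1 \<omega>))" and p: "0 < p"
  shows "(\<integral>\<^sup>+\<omega>. ennreal (weight (k, j) i t \<omega> powr p) \<partial>M) =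
    (\<integral>\<^sup>+\<omega>. of_bool (ereal (\<tau> k j i \<omega>) \<le> t) *
      ennreal (laplace R p powr \<tau> k j i \<omega>) \<partial>M)"
proof -
  have "(\<integral>\<^sup>+\<omega>. ennreal (weight (k, j) i t \<omega> powr p) \<partial>M) =
    (\<integral>\<^sup>+\<omega>. indicator {s. ereal s \<le> t} (\<tau> k j i \<omega>) *
      ennreal (exp (- p * R (\<tau> k j i \<omega>) \<omega>)) \<partial>M)"
    by (intro nn_integral_cong) (simp add: weight_def powr_def indicator_def)
  also have "\<dots> = (\<integral>\<^sup>+\<omega>. indicator {s. ereal s \<le> t} (\<tau> k j i \<omega>) *
      ennreal (laplace R p powr \<tau> k j i \<omega>) \<partial>M)"
  proof (rule levy_exp_moment_indep_time[OF levy int subalgebra_component[of Returns] returns_measurable arrival_measurable[OF kj] arrival_returns_indep[OF kj(1) arrival_measurable_component[OF kj]] arrival_nonneg[OF kj]])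
    show "(indicator {s. ereal s \<le> t} :: real \<Rightarrow> ennreal) \<in> borel_measurable borel" by measurable
  qed simp_all
  also have "\<dots> = (\<integral>\<^sup>+\<omega>. of_bool (ereal (\<tau> k j i \<omega>) \<le> t) *
      ennreal (laplace R p powr \<tau> k j i \<omega>) \<partial>M)"
    by (intro nn_integral_cong) (simp add: indicator_def)
  finally show ?thesis .
qed

lemma weight_moment_bound:
  assumes kj: "k \<in> {1..d}" "j \<in> {1..r}" and int: "integrable M (\<lambda>\<omega>. exp (- p * R 1 \<omega>))" and p: "0 < p"
    and b: "laplace R p = b" "b < 1"
  shows "integrable M (\<lambda>\<omega>. weight (k, j) i t \<omega> powr p)"
    and "mean_weight p (k, j) i t \<le>
      waiting_moment b k j ^ i * prob (arrived k j 0 t)"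
proof -
  have b0: "0 < b" unfolding b(1)[symmetric] by (rule expectation_greater[OF int]) simp
  have [measurable]: "weight (k, j) i t \<in> borel_measurable M"
    by (rule measurable_from_subalg[OF subalgebra_weight weight_measurable[OF kj]])
  have \<rho>: "0 \<le> waiting_moment b k j" by (rule inter_arrival_moment(2)[OF kj b0 b(2)])
  have le: "(\<integral>\<^sup>+\<omega>. ennreal (weight (k, j) i t \<omega> powr p) \<partial>M) \<le>
      ennreal (waiting_moment b k j ^ i * prob (arrived k j 0 t))"
    unfolding weight_moment[OF kj int p] b(1) by (rule arrival_moment_bound[OF kj b0 b(2)])
  show int': "integrable M (\<lambda>\<omega>. weight (k, j) i t \<omega> powr p)"
    by (rule integrableI_bounded) (use le in \<open>auto intro: le_less_trans\<close>)
  have "ennreal (mean_weight p (k, j) i t) = (\<integral>\<^sup>+\<omega>. ennreal (weight (k, j) i t \<omega> powr p) \<partial>M)"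
    by (rule nn_integral_eq_integral[OF int', symmetric]) simp
  then have le': "ennreal (mean_weight p (k, j) i t) \<le>
      ennreal (waiting_moment b k j ^ i * prob (arrived k j 0 t))"
    using le by (simp only:)
  have "0 \<le> waiting_moment b k j ^ i * prob (arrived k j 0 t)"
    using \<rho> by (intro mult_nonneg_nonneg zero_le_power measure_nonneg)
  then show "mean_weight p (k, j) i t \<le>
      waiting_moment b k j ^ i * prob (arrived k j 0 t)"
    using le' by (rule ennreal_le_iff[THEN iffD1])
qed

lemma discount_integral_measurable: "discount_integral R t \<in> borel_measurable weight_algebra"
proof -
  have sub: "subalgebra weight_algebra (component_algebra Returns)"
    by (rule component_subalgebra_weight) simp
  have [measurable]: "(\<lambda>q. R (max 0 (fst q)) (snd q)) \<in> borel_measurable (borel \<Otimes>\<^sub>M component_algebra Returns)"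
    using returns_measurable levy_right_continuous[OF levy]
    by (intro borel_measurable_right_continuous_process) (auto simp: space_component_algebra)
  have swap: "(\<lambda>q. (snd q, fst q)) \<in> measurable (component_algebra Returns \<Otimes>\<^sub>M lborel) (borel \<Otimes>\<^sub>M component_algebra Returns)"
    by measurable
  have [measurable]: "(\<lambda>q. R (max 0 (snd q)) (fst q)) \<in> borel_measurable (component_algebra Returns \<Otimes>\<^sub>M lborel)"
    using measurable_compose[OF swap \<open>(\<lambda>q. R (max 0 (fst q)) (snd q)) \<in> _\<close>] by simp
  have "(\<lambda>\<omega>. \<integral>\<^sup>+s. ennreal (exp (- R (max 0 s) \<omega>)) * indicator {s. 0 \<le> s \<and> ereal s \<le> t} s \<partial>lborel) \<in> borel_measurable (component_algebra Returns)"
  proof (rule lborel.borel_measurable_nn_integral)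
    have "(\<lambda>q. ennreal (exp (- R (max 0 (snd q)) (fst q))) * indicator {s. 0 \<le> s \<and> ereal s \<le> t} (snd q)) \<in> borel_measurable (component_algebra Returns \<Otimes>\<^sub>M lborel)"
      by measurable
    then show "(\<lambda>(\<omega>, s). ennreal (exp (- R (max 0 s) \<omega>)) * indicator {s. 0 \<le> s \<and> ereal s \<le> t} s) \<in> borel_measurable (component_algebra Returns \<Otimes>\<^sub>M lborel)"
      by (simp add: case_prod_unfold)
  qed
  moreover have "discount_integral R t \<omega> = (\<integral>\<^sup>+s. ennreal (exp (- R (max 0 s) \<omega>)) * indicator {s. 0 \<le> s \<and> ereal s \<le> t} s \<partial>lborel)" for \<omega>
    unfolding discount_integral_def by (intro nn_integral_cong) (auto simp: indicator_def max_def)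
  ultimately have "(\<lambda>\<omega>. discount_integral R t \<omega>) \<in> borel_measurable (component_algebra Returns)" by (simp only:)
  then show ?thesis by (rule measurable_from_subalg[OF sub])
qed

end

section \<open>The main theorem\<close>

context renewal_model
begin

section \<open>Total claims and net loss in terms of the weights\<close>

lemma total_discounted_claims_eq:
  "total_discounted_claims d r X \<theta> R t \<omega> =
    (\<Sum>a\<in>{1..d} \<times> {1..r}. \<Sum>i. ennreal (X (fst a) (snd a) (Suc i) \<omega> * weight a i t \<omega>))"
  unfolding total_discounted_claims_def discounted_claims_def Let_def weight_def
  by (simp add: sum.cartesian_product' mult.assoc mult.commute[of "exp _"])

lemma net_loss_le:
  "net_loss d r X \<theta> R c t \<omega> \<le> enn2ereal (total_discounted_claims d r X \<theta> R t \<omega>)"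
proof -
  have "line_net_loss r X \<theta> R c k t \<omega> \<le> enn2ereal (\<Sum>j=1..r. discounted_claims X \<theta> R k j t \<omega>)" if k: "k \<in> {1..d}" for k
  proof -
    have "0 \<le> ereal (c k) * enn2ereal (discount_integral R t \<omega>)"
      using premium_pos[OF k] by (intro ereal_0_le_mult) auto
    moreover have "u - v \<le> u" if "0 \<le> v" for u v :: ereal
      using that by (cases u; cases v) auto
    ultimately show ?thesis unfolding line_net_loss_def by blast
  qed
  then have "net_loss d r X \<theta> R c t \<omega> \<le> (\<Sum>k=1..d. enn2ereal (\<Sum>j=1..r. discounted_claims X \<theta> R k j t \<omega>))"
    unfolding net_loss_def by (intro sum_mono) auto
  also have "\<dots> = enn2ereal (total_discounted_claims d r X \<theta> R t \<omega>)"
    unfolding total_discounted_claims_def by (rule sum_enn2ereal) simp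
  finally show ?thesis .
qed

text \<open>Premiums up to \<open>t\<close> are dominated by premiums over the whole half-line, at
  most \<open>y\<close> here, so one claim above \<open>x + y\<close> outweighs them while all other
  claims are nonnegative. Finite premiums also rule out a difference of infinities in
  \<open>ereal\<close>.\<close>

lemma net_loss_gt:
  assumes k: "k0 \<in> {1..d}" "j0 \<in> {1..r}" and x: "0 < x" and y: "0 < y"
    and claim: "X k0 j0 (Suc i) \<omega> * weight (k0, j0) i t \<omega> > x + y"
    and disc: "ennreal (\<Sum>k=1..d. c k) * discount_integral R \<infinity> \<omega> \<le> ennreal y"
  shows "net_loss d r X \<theta> R c t \<omega> > ereal x"
proof -
  define S where "S k = (\<Sum>j=1..r. discounted_claims X \<theta> R k j t \<omega>)" for k
  define C where "C = (\<Sum>k=1..d. c k)"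
  have C: "0 < C" unfolding C_def using premium_pos d_ge_1 by (intro sum_pos) auto
  have le: "discount_integral R t \<omega> \<le> discount_integral R \<infinity> \<omega>"
    unfolding discount_integral_def by (intro nn_integral_mono) (auto simp: indicator_def)
  have "discount_integral R \<infinity> \<omega> \<noteq> \<top>"
    using disc C unfolding C_def[symmetric] by (auto simp: ennreal_mult_top top_unique)
  then have "discount_integral R t \<omega> \<noteq> \<top>" using le by (auto simp: top_unique)
  then obtain u where u: "0 \<le> u" "discount_integral R t \<omega> = ennreal u"
    by (cases "discount_integral R t \<omega>") auto
  have Cu: "C * u \<le> y"
  proof -
    have "ennreal (C * u) = ennreal C * discount_integral R t \<omega>" using C u by (simp add: ennreal_mult)
    also have "\<dots> \<le> ennreal C * discount_integral R \<infinity> \<omega>" using le by (rule mult_left_mono) simp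
    also have "\<dots> \<le> ennreal y" using disc by (simp add: C_def)
    finally show ?thesis using y by (simp add: ennreal_le_iff)
  qed
  have line: "line_net_loss r X \<theta> R c k t \<omega> = enn2ereal (S k) - ereal (c k * u)" for k
    unfolding line_net_loss_def S_def using u by simp
  show ?thesis
  \<comment> \<open>A line with infinite claims makes the whole loss infinite, as its premium is
    finite and no line can contribute minus infinity. Otherwise everything is real.\<close>
  proof (cases "\<exists>k\<in>{1..d}. S k = \<top>")
    case True
    then obtain k where "k \<in> {1..d}" "S k = \<top>" by blast
    then have "k \<in> {1..d} \<and> line_net_loss r X \<theta> R c k t \<omega> = \<infinity>" by (simp add: line)
    then have "net_loss d r X \<theta> R c t \<omega> = \<infinity>"
      unfolding net_loss_def by (subst sum_Pinfty) auto
    then show ?thesis by simp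
  next
    case False
    define s where "s k = enn2real (S k)" for k
    have S: "S k = ennreal (s k)" if "k \<in> {1..d}" for k
      using False that by (simp add: s_def less_top)
    have s0: "0 \<le> s k" for k by (simp add: s_def)
    have "net_loss d r X \<theta> R c t \<omega> = (\<Sum>k=1..d. ereal (s k - c k * u))"
      unfolding net_loss_def using S s0 by (intro sum.cong) (auto simp: line)
    also have "\<dots> = ereal ((\<Sum>k=1..d. s k) - C * u)"
      by (simp add: C_def sum_subtractf sum_distrib_right)
    finally have net: "net_loss d r X \<theta> R c t \<omega> = ereal ((\<Sum>k=1..d. s k) - C * u)" .
    have "ennreal (X k0 j0 (Suc i) \<omega> * weight (k0, j0) i t \<omega>) \<le> ennreal (s k0)"
    proof -
      have "ennreal (X k0 j0 (Suc i) \<omega> * weight (k0, j0) i t \<omega>) \<le> (\<Sum>n. ennreal (X k0 j0 (Suc n) \<omega> * weight (k0, j0) n t \<omega>))"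
        using sum_le_suminf[of "\<lambda>n. ennreal (X k0 j0 (Suc n) \<omega> * weight (k0, j0) n t \<omega>)" "{i}"] by simp
      also have "\<dots> = discounted_claims X \<theta> R k0 j0 t \<omega>"
        unfolding discounted_claims_def Let_def weight_def by (simp add: ac_simps)
      also have "\<dots> \<le> S k0"
        unfolding S_def using k by (intro member_le_sum[of j0 _ "\<lambda>j. discounted_claims X \<theta> R k0 j t \<omega>"]) auto
      finally show ?thesis using S[OF k(1)] by simp
    qed
    then have "X k0 j0 (Suc i) \<omega> * weight (k0, j0) i t \<omega> \<le> s k0"
      using s0 by (simp add: ennreal_le_iff)
    also have "\<dots> \<le> (\<Sum>k=1..d. s k)"
      using k s0 by (intro member_le_sum) auto
    finally show ?thesis using claim Cu by (simp add: net)
  qed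
qed

lemma net_loss_measurable: "net_loss d r X \<theta> R c t \<in> borel_measurable M"
proof -
  have [measurable]: "discounted_claims X \<theta> R k j t \<in> borel_measurable M" if "k \<in> {1..d}" "j \<in> {1..r}" for k j
  proof -
    have "(\<lambda>\<omega>. ennreal (X k j (Suc i) \<omega> * weight (k, j) i t \<omega>)) \<in> borel_measurable M" for i
    proof -
      have [measurable]: "X k j (Suc i) \<in> borel_measurable M" using that by (intro claim_rv) auto
      have [measurable]: "weight (k, j) i t \<in> borel_measurable M"
        by (rule measurable_from_subalg[OF subalgebra_weight weight_measurable[OF that]])
      show ?thesis by measurable
    qed
    then have "(\<lambda>\<omega>. \<Sum>i. ennreal (X k j (Suc i) \<omega> * weight (k, j) i t \<omega>)) \<in> borel_measurable M"
      by measurable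
    moreover have "(\<Sum>i. ennreal (X k j (Suc i) \<omega> * weight (k, j) i t \<omega>)) = discounted_claims X \<theta> R k j t \<omega>" for \<omega>
      unfolding discounted_claims_def Let_def weight_def by (simp add: ac_simps)
    ultimately show ?thesis by simp
  qed
  have [measurable]: "discount_integral R t \<in> borel_measurable M"
    by (rule measurable_from_subalg[OF subalgebra_weight discount_integral_measurable])
  have "(\<lambda>\<omega>. \<Sum>k=1..d. enn2ereal (\<Sum>j=1..r. discounted_claims X \<theta> R k j t \<omega>) - ereal (c k) * enn2ereal (discount_integral R t \<omega>)) \<in> borel_measurable M"
    by measurable
  moreover have "net_loss d r X \<theta> R c t = (\<lambda>\<omega>. \<Sum>k=1..d. enn2ereal (\<Sum>j=1..r. discounted_claims X \<theta> R k j t \<omega>) - ereal (c k) * enn2ereal (discount_integral R t \<omega>))"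
    by (rule ext) (simp add: net_loss_def line_net_loss_def)
  ultimately show ?thesis by (simp only:)
qed

lemma claim_tail:
  assumes "k \<in> {1..d}" "j \<in> {1..r}" "i \<ge> 1"
  shows "\<P>(\<omega> in M. X k j i \<omega> > u) = tail (F k j) u"
  using tail_cdf_distr[OF claim_rv[OF assms]] claim_cdf[OF assms] by simp

text \<open>With \<open>exp (s * ln b) = b powr s\<close> the integral is the series of weight
  moments, term by term. Summability ensures that \<open>enn2real\<close> returns the sum and not
  its default value \<open>0\<close>.\<close>

lemma renewal_integral_weights:
  assumes kj: "k \<in> {1..d}" "j \<in> {1..r}" and int: "integrable M (\<lambda>\<omega>. exp (- p * R 1 \<omega>))" and p: "0 < p"
    and b: "laplace R p = b" "b < 1"
    and sum: "summable (\<lambda>i. mean_weight p (k, j) i t)"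
  shows "renewal_integral M \<theta> k j (\<lambda>s. exp (s * ln b)) t = (\<Sum>i. mean_weight p (k, j) i t)"
proof -
  have b0: "0 < b" unfolding b(1)[symmetric] by (rule expectation_greater[OF int]) simp
  have "renewal_integral M \<theta> k j (\<lambda>s. exp (s * ln b)) t =
      enn2real (\<Sum>i. \<integral>\<^sup>+\<omega>. of_bool (ereal (\<tau> k j i \<omega>) \<le> t) * ennreal (exp (\<tau> k j i \<omega> * ln b)) \<partial>M)"
    by (rule renewal_integral_eq[OF kj]) auto
  also have "(\<lambda>i. \<integral>\<^sup>+\<omega>. of_bool (ereal (\<tau> k j i \<omega>) \<le> t) * ennreal (exp (\<tau> k j i \<omega> * ln b)) \<partial>M)
      = (\<lambda>i. ennreal (mean_weight p (k, j) i t))"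
  proof
    fix i
    have "(\<integral>\<^sup>+\<omega>. of_bool (ereal (\<tau> k j i \<omega>) \<le> t) * ennreal (exp (\<tau> k j i \<omega> * ln b)) \<partial>M)
        = (\<integral>\<^sup>+\<omega>. ennreal (weight (k, j) i t \<omega> powr p) \<partial>M)"
      unfolding weight_moment[OF kj int p] b(1) using b0 by (simp add: powr_def)
    also have "\<dots> = ennreal (mean_weight p (k, j) i t)"
      by (rule nn_integral_eq_integral[OF weight_moment_bound(1)[OF kj int p b]]) simp
    finally show "(\<integral>\<^sup>+\<omega>. of_bool (ereal (\<tau> k j i \<omega>) \<le> t) * ennreal (exp (\<tau> k j i \<omega> * ln b)) \<partial>M)
        = ennreal (mean_weight p (k, j) i t)" .
  qed
  also have "(\<Sum>i. ennreal (mean_weight p (k, j) i t)) = ennreal (\<Sum>i. mean_weight p (k, j) i t)"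
    by (rule suminf_ennreal2[OF _ sum]) simp
  also have "enn2real \<dots> = (\<Sum>i. mean_weight p (k, j) i t)"
    using suminf_nonneg[OF sum] by simp
  finally show ?thesis .
qed

text \<open>The lower exponent may be any number strictly between \<open>0\<close> and \<alpha>;
  \<open>\<alpha> / 2\<close> is taken. The constant \<open>2\<close> arises because each of the two
  moments is at most \<open>q ^ i\<close> times the probability of a first arrival.\<close>

lemma weighted_claims_renewal:
  assumes \<alpha>: "0 < \<alpha>" "\<alpha> < \<alpha>'"
    and RV: "\<And>k j. \<lbrakk>k \<in> {1..d}; j \<in> {1..r}\<rbrakk> \<Longrightarrow> regularly_varying (- \<alpha>) (tail (F k j))"
    and comparable: "\<And>k j k' j'. \<lbrakk>k \<in> {1..d}; j \<in> {1..r}; k' \<in> {1..d}; j' \<in> {1..r}\<rbrakk> \<Longrightarrow>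
      tail (F k j) \<in> \<Theta>[at_top](tail (F k' j'))"
    and int: "integrable M (\<lambda>\<omega>. exp (- \<alpha>' * R 1 \<omega>))" and lt1: "laplace R \<alpha>' < 1"
  obtains q where "weighted_claims M ({1..d} \<times> {1..r}) (\<lambda>a i. X (fst a) (snd a) (Suc i))
    (\<lambda>a. tail (F (fst a) (snd a))) weight_algebra weight
    (\<lambda>a t. prob (arrived (fst a) (snd a) 0 t)) UNIV (\<alpha> / 2) \<alpha> \<alpha>' q 2"
proof -
  let ?A = "{1..d} \<times> {1..r}"
  have R1: "R 1 \<in> borel_measurable M" by (rule levy_rv[OF levy]) simp
  have \<alpha>1: "0 < \<alpha> / 2" "\<alpha> / 2 \<le> \<alpha>'" "0 < \<alpha>'" using \<alpha> by auto
  define b1 where "b1 = laplace R (\<alpha> / 2)"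
  define b2 where "b2 = laplace R \<alpha>'"
  note int1 = exp_moment_smaller_exponent(1)[OF R1 int lt1 \<alpha>1(1,2)]
  have b1: "0 < b1" "b1 < 1"
    unfolding b1_def by (rule expectation_greater[OF int1], simp)
      (rule exp_moment_smaller_exponent(2)[OF R1 int lt1 \<alpha>1(1,2)])
  have b2: "0 < b2" "b2 < 1"
    unfolding b2_def by (rule expectation_greater[OF int], simp) (rule lt1)
  define \<rho> where "\<rho> b a = waiting_moment b (fst a) (snd a)" for b and a :: "nat \<times> nat"
  have \<rho>: "0 \<le> \<rho> b a" "\<rho> b a < 1" if "a \<in> ?A" "0 < b" "b < 1" for a b
    unfolding \<rho>_def using inter_arrival_moment[of "fst a" "snd a" b] that by auto
  have finA: "finite ?A" and neA: "?A \<noteq> {}" using d_ge_1 r_ge_1 by auto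
  \<comment> \<open>The worst ratio over the finitely many types and both exponents; each candidate
    is below \<open>1\<close>, hence so is the maximum.\<close>
  define q where "q = Max ((\<lambda>a. max (\<rho> b1 a) (\<rho> b2 a)) ` ?A)"
  have q1: "q < 1" unfolding q_def using finA neA \<rho> b1 b2 by (subst Max_less_iff) auto
  have qge: "\<rho> b1 a \<le> q" "\<rho> b2 a \<le> q" if "a \<in> ?A" for a
  proof -
    have "max (\<rho> b1 a) (\<rho> b2 a) \<le> q" unfolding q_def using finA that by (intro Max_ge) auto
    then show "\<rho> b1 a \<le> q" "\<rho> b2 a \<le> q" by simp_all
  qed
  have q0: "0 \<le> q" using neA qge(1) \<rho>(1)[OF _ b1] by (meson all_not_in_conv order_trans)
  let ?L = "\<lambda>a t. prob (arrived (fst a) (snd a) 0 t)"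
  have pos: "0 < tail (F k j) u" if kj: "k \<in> {1..d}" "j \<in> {1..r}" for k j u
  proof (rule antimono_regularly_varying_pos[OF RV[OF kj]])
    show "antimono (tail (F k j))"
    proof (rule antimonoI)
      fix x y :: real assume "x \<le> y"
      note [measurable] = claim_rv[OF kj order_refl]
      show "tail (F k j) y \<le> tail (F k j) x"
        unfolding claim_tail[OF kj order_refl, symmetric]
      proof (rule finite_measure_mono)
        show "{\<omega> \<in> space M. X k j 1 \<omega> > x} \<in> events" by measurable
      qed (use \<open>x \<le> y\<close> in auto)
    qed
    show "0 \<le> tail (F k j) x" for x unfolding claim_tail[OF kj order_refl, symmetric] by simp
  qed
  have wint: "integrable M (\<lambda>\<omega>. weight a i t \<omega> powr (\<alpha> / 2))" "integrable M (\<lambda>\<omega>. weight a i t \<omega> powr \<alpha>')"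
    "mean_weight (\<alpha> / 2) a i t \<le> \<rho> b1 a ^ i * ?L a t"
    "mean_weight \<alpha>' a i t \<le> \<rho> b2 a ^ i * ?L a t" if "a \<in> ?A" for a i t
    using weight_moment_bound[OF _ _ int1 \<alpha>1(1) b1_def[symmetric] b1(2), of "fst a" "snd a" i t]
      weight_moment_bound[OF _ _ int \<alpha>1(3) b2_def[symmetric] b2(2), of "fst a" "snd a" i t] that
    by (auto simp: \<rho>_def)
  have "weighted_claims M ?A (\<lambda>a i. X (fst a) (snd a) (Suc i))
    (\<lambda>a. tail (F (fst a) (snd a))) weight_algebra weight ?L UNIV (\<alpha> / 2) \<alpha> \<alpha>' q 2"
  proof (unfold_locales)
    show "finite ?A" "?A \<noteq> {}" using finA neA .
    show "0 < \<alpha> / 2" "\<alpha> / 2 < \<alpha>" "\<alpha> < \<alpha>'" "0 \<le> q" "q < 1" "0 \<le> (2::real)" using \<alpha> q0 q1 by auto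
    show "subalgebra M weight_algebra" by (rule subalgebra_weight)
    show "0 \<le> X (fst a) (snd a) (Suc i) \<omega>" if "a \<in> ?A" "\<omega> \<in> space M" for a i \<omega>
      using that by (intro claim_nonneg) auto
    show "\<P>(\<omega> in M. X (fst a) (snd a) (Suc i) \<omega> > u) = tail (F (fst a) (snd a)) u" if "a \<in> ?A" for a i u
      using that by (intro claim_tail) auto
    show "regularly_varying (- \<alpha>) (tail (F (fst a) (snd a)))" if "a \<in> ?A" for a
      using that by (intro RV) auto
    show "indep_var borel (X (fst a) (snd a) (Suc i)) borel U" if "a \<in> ?A" "U \<in> borel_measurable weight_algebra" for a i U
      using that by (intro claim_weight_indep_var) auto
    show "\<P>(\<omega> in M. X (fst a) (snd a) (Suc i) \<omega> > u \<and> X (fst b) (snd b) (Suc j) \<omega> > u \<and> \<omega> \<in> B) =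
      \<P>(\<omega> in M. X (fst a) (snd a) (Suc i) \<omega> > u \<and> X (fst b) (snd b) (Suc j) \<omega> > u) * prob B"
      if "a \<in> ?A" "b \<in> ?A" "B \<in> sets weight_algebra" for a i b j u B
      using that by (intro claims_weight_indep) auto
    show "((\<lambda>y. \<P>(\<omega> in M. X (fst a) (snd a) (Suc i) \<omega> > y \<and> X (fst b) (snd b) (Suc j) \<omega> > y) / tail (F (fst a) (snd a)) y) \<longlongrightarrow> 0) at_top"
      if ab: "a \<in> ?A" "b \<in> ?A" "(a, i) \<noteq> (b, j)" for a i b j
    proof -
      have a: "fst a \<in> {1..d}" "snd a \<in> {1..r}" "Suc i \<ge> 1" and b: "fst b \<in> {1..d}" "snd b \<in> {1..r}" "Suc j \<ge> 1"
        using ab by auto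
      have "asymptotically_independent (X (fst a) (snd a) (Suc i)) (X (fst b) (snd b) (Suc j))"
        using a b by (rule claims_PAI) (use ab(3) in \<open>auto simp: prod_eq_iff\<close>)
      then have "((\<lambda>y. \<P>(\<omega> in M. X (fst a) (snd a) (Suc i) \<omega> > y \<and> X (fst b) (snd b) (Suc j) \<omega> > y)
          / \<P>(\<omega> in M. X (fst a) (snd a) (Suc i) \<omega> > y)) \<longlongrightarrow> 0) at_top"
      proof (rule asymptotically_independent_joint_tail)
        show "(\<lambda>u. \<P>(\<omega> in M. X (fst b) (snd b) (Suc j) \<omega> > u)) \<in> O(\<lambda>u. \<P>(\<omega> in M. X (fst a) (snd a) (Suc i) \<omega> > u))"
          unfolding claim_tail[OF a] claim_tail[OF b] using comparable[OF b(1,2) a(1,2)] by (rule bigthetaD1)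
      qed (use a b in \<open>auto intro: claim_rv claim_nonneg simp: claim_tail pos\<close>)
      then show ?thesis by (simp only: claim_tail[OF a])
    qed
    show "weight a i t \<in> borel_measurable weight_algebra" if "a \<in> ?A" for a i t
      using weight_measurable[of "fst a" "snd a" i t] that by auto
    show "0 \<le> weight a i t \<omega>" for a i t \<omega> by (rule weight_nonneg)
    show "integrable M (\<lambda>\<omega>. weight a i t \<omega> powr (\<alpha> / 2))" "integrable M (\<lambda>\<omega>. weight a i t \<omega> powr \<alpha>')" if "a \<in> ?A" for a i t
      using wint that by blast+
    show "expectation (\<lambda>\<omega>. weight a i t \<omega> powr (\<alpha> / 2) + weight a i t \<omega> powr \<alpha>') \<le> 2 * q ^ i * ?L a t" if a: "a \<in> ?A" for a i t
    proof -
      have "expectation (\<lambda>\<omega>. weight a i t \<omega> powr (\<alpha> / 2) + weight a i t \<omega> powr \<alpha>')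
          = mean_weight (\<alpha> / 2) a i t + mean_weight \<alpha>' a i t"
        using wint(1,2)[OF a] by simp
      also have "\<dots> \<le> \<rho> b1 a ^ i * ?L a t + \<rho> b2 a ^ i * ?L a t"
        using wint(3,4)[OF a] by (intro add_mono)
      also have "\<dots> \<le> q ^ i * ?L a t + q ^ i * ?L a t"
        using qge[OF a] \<rho>(1)[OF a b1] \<rho>(1)[OF a b2] by (intro add_mono mult_right_mono power_mono) auto
      finally show ?thesis by simp
    qed
    show "\<P>(\<omega> in M. weight a i t \<omega> > 0) \<le> ?L a t" if a: "a \<in> ?A" for a i t
    proof (rule finite_measure_mono)
      have kj: "fst a \<in> {1..d}" "snd a \<in> {1..r}" using a by auto
      note [measurable] = arrival_measurable[OF kj]
      show "arrived (fst a) (snd a) 0 t \<in> events" by measurable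
      show "{\<omega> \<in> space M. weight a i t \<omega> > 0} \<subseteq> (arrived (fst a) (snd a) 0 t)"
      proof safe
        fix \<omega> assume w: "\<omega> \<in> space M" "0 < weight a i t \<omega>"
        then have le: "ereal (\<tau> (fst a) (snd a) i \<omega>) \<le> t"
          by (cases "ereal (\<tau> (fst a) (snd a) i \<omega>) \<le> t") (simp_all add: weight_def)
        have "ereal (\<tau> (fst a) (snd a) 0 \<omega>) \<le> ereal (\<tau> (fst a) (snd a) i \<omega>)"
          by (simp add: arrival_mono[OF kj w(1)])
        then show "ereal (\<tau> (fst a) (snd a) 0 \<omega>) \<le> t" using le by (rule order_trans)
      qed
    qed
  qed
  then show thesis by (rule that)
qed

end

theorem theorem3p1:
  fixes M :: "'a measure" and d r :: nat
    and X \<theta> :: "nat \<Rightarrow> nat \<Rightarrow> nat \<Rightarrow> 'a \<Rightarrow> real"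
    and F :: "nat \<Rightarrow> nat \<Rightarrow> real \<Rightarrow> real"
    and R :: "real \<Rightarrow> 'a \<Rightarrow> real" and c :: "nat \<Rightarrow> real"
    and \<alpha> \<alpha>' :: real
  assumes model: "renewal_model M d r X F \<theta> R c"
    and alpha_pos: "\<alpha> > 0"
    and RV: "\<And>k j. \<lbrakk>k \<in> {1..d}; j \<in> {1..r}\<rbrakk> \<Longrightarrow> regularly_varying (- \<alpha>) (tail (F k j))"
    and comparable: "\<And>k j k' j'. \<lbrakk>k \<in> {1..d}; j \<in> {1..r}; k' \<in> {1..d}; j' \<in> {1..r}\<rbrakk> \<Longrightarrow>
      tail (F k j) \<in> \<Theta>[at_top](tail (F k' j'))"
    and alpha': "\<alpha>' > \<alpha>" "laplace_exponent M R \<alpha>' < 0"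
  shows
    "let \<phi> = real_of_ereal (laplace_exponent M R \<alpha>);
         \<Lambda> = renewal_times M d r \<theta>;
         asymptotics = (\<lambda>x t. \<Sum>k=1..d. \<Sum>j=1..r.
           tail (F k j) x * renewal_integral M \<theta> k j (\<lambda>s. exp (s * \<phi>)) t)
     in uniformly_asymp_equiv \<Lambda>
          (\<lambda>x t. \<P>(\<omega> in M. total_discounted_claims d r X \<theta> R t \<omega> > ennreal x)) asymptotics
      \<and> (\<forall>T\<in>\<Lambda>. uniformly_asymp_equiv (\<Lambda> \<inter> {T..\<infinity>})
          (\<lambda>x t. \<P>(\<omega> in M. net_loss d r X \<theta> R c t \<omega> > ereal x)) asymptotics)"
proof -
  interpret renewal_model M d r X F \<theta> R c by (rule model)
  let ?A = "{1..d} \<times> {1..r}"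
  let ?L = "\<lambda>a t. prob (arrived (fst a) (snd a) 0 t)"
  have R1: "R 1 \<in> borel_measurable M" by (rule levy_rv[OF levy]) simp
  have int: "integrable M (\<lambda>\<omega>. exp (- \<alpha>' * R 1 \<omega>))"
    using alpha'(2) unfolding laplace_exponent_def by (auto split: if_splits)
  have E_pos: "0 < laplace R \<alpha>'"
    by (rule expectation_greater[OF int]) simp
  have lt1: "laplace R \<alpha>' < 1"
  proof -
    have "ln (laplace R \<alpha>') < 0"
      using alpha'(2) int by (simp add: laplace_exponent_def)
    then show ?thesis using E_pos by simp
  qed
  have \<alpha>: "\<alpha> \<le> \<alpha>'" "0 < \<alpha>'" using alpha_pos alpha'(1) by auto
  define b where "b = laplace R \<alpha>"
  note int_a = exp_moment_smaller_exponent(1)[OF R1 int lt1 alpha_pos \<alpha>(1)]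
  have b: "0 < b" "b < 1"
    unfolding b_def by (rule expectation_greater[OF int_a], simp)
      (rule exp_moment_smaller_exponent(2)[OF R1 int lt1 alpha_pos \<alpha>(1)])
  \<comment> \<open>The exponent at \<alpha> is finite because the moment at the larger \<alpha>'
    is, so the conversion to a real number does not fall back on a default.\<close>
  have \<phi>: "real_of_ereal (laplace_exponent M R \<alpha>) = ln b"
    using int_a by (simp add: laplace_exponent_def b_def)
  obtain q where "weighted_claims M ?A (\<lambda>a i. X (fst a) (snd a) (Suc i))
    (\<lambda>a. tail (F (fst a) (snd a))) weight_algebra weight ?L UNIV (\<alpha> / 2) \<alpha> \<alpha>' q 2"
    using weighted_claims_renewal[OF alpha_pos alpha'(1) RV comparable int lt1] by blast
  then interpret W: weighted_claims M ?A "\<lambda>a i. X (fst a) (snd a) (Suc i)"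
    "\<lambda>a. tail (F (fst a) (snd a))" weight_algebra weight ?L UNIV "\<alpha> / 2" \<alpha> \<alpha>' q 2 .
  define \<Lambda> where "\<Lambda> = renewal_times M d r \<theta>"
  have main: "W.main_term = (\<lambda>x t. \<Sum>k=1..d. \<Sum>j=1..r. tail (F k j) x * renewal_integral M \<theta> k j (\<lambda>s. exp (s * ln b)) t)"
  proof (intro ext)
    fix x t
    have "W.main_term x t = (\<Sum>a\<in>?A. tail (F (fst a) (snd a)) x * renewal_integral M \<theta> (fst a) (snd a) (\<lambda>s. exp (s * ln b)) t)"
      unfolding W.main_term_def
    proof (rule sum.cong[OF refl])
      fix a assume a: "a \<in> ?A"
      then have kj: "fst a \<in> {1..d}" "snd a \<in> {1..r}" by auto
      show "tail (F (fst a) (snd a)) x * (\<Sum>i. mean_weight \<alpha> a i t) =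
          tail (F (fst a) (snd a)) x * renewal_integral M \<theta> (fst a) (snd a) (\<lambda>s. exp (s * ln b)) t"
        using renewal_integral_weights[OF kj int_a alpha_pos b_def[symmetric] b(2), of t] W.summable_V_alpha[OF a UNIV_I, of t]
        by simp
    qed
    then show "W.main_term x t = (\<Sum>k=1..d. \<Sum>j=1..r. tail (F k j) x * renewal_integral M \<theta> k j (\<lambda>s. exp (s * ln b)) t)"
      by (simp add: sum.cartesian_product')
  qed
  have total: "W.total t \<omega> = total_discounted_claims d r X \<theta> R t \<omega>" for t \<omega>
    unfolding W.total_def total_discounted_claims_eq ..
  have L_pos: "0 < ?L a t" if "a \<in> ?A" "t \<in> \<Lambda>" for a t
    using that by (intro renewal_function_pos_first_arrival) (auto simp: \<Lambda>_def renewal_times_def)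
  \<comment> \<open>The term of the first claim alone bounds the moment series from below. The
    constant depends on the type but not on \<open>t\<close>; the minimum over the types is taken
    afterwards.\<close>
  have "\<forall>a\<in>?A. \<exists>\<kappa>>0. \<forall>t. \<kappa> * ?L a t \<le> (\<Sum>i. mean_weight \<alpha> a i t)"
  proof
    fix a assume a: "a \<in> ?A"
    then have kj: "fst a \<in> {1..d}" "snd a \<in> {1..r}" by auto
    obtain \<kappa> where \<kappa>: "0 < \<kappa>" "\<And>t. \<kappa> * ?L a t \<le>
      expectation (\<lambda>\<omega>. of_bool (ereal (\<tau> (fst a) (snd a) 0 \<omega>) \<le> t) * b powr \<tau> (fst a) (snd a) 0 \<omega>)"
      using first_arrival_lower[OF kj b] by blast
    have "\<kappa> * ?L a t \<le> (\<Sum>i. mean_weight \<alpha> a i t)" for t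
    proof -
      note [measurable] = arrival_measurable[OF kj]
      have "ennreal (expectation (\<lambda>\<omega>. of_bool (ereal (\<tau> (fst a) (snd a) 0 \<omega>) \<le> t) * b powr \<tau> (fst a) (snd a) 0 \<omega>))
          \<le> (\<integral>\<^sup>+\<omega>. ennreal (of_bool (ereal (\<tau> (fst a) (snd a) 0 \<omega>) \<le> t) * b powr \<tau> (fst a) (snd a) 0 \<omega>) \<partial>M)"
        by (subst integral_eq_nn_integral) (auto simp: ennreal_enn2real_if)
      also have "\<dots> = (\<integral>\<^sup>+\<omega>. of_bool (ereal (\<tau> (fst a) (snd a) 0 \<omega>) \<le> t) * ennreal (b powr \<tau> (fst a) (snd a) 0 \<omega>) \<partial>M)"
        by (intro nn_integral_cong) (simp add: of_bool_def)
      also have "\<dots> = (\<integral>\<^sup>+\<omega>. ennreal (weight (fst a, snd a) 0 t \<omega> powr \<alpha>) \<partial>M)"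
        unfolding b_def by (rule weight_moment[OF kj int_a alpha_pos, symmetric])
      also have "\<dots> = ennreal (mean_weight \<alpha> (fst a, snd a) 0 t)"
        by (rule nn_integral_eq_integral[OF weight_moment_bound(1)[OF kj int_a alpha_pos b_def[symmetric] b(2)]]) simp
      finally have "expectation (\<lambda>\<omega>. of_bool (ereal (\<tau> (fst a) (snd a) 0 \<omega>) \<le> t) * b powr \<tau> (fst a) (snd a) 0 \<omega>)
          \<le> mean_weight \<alpha> a 0 t"
        by (simp add: ennreal_le_iff)
      also have "\<dots> \<le> (\<Sum>i. mean_weight \<alpha> a i t)"
        using sum_le_suminf[OF W.summable_V_alpha[OF a UNIV_I, of t], of "{0}"] by simp
      finally show ?thesis using \<kappa>(2)[of t] by linarith
    qed
    then show "\<exists>\<kappa>>0. \<forall>t. \<kappa> * ?L a t \<le> (\<Sum>i. mean_weight \<alpha> a i t)"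
      using \<kappa>(1) by blast
  qed
  from bchoice[OF this] obtain \<kappa>f where \<kappa>f: "\<forall>a\<in>?A. 0 < \<kappa>f a \<and> (\<forall>t. \<kappa>f a * ?L a t \<le> (\<Sum>i. mean_weight \<alpha> a i t))" ..
  define \<kappa> where "\<kappa> = Min (\<kappa>f ` ?A)"
  have \<kappa>: "0 < \<kappa>"
    unfolding \<kappa>_def using W.finite_A W.A_nonempty \<kappa>f by (subst Min_gr_iff) auto
  have low: "\<kappa> * ?L a t \<le> (\<Sum>i. mean_weight \<alpha> a i t)" if a: "a \<in> ?A" for a t
  proof -
    have "\<kappa> * ?L a t \<le> \<kappa>f a * ?L a t"
      unfolding \<kappa>_def using W.finite_A a by (intro mult_right_mono Min_le) auto
    also have "\<dots> \<le> (\<Sum>i. mean_weight \<alpha> a i t)" using \<kappa>f a by blast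
    finally show ?thesis .
  qed
  have "uniformly_asymp_equiv \<Lambda> (\<lambda>x t. \<P>(\<omega> in M. total_discounted_claims d r X \<theta> R t \<omega> > ennreal x)) W.main_term"
  proof (rule W.uniformly_asymp_equiv_main_term[OF subset_UNIV \<kappa> L_pos low])
    fix \<epsilon> :: real assume "0 < \<epsilon>"
    from W.total_asymp[OF this]
    show "\<forall>\<^sub>F x in at_top. \<forall>t\<in>\<Lambda>. \<bar>\<P>(\<omega> in M. total_discounted_claims d r X \<theta> R t \<omega> > ennreal x) - W.main_term x t\<bar> \<le> \<epsilon> * W.scale x t"
      unfolding total by eventually_elim blast
  qed
  moreover have "uniformly_asymp_equiv (\<Lambda> \<inter> {T..\<infinity>}) (\<lambda>x t. \<P>(\<omega> in M. net_loss d r X \<theta> R c t \<omega> > ereal x)) W.main_term"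
    if T: "T \<in> \<Lambda>" for T
  proof (rule W.uniformly_asymp_equiv_main_term[OF subset_UNIV \<kappa>])
    show "0 < ?L a t" if "a \<in> ?A" "t \<in> \<Lambda> \<inter> {T..\<infinity>}" for a t using that by (intro L_pos) auto
    show "\<kappa> * ?L a t \<le> (\<Sum>i. mean_weight \<alpha> a i t)" if "a \<in> ?A" for a t
      using that by (rule low)
    fix \<epsilon> :: real assume \<epsilon>: "0 < \<epsilon>"
    \<comment> \<open>Membership of \<open>T\<close> in \<Lambda> makes these probabilities
      positive, and they are nondecreasing in \<open>t\<close>. This is where the restriction to
      \<open>t \<ge> T\<close> is used.\<close>
    define l where "l = Min ((\<lambda>a. ?L a T) ` ?A)"
    have l: "0 < l"
      unfolding l_def using W.finite_A W.A_nonempty L_pos[OF _ T] by (subst Min_gr_iff) auto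
    show "\<forall>\<^sub>F x in at_top. \<forall>t\<in>\<Lambda> \<inter> {T..\<infinity>}. \<bar>\<P>(\<omega> in M. net_loss d r X \<theta> R c t \<omega> > ereal x) - W.main_term x t\<bar> \<le> \<epsilon> * W.scale x t"
    \<comment> \<open>Weights with infinite horizon dominate those at every \<open>t\<close>, and
      the premium of all lines over the whole half-line dominates the premium up to
      \<open>t\<close>. Neither depends on \<open>t\<close>, which gives uniformity.\<close>
    proof (rule W.net_asymp[OF subset_UNIV l _ _ _ _ _ _ _ _ _ _ _ \<epsilon>,
        where U = "\<lambda>a i. weight a i \<infinity>" and J = "\<lambda>\<omega>. ennreal (\<Sum>k=1..d. c k) * discount_integral R \<infinity> \<omega>"
          and D = "\<lambda>t x. {\<omega> \<in> space M. net_loss d r X \<theta> R c t \<omega> > ereal x}"])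
      show "l \<le> ?L a t" if a: "a \<in> ?A" and t: "t \<in> \<Lambda> \<inter> {T..\<infinity>}" for a t
      proof -
        have kj: "fst a \<in> {1..d}" "snd a \<in> {1..r}" using a by auto
        note [measurable] = arrival_measurable[OF kj]
        have "l \<le> ?L a T" unfolding l_def using W.finite_A a by (intro Min_le) auto
        also have "\<dots> \<le> ?L a t" using t by (intro finite_measure_mono) (auto intro: order_trans)
        finally show ?thesis .
      qed
      show "weight a i \<infinity> \<in> borel_measurable weight_algebra" if "a \<in> ?A" for a i
        using that by (rule W.V_meas) simp
      show "integrable M (\<lambda>\<omega>. weight a i \<infinity> \<omega> powr (\<alpha> / 2))" "integrable M (\<lambda>\<omega>. weight a i \<infinity> \<omega> powr \<alpha>')" if "a \<in> ?A" for a i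
        using that by (intro W.V_int; simp)+
      show "0 \<le> weight a i \<infinity> \<omega>" for a i \<omega> by (rule weight_nonneg)
      show "weight a i t \<omega> \<le> weight a i \<infinity> \<omega>" for a i t \<omega> by (simp add: weight_def)
      show "(\<lambda>\<omega>. ennreal (\<Sum>k=1..d. c k) * discount_integral R \<infinity> \<omega>) \<in> borel_measurable weight_algebra"
        using discount_integral_measurable[of \<infinity>] by measurable
      show "AE \<omega> in M. ennreal (\<Sum>k=1..d. c k) * discount_integral R \<infinity> \<omega> < \<infinity>"
        using discount_integral_finite[OF levy int \<alpha>(2) lt1]
        by eventually_elim (simp add: ennreal_mult_less_top)
      show "{\<omega> \<in> space M. net_loss d r X \<theta> R c t \<omega> > ereal x} \<in> events" for t x
      proof -
        note [measurable] = net_loss_measurable[of t]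
        show ?thesis by measurable
      qed
      show "{\<omega> \<in> space M. net_loss d r X \<theta> R c t \<omega> > ereal x} \<subseteq> {\<omega> \<in> space M. W.total t \<omega> > ennreal x}" if "0 < x" for t x
      proof safe
        fix \<omega> assume "ereal x < net_loss d r X \<theta> R c t \<omega>"
        also have "\<dots> \<le> enn2ereal (W.total t \<omega>)" unfolding total by (rule net_loss_le)
        finally have "enn2ereal (ennreal x) < enn2ereal (W.total t \<omega>)" using that by simp
        then show "ennreal x < W.total t \<omega>" by (simp add: less_ennreal.rep_eq)
      qed
      show "\<omega> \<in> {\<omega> \<in> space M. net_loss d r X \<theta> R c t \<omega> > ereal x}"
        if "0 < x" "0 < y" "\<omega> \<in> space M" "a \<in> ?A" "X (fst a) (snd a) (Suc i) \<omega> * weight a i t \<omega> > x + y"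
          "ennreal (\<Sum>k=1..d. c k) * discount_integral R \<infinity> \<omega> \<le> ennreal y" for t x y a i \<omega>
        using net_loss_gt[of "fst a" "snd a" x y i \<omega> t] that by auto
    qed
  qed
  ultimately show ?thesis
    unfolding Let_def \<phi> main \<Lambda>_def by blast
qed

end
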